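(* Let $R=K[X_1,\dots,X_d]$ be a polynomial ring in $d$ variables over a field $K$, let $m_R=(X_1,\dots,X_d)$, let $I_1,\dots,I_r$ be monomial ideals of $R$ and let $J$ be any ideal of $R$. Then the symbolic multi-Rees algebra $S_J(I_1,\dots,I_r)$ is a Noetherian $\mathbb{N}^r$-graded $R$-algebra. If $J=m_R$, there exists a piecewise quasi-polynomial $F:\mathbb{N}^r\to\mathbb{N}$ such that $$l_R\left(H^0_{m_R}\left(\frac{R}{I_1^{n_1}\cdots I_r^{n_r}}\right)\right)=F(n_1,\dots,n_r)$$ for all $n_1,\dots,n_r\gg 0$. Moreover, this length function is bounded above, for all $n_1,\dots,n_r\gg0$, by a numerical polynomial in $n_1,\dots,n_r$ of total degree at most $d$.
   Context: For ideals $I_1,\dots,I_r,J$ of a ring $R$ and $\mathbf{n}=(n_1,\dots,n_r)\in\mathbb{N}^r$ write $\mathbf{I}^{\mathbf{n}}=I_1^{n_1}\cdots I_r^{n_r}$ and $\mathbf{t}^{\mathbf{n}}=t_1^{n_1}\cdots t_r^{n_r}$ with $t_i$ indeterminates. The symbolic multi-Rees algebra is $S_J(I_1,\dots,I_r)=\bigoplus_{\mathbf{n}\in\mathbb{N}^r}(\mathbf{I}^{\mathbf{n}}:_R J^\infty)\mathbf{t}^{\mathbf{n}}\subseteq R[t_1,\dots,t_r]$, where $I:_RJ^\infty=\bigcup_{k}(I:_RJ^k)$. $H^0_{m_R}(N)$ denotes the submodule of elements of $N$ annihilated by a power of $m_R$. A numerical polynomial is a polynomial in $\mathbb{Q}[n_1,\dots,n_r]$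 taking integer values at integer points. A map $\sigma:\mathbb{N}^r\to\mathbb{Q}$ is periodic if there is $\alpha\in\mathbb{N}$ with $\sigma(\mathbf{n}+\alpha\mathbf{e}_i)=\sigma(\mathbf{n})$ for all $\mathbf{n}$ and all $i$ ($\mathbf{e}_i$ the standard unit vectors). A quasi-polynomial is a function $f:\mathbb{N}^r\to\mathbb{Q}$ of the form $f(\mathbf{n})=\sum_{|\mathbf{i}|\le D}\sigma_{\mathbf{i}}(\mathbf{n})n_1^{i_1}\cdots n_r^{i_r}$ with all $\sigma_{\mathbf{i}}$ periodic. A piecewise quasi-polynomial is a function $F$ on $\mathbb{N}^r$ for which there is a finite partition $\mathbb{N}^r=\bigcup_{i=1}^t(P_i\cap\mathbb{N}^r)$ with $P_i$ polyhedra (not necessarily full-dimensional) and quasi-polynomials $f_i$ with $F=f_i$ on $P_i\cap\mathbb{N}^r$. *)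

theory Defs
  imports "HOL-Analysis.Analysis" "HOL-Library.Poly_Mapping" "HOL-Library.Extended_Nat"
begin

definition is_ideal :: "'a::comm_ring_1 set \<Rightarrow> bool" where
  "is_ideal I \<longleftrightarrow> 0 \<in> I \<and> (\<forall>x\<in>I. \<forall>y\<in>I. x + y \<in> I) \<and> (\<forall>x\<in>I. \<forall>a. a * x \<in> I)"

definition ideal_gen :: "'a::comm_ring_1 set \<Rightarrow> 'a set" where
  "ideal_gen S = \<Inter>{I. is_ideal I \<and> S \<subseteq> I}"

definition ideal_mult :: "'a::comm_ring_1 set \<Rightarrow> 'a set \<Rightarrow> 'a set" where
  "ideal_mult I J = ideal_gen {x * y | x y. x \<in> I \<and> y \<in> J}"

primrec ideal_pow :: "'a::comm_ring_1 set \<Rightarrow> nat \<Rightarrow> 'a set" where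
  "ideal_pow I 0 = UNIV"
| "ideal_pow I (Suc k) = ideal_mult I (ideal_pow I k)"

definition ideal_multipow :: "('r::finite \<Rightarrow> 'a::comm_ring_1 set) \<Rightarrow> ('r \<Rightarrow> nat) \<Rightarrow> 'a set" where
  "ideal_multipow I n = ideal_gen {(\<Prod>j\<in>UNIV. f j) | f. \<forall>j. f j \<in> ideal_pow (I j) (n j)}"

definition saturation :: "'a::comm_ring_1 set \<Rightarrow> 'a set \<Rightarrow> 'a set" where
  "saturation I J = {x. \<exists>k. \<forall>y\<in>ideal_pow J k. y * x \<in> I}"

type_synonym ('v, 'k) mpoly = "('v \<Rightarrow>\<^sub>0 nat) \<Rightarrow>\<^sub>0 'k"

definition monom :: "('v \<Rightarrow>\<^sub>0 nat) \<Rightarrow> ('v, 'k::field) mpoly" where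
  "monom a = Poly_Mapping.single a 1"

definition Var :: "'v \<Rightarrow> ('v, 'k::field) mpoly" where
  "Var v = monom (Poly_Mapping.single v 1)"

definition monomial_ideal :: "('v, 'k::field) mpoly set \<Rightarrow> bool" where
  "monomial_ideal I \<longleftrightarrow> (\<exists>M \<subseteq> range monom. I = ideal_gen M)"

definition max_ideal :: "('v, 'k::field) mpoly set" where
  "max_ideal = ideal_gen (range Var)"

text \<open>Elements of \<open>R[t_1,\<dots>,t_r]\<close> are finitely supported maps \<open>\<nat>^r \<rightarrow> R\<close>, \<open>n \<mapsto>\<close> coefficient of \<open>t^n\<close>.\<close>
definition symb_multi_rees ::
  "('a::comm_ring_1) set \<Rightarrow> ('r::finite \<Rightarrow> 'a set) \<Rightarrow> (('r \<Rightarrow>\<^sub>0 nat) \<Rightarrow>\<^sub>0 'a) set" where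
  "symb_multi_rees J I =
     {P. \<forall>n. Poly_Mapping.lookup P n \<in> saturation (ideal_multipow I (Poly_Mapping.lookup n)) J}"

definition is_subring :: "'a::comm_ring_1 set \<Rightarrow> bool" where
  "is_subring A \<longleftrightarrow> 1 \<in> A \<and> (\<forall>x\<in>A. \<forall>y\<in>A. x + y \<in> A \<and> x - y \<in> A \<and> x * y \<in> A)"

definition ideal_of :: "'a::comm_ring_1 set \<Rightarrow> 'a set \<Rightarrow> bool" where
  "ideal_of A I \<longleftrightarrow> I \<subseteq> A \<and> 0 \<in> I \<and> (\<forall>x\<in>I. \<forall>y\<in>I. x + y \<in> I) \<and> (\<forall>a\<in>A. \<forall>x\<in>I. a * x \<in> I)"

definition noetherian_subring :: "'a::comm_ring_1 set \<Rightarrow> bool" where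
  "noetherian_subring A \<longleftrightarrow>
     is_subring A \<and>
     (\<forall>L :: nat \<Rightarrow> 'a set. (\<forall>i. ideal_of A (L i)) \<and> (\<forall>i. L i \<subseteq> L (Suc i)) \<longrightarrow>
        (\<exists>N. \<forall>m\<ge>N. L m = L N))"

section \<open>Length of \<open>H^0_{m_R}(R/I) = (I :_R m_R^\<infinity>)/I\<close>\<close>

text \<open>Length of the \<open>R\<close>-module \<open>B/A\<close> for ideals \<open>A \<subseteq> B\<close>: supremum of lengths of
  strict chains of submodules, i.e. of ideals \<open>A = L_0 \<subset> \<dots> \<subset> L_n = B\<close>.\<close>
definition quot_length :: "'a::comm_ring_1 set \<Rightarrow> 'a set \<Rightarrow> enat" where
  "quot_length A B = Sup {enat n | n. \<exists>L :: nat \<Rightarrow> 'a set.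
      L 0 = A \<and> L n = B \<and> (\<forall>i\<le>n. is_ideal (L i)) \<and> (\<forall>i<n. L i \<subset> L (Suc i))}"

definition H0_length :: "('v, 'k::field) mpoly set \<Rightarrow> enat" where
  "H0_length I = quot_length I (saturation I max_ideal)"

definition periodic_fun :: "(('r::finite \<Rightarrow> nat) \<Rightarrow> rat) \<Rightarrow> bool" where
  "periodic_fun \<sigma> \<longleftrightarrow> (\<exists>\<alpha>::nat. \<alpha> > 0 \<and> (\<forall>n j. \<sigma> (n(j := n j + \<alpha>)) = \<sigma> n))"

definition quasi_poly :: "(('r::finite \<Rightarrow> nat) \<Rightarrow> rat) \<Rightarrow> bool" where
  "quasi_poly f \<longleftrightarrow> (\<exists>(D::nat) (\<sigma> :: ('r \<Rightarrow> nat) \<Rightarrow> ('r \<Rightarrow> nat) \<Rightarrow> rat).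
     (\<forall>i. periodic_fun (\<sigma> i)) \<and>
     (\<forall>n. f n = (\<Sum>i\<in>{i. sum i UNIV \<le> D}. \<sigma> i n * (\<Prod>j\<in>UNIV. of_nat (n j) ^ i j))))"

definition lattice_pt :: "('r::finite \<Rightarrow> nat) \<Rightarrow> real ^ 'r" where
  "lattice_pt n = (\<chi> j. real (n j))"

definition piecewise_quasi_poly :: "(('r::finite \<Rightarrow> nat) \<Rightarrow> rat) \<Rightarrow> bool" where
  "piecewise_quasi_poly F \<longleftrightarrow>
     (\<exists>(t::nat) (P :: nat \<Rightarrow> (real ^ 'r) set) (f :: nat \<Rightarrow> ('r \<Rightarrow> nat) \<Rightarrow> rat).
        (\<forall>i<t. polyhedron (P i) \<and> quasi_poly (f i)) \<and>
        (\<forall>n. \<exists>!i. i < t \<and> lattice_pt n \<in> P i) \<and>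
        (\<forall>i<t. \<forall>n. lattice_pt n \<in> P i \<longrightarrow> F n = f i n))"

definition poly_eval :: "nat \<Rightarrow> (('r::finite \<Rightarrow> nat) \<Rightarrow> rat) \<Rightarrow> ('r \<Rightarrow> int) \<Rightarrow> rat" where
  "poly_eval D c x = (\<Sum>i\<in>{i. sum i UNIV \<le> D}. c i * (\<Prod>j\<in>UNIV. of_int (x j) ^ i j))"

definition numerical_poly :: "nat \<Rightarrow> (('r::finite \<Rightarrow> nat) \<Rightarrow> rat) \<Rightarrow> bool" where
  "numerical_poly D c \<longleftrightarrow> (\<forall>x. poly_eval D c x \<in> \<int>)"

end

theory Submission
  imports Defs "HOL-Library.Multiset_Order"
begin

text \<open>
  The associated primes of a monomial ideal are generated by variables. Hence
  \<open>I^n : J^\<infinity>\<close> is spanned by the monomials \<open>X^a\<close> that lie in the contraction of the localisation of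
  \<open>I^n\<close> at \<open>(X_i : i \<in> A)\<close>, for every set \<open>A\<close> of variables whose prime does not contain \<open>J\<close>.
  For fixed \<open>A\<close> the pairs \<open>(a, n)\<close> form a finitely generated monoid, and by Dickson's lemma an
  intersection of finitely generated monoids is finitely generated. So the symbolic multi-Rees
  algebra is a finitely generated monoid algebra over \<open>K\<close>, and Hilbert's basis theorem applies.

  For \<open>J = m_R\<close> the length is the number of monomials in \<open>I^n : m_R^\<infinity>\<close> outside \<open>I^n\<close>.
  Dropping one variable \<open>X_i\<close> at a time shows that such a monomial has all exponents below \<open>c|n|\<close>,
  where \<open>c\<close> bounds the exponents of the generators; this gives the bound \<open>(c|n|)^d\<close>. Cutting both
  monoids by \<open>a_i \<le> c|n|\<close> makes all fibres over \<open>n\<close> finite, and the length becomes a difference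
  of two fibre counting functions of finitely generated monoids. Counting each element through its
  least representation by generators makes such a function an alternating sum of shifted vector
  partition functions, which arise by iterated summation over intervals with affine bounds and are
  therefore piecewise quasi-polynomial.
\<close>

section \<open>Summation in algebras of floor functions and indicators\<close>

inductive_set quasi_algebra :: "('x \<Rightarrow> int) set \<Rightarrow> ('x \<Rightarrow> rat) set" for L :: "('x \<Rightarrow> int) set" where
  floor: "l \<in> L \<Longrightarrow> a > 0 \<Longrightarrow> (\<lambda>x. of_int (l x div a)) \<in> quasi_algebra L"
| indicator: "l \<in> L \<Longrightarrow> (\<lambda>x. of_bool (l x \<ge> 0)) \<in> quasi_algebra L"
| const: "(\<lambda>x. c) \<in> quasi_algebra L"
| add: "f \<in> quasi_algebra L \<Longrightarrow> g \<in> quasi_algebra L \<Longrightarrow> (\<lambda>x. f x + g x) \<in> quasi_algebra L"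
| mult: "f \<in> quasi_algebra L \<Longrightarrow> g \<in> quasi_algebra L \<Longrightarrow> (\<lambda>x. f x * g x) \<in> quasi_algebra L"

lemma quasi_algebra_diff:
  assumes "f \<in> quasi_algebra L" "g \<in> quasi_algebra L"
  shows "(\<lambda>x. f x - g x) \<in> quasi_algebra L"
  using quasi_algebra.add[OF assms(1) quasi_algebra.mult[OF quasi_algebra.const[of "-1"] assms(2)]]
  by simp

lemma quasi_algebra_sum:
  assumes "\<And>i. i \<in> A \<Longrightarrow> f i \<in> quasi_algebra L"
  shows "(\<lambda>x. \<Sum>i\<in>A. f i x) \<in> quasi_algebra L"
  using assms
  by (induction A rule: infinite_finite_induct) (auto intro: quasi_algebra.const quasi_algebra.add)

lemma quasi_algebra_prod:
  assumes "\<And>i. i \<in> A \<Longrightarrow> f i \<in> quasi_algebra L"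
  shows "(\<lambda>x. \<Prod>i\<in>A. f i x) \<in> quasi_algebra L"
  using assms
  by (induction A rule: infinite_finite_induct) (auto intro: quasi_algebra.const quasi_algebra.mult)

lemma quasi_algebra_power:
  assumes "f \<in> quasi_algebra L"
  shows "(\<lambda>x. f x ^ e) \<in> quasi_algebra L"
  by (induction e) (auto intro: quasi_algebra.const quasi_algebra.mult assms)

lemma quasi_algebra_if:
  assumes "(\<lambda>x. of_bool (P x)) \<in> quasi_algebra L" "f \<in> quasi_algebra L" "g \<in> quasi_algebra L"
  shows "(\<lambda>x. if P x then f x else g x) \<in> quasi_algebra L"
proof -
  have "(\<lambda>x. if P x then f x else g x) = (\<lambda>x. of_bool (P x) * f x + (1 - of_bool (P x)) * g x)"
    by auto
  also have "\<dots> \<in> quasi_algebra L"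
    by (intro quasi_algebra.add quasi_algebra.mult quasi_algebra_diff quasi_algebra.const assms)
  finally show ?thesis .
qed

lemma quasi_algebra_pullback:
  assumes "f \<in> quasi_algebra L" and "\<And>l. l \<in> L \<Longrightarrow> (\<lambda>y. l (h y)) \<in> L'"
  shows "(\<lambda>y. f (h y)) \<in> quasi_algebra L'"
  using assms(1)
proof induction
  case (floor l a)
  then show ?case using quasi_algebra.floor[OF assms(2)] by auto
next
  case (indicator l)
  then show ?case using quasi_algebra.indicator[OF assms(2)] by auto
qed (auto intro: quasi_algebra.intros)

definition affine_closed :: "('x \<Rightarrow> int) set \<Rightarrow> bool" where
  "affine_closed L \<longleftrightarrow> (\<forall>c. (\<lambda>x. c) \<in> L) \<and> (\<forall>l\<in>L. \<forall>m\<in>L. (\<lambda>x. l x + m x) \<in> L) \<and>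
     (\<forall>l\<in>L. \<forall>c. (\<lambda>x. c * l x) \<in> L)"

lemma
  assumes "affine_closed L"
  shows affine_closed_const: "(\<lambda>x. c) \<in> L"
    and affine_closed_add: "l \<in> L \<Longrightarrow> m \<in> L \<Longrightarrow> (\<lambda>x. l x + m x) \<in> L"
    and affine_closed_scale: "l \<in> L \<Longrightarrow> (\<lambda>x. c * l x) \<in> L"
  using assms by (auto simp: affine_closed_def)

lemma affine_closed_diff:
  assumes "affine_closed L" "l \<in> L" "m \<in> L"
  shows "(\<lambda>x. l x - m x) \<in> L"
  using affine_closed_add[OF assms(1,2) affine_closed_scale[OF assms(1,3), of "-1"]] by simp

lemma affine_closed_shift:
  assumes "affine_closed L" "l \<in> L"
  shows "(\<lambda>x. l x + c) \<in> L" "(\<lambda>x. l x - c) \<in> L"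
  using affine_closed_add[OF assms affine_closed_const[OF assms(1)], of c]
    affine_closed_diff[OF assms affine_closed_const[OF assms(1)], of c] by auto

lemma int_le_div_iff:
  fixes a m n :: int
  assumes "a > 0"
  shows "m \<le> n div a \<longleftrightarrow> m * a \<le> n"
proof -
  have "m \<le> n div a \<longleftrightarrow> m \<le> \<lfloor>(of_int n :: rat) / of_int a\<rfloor>"
    by (simp only: floor_divide_of_int_eq)
  also have "\<dots> \<longleftrightarrow> (of_int (m * a) :: rat) \<le> of_int n"
    using assms by (simp add: le_floor_iff pos_le_divide_eq)
  finally show ?thesis by (simp only: of_int_le_iff)
qed

lemma int_div_diff_pred:
  fixes z a :: int
  assumes "a > 0"
  shows "z div a - (z - 1) div a = of_bool (a dvd z)"
proof (cases "a dvd z")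
  case True
  then have "(z - 1) div a = z div a - 1"
    using assms by (intro int_div_pos_eq[where r = "a - 1"]) (auto simp: algebra_simps)
  with True show ?thesis by simp
next
  case False
  then have "z mod a > 0" using pos_mod_sign[OF assms, of z] by (simp add: dvd_eq_mod_eq_0)
  then have "(z - 1) div a = z div a"
    using pos_mod_bound[OF assms, of z]
    by (intro int_div_pos_eq[where r = "z mod a - 1"]) (auto simp: algebra_simps)
  with False show ?thesis by simp
qed

lemma quasi_algebra_mod_eq:
  assumes closed: "affine_closed L" and l_in: "l \<in> L" and residue: "0 \<le> r" "r < a"
  shows "(\<lambda>x. of_bool (l x mod a = r)) \<in> quasi_algebra L"
proof -
  have "a > 0" using residue by simp
  have "of_bool (l x mod a = r) =
      (of_int ((l x - r) div a) - of_int ((l x - (r + 1)) div a) :: rat)" for x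
  proof -
    have "l x mod a = r \<longleftrightarrow> a dvd l x - r"
      using residue mod_eq_dvd_iff[of "l x" a r] by simp
    then show ?thesis
      using int_div_diff_pred[OF \<open>a > 0\<close>, of "l x - r"]
      by (simp only: of_int_diff[symmetric] diff_diff_eq of_int_of_bool)
  qed
  then have "(\<lambda>x. of_bool (l x mod a = r)) =
      (\<lambda>x. of_int ((l x - r) div a) - of_int ((l x - (r + 1)) div a) :: rat)"
    by simp
  also have "\<dots> \<in> quasi_algebra L"
    by (intro quasi_algebra_diff quasi_algebra.floor affine_closed_shift(2) closed l_in \<open>a > 0\<close>)
  finally show ?thesis .
qed

lemma quasi_algebra_residue_cases:
  assumes closed: "affine_closed L" "l \<in> L" and "a > 0" and f_in: "\<And>r. f r \<in> quasi_algebra L"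
  shows "(\<lambda>x. f (l x mod a) x) \<in> quasi_algebra L"
proof -
  have "(\<Sum>r=0..<a. of_bool (l x mod a = r) * f r x) = (\<Sum>r\<in>{l x mod a}. f r x)" for x
    using \<open>a > 0\<close> by (intro sum.mono_neutral_cong_right) auto
  then have "(\<lambda>x. f (l x mod a) x) = (\<lambda>x. \<Sum>r=0..<a. of_bool (l x mod a = r) * f r x)"
    by simp
  also have "\<dots> \<in> quasi_algebra L"
    by (intro quasi_algebra_sum quasi_algebra.mult quasi_algebra_mod_eq closed f_in) auto
  finally show ?thesis .
qed

lemma quasi_algebra_floor_le_floor:
  assumes closed: "affine_closed L" and "l \<in> L" "m \<in> L" and "a > 0" "b > 0"
  shows "(\<lambda>x. of_bool (l x div a \<le> m x div b)) \<in> quasi_algebra L"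
proof -
  have "l x div a \<le> m x div b \<longleftrightarrow> a * m x - b * (l x - l x mod a) \<ge> 0" for x
  proof -
    have "a * m x - b * (l x - l x mod a) = a * (m x - b * (l x div a))"
      by (simp add: minus_mod_eq_mult_div algebra_simps)
    then show ?thesis
      using assms by (simp add: zero_le_mult_iff int_le_div_iff mult.commute)
  qed
  then have "(\<lambda>x. of_bool (l x div a \<le> m x div b)) =
      (\<lambda>x. of_bool (a * m x - b * (l x - l x mod a) \<ge> 0) :: rat)"
    by simp
  also have "\<dots> \<in> quasi_algebra L"
    using assms
    by (intro quasi_algebra_residue_cases[where f = "\<lambda>r x. of_bool (a * m x - b * (l x - r) \<ge> 0)"]
        quasi_algebra.indicator affine_closed_diff affine_closed_scale affine_closed_shift(2))
  finally show ?thesis .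
qed

lemma sum_int_telescope:
  fixes f :: "int \<Rightarrow> 'a::ab_group_add"
  assumes "u \<le> v + 1"
  shows "(\<Sum>q=u..v. f q - f (q - 1)) = f v - f (u - 1)"
proof -
  have "(\<Sum>q=u..u - 1 + int k. f q - f (q - 1)) = f (u - 1 + int k) - f (u - 1)" for k
  proof (induction k)
    case (Suc k)
    have "{u..u - 1 + int (Suc k)} = insert (u + int k) {u..u - 1 + int k}" by auto
    with Suc show ?case by (simp add: algebra_simps)
  qed simp
  from this[of "nat (v - u + 1)"] assms show ?thesis by simp
qed

lemma Suc_mult_power_conv_diff:
  fixes x :: "'a::comm_ring_1"
  shows "of_nat (Suc e) * x ^ e =
    x ^ Suc e - (x - 1) ^ Suc e + (\<Sum>j<e. of_nat (Suc e choose j) * (-1) ^ (Suc e - j) * x ^ j)"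
proof -
  have "(x - 1) ^ Suc e = (\<Sum>j\<le>Suc e. of_nat (Suc e choose j) * x ^ j * (-1) ^ (Suc e - j))"
    using binomial_ring[of x "-1" "Suc e"] by simp
  also have "\<dots> = (\<Sum>j<e. of_nat (Suc e choose j) * (-1) ^ (Suc e - j) * x ^ j)
      - of_nat (Suc e) * x ^ e + x ^ Suc e"
    unfolding lessThan_Suc_atMost[symmetric] by (simp add: algebra_simps)
  finally show ?thesis by simp
qed

lemma sum_power_recurrence:
  fixes u v :: int
  shows "(\<Sum>q=u..v. of_int q ^ e) =
    ((if u \<le> v then of_int v ^ Suc e - (of_int u - 1) ^ Suc e else 0) +
      (\<Sum>j<e. of_nat (Suc e choose j) * (-1) ^ (Suc e - j) * (\<Sum>q=u..v. of_int q ^ j))) /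
    (of_nat (Suc e) :: rat)"
proof (cases "u \<le> v")
  case True
  have "of_nat (Suc e) * (\<Sum>q=u..v. of_int q ^ e :: rat) =
      (\<Sum>q=u..v. of_int q ^ Suc e - of_int (q - 1) ^ Suc e) +
      (\<Sum>q=u..v. \<Sum>j<e. of_nat (Suc e choose j) * (-1) ^ (Suc e - j) * of_int q ^ j)"
    unfolding sum_distrib_left sum.distrib[symmetric]
    by (intro sum.cong refl) (simp only: Suc_mult_power_conv_diff of_int_diff of_int_1)
  also have "(\<Sum>q=u..v. of_int q ^ Suc e - of_int (q - 1) ^ Suc e :: rat) =
      of_int v ^ Suc e - of_int (u - 1) ^ Suc e"
    using True by (intro sum_int_telescope[where f = "\<lambda>q. of_int q ^ Suc e"]) simp
  also have "(\<Sum>q=u..v. \<Sum>j<e. of_nat (Suc e choose j) * (-1) ^ (Suc e - j) * of_int q ^ j :: rat) =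
      (\<Sum>j<e. of_nat (Suc e choose j) * (-1) ^ (Suc e - j) * (\<Sum>q=u..v. of_int q ^ j))"
    by (subst sum.swap) (simp only: sum_distrib_left)
  finally show ?thesis
    using True by (simp add: eq_divide_eq mult.commute del: of_nat_Suc power_Suc)
qed simp

lemma quasi_algebra_sum_power:
  assumes closed: "affine_closed L" and bounds_in: "l \<in> L" "m \<in> L" and pos: "a > 0" "b > 0"
  shows "(\<lambda>x. \<Sum>q=l x div a..m x div b. of_int q ^ e) \<in> quasi_algebra L"
proof (induction e rule: less_induct)
  case (less e)
  show ?case
    unfolding sum_power_recurrence[of e] divide_inverse using less
    by (intro quasi_algebra.mult quasi_algebra.add quasi_algebra_if quasi_algebra_floor_le_floor
        quasi_algebra_diff quasi_algebra_power quasi_algebra_sum quasi_algebra.floor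
        quasi_algebra.const assms) auto
qed

definition affine_extension :: "('x \<Rightarrow> int) set \<Rightarrow> ('x \<times> int \<Rightarrow> int) set" where
  "affine_extension L = {\<lambda>(x, k). l x + d * k | l d. l \<in> L}"

lemma affine_extensionI: "l \<in> L \<Longrightarrow> (\<lambda>(x, k). l x + d * k) \<in> affine_extension L"
  unfolding affine_extension_def by blast

lemma affine_extensionE:
  assumes "g \<in> affine_extension L"
  obtains l d where "l \<in> L" "\<And>x k. g (x, k) = l x + d * k"
  using assms unfolding affine_extension_def by auto

lemma int_interval_constraint:
  fixes u v c d :: int
  shows "d > 0 \<Longrightarrow> {q\<in>{u..v}. 0 \<le> c + d * q} =
      (if u \<le> (d - 1 - c) div d then {(d - 1 - c) div d..v} else {u..v})" (is "_ \<Longrightarrow> ?lower")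
    and "d < 0 \<Longrightarrow> {q\<in>{u..v}. 0 \<le> c + d * q} =
      (if v \<le> c div (- d) then {u..v} else {u..c div (- d)})" (is "_ \<Longrightarrow> ?upper")
proof -
  assume "d > 0"
  define m where "m = (d - 1 - c) div d"
  have iff: "0 \<le> c + d * q \<longleftrightarrow> m < q + 1" for q
    unfolding m_def not_le[symmetric] using \<open>d > 0\<close> by (auto simp: int_le_div_iff algebra_simps)
  have "{q\<in>{u..v}. 0 \<le> c + d * q} = (if u \<le> m then {m..v} else {u..v})"
    unfolding iff by auto
  then show ?lower by (simp only: m_def)
next
  assume "d < 0"
  define m where "m = c div (- d)"
  have iff: "0 \<le> c + d * q \<longleftrightarrow> q \<le> m" for q
    unfolding m_def using \<open>d < 0\<close>
    by (simp add: int_le_div_iff del: div_minus_right) (auto simp: algebra_simps)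
  have "{q\<in>{u..v}. 0 \<le> c + d * q} = (if v \<le> m then {u..v} else {u..m})"
    unfolding iff by auto
  then show ?upper by (simp only: m_def)
qed

lemma quasi_algebra_sum_power_constrained:
  assumes closed: "affine_closed L" and "finite S" "S \<subseteq> affine_extension L"
    and "l \<in> L" "m \<in> L" "a > 0" "b > 0"
  shows "(\<lambda>x. \<Sum>q\<in>{l x div a..m x div b} \<inter> {q. \<forall>g\<in>S. 0 \<le> g (x, q)}. of_int q ^ e) \<in> quasi_algebra L"
  using assms(2-)
proof (induction S arbitrary: l m a b rule: finite_induct)
  case empty
  then show ?case using quasi_algebra_sum_power[OF closed] by simp
next
  case (insert g S)
  let ?sum = "\<lambda>x Q. \<Sum>q\<in>Q \<inter> {q. \<forall>g\<in>S. 0 \<le> g (x, q)}. of_int q ^ e :: rat"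
  obtain k d where k_in: "k \<in> L" and g_eq: "\<And>x q. g (x, q) = k x + d * q"
    using insert.prems(1) by (meson affine_extensionE insert_subset)
  have split: "(\<Sum>q\<in>{u..v} \<inter> {q. \<forall>g\<in>insert g S. 0 \<le> g (x, q)}. of_int q ^ e) =
      ?sum x {q\<in>{u..v}. 0 \<le> k x + d * q}" for x u v
    by (intro sum.cong) (auto simp: g_eq)
  have sum_in: "(\<lambda>x. ?sum x {l x div a..m x div b}) \<in> quasi_algebra L"
    if "l \<in> L" "m \<in> L" "a > 0" "b > 0" for l m a b
    using insert.IH[OF _ that] insert.prems(1) by simp
  consider (zero) "d = 0" | (pos) "d > 0" | (neg) "d < 0" by linarith
  then show ?case
  proof cases
    case zero
    then have constraint_const: "?sum x {q\<in>Q. 0 \<le> k x + d * q} =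
        (if 0 \<le> k x then ?sum x Q else 0)" for x Q
      by simp
    show ?thesis
      unfolding split constraint_const using insert.prems k_in
      by (intro quasi_algebra_if quasi_algebra.indicator quasi_algebra.const sum_in)
  next
    case pos
    have "(\<lambda>x. d - 1 - k x) \<in> L" by (intro affine_closed_diff affine_closed_const closed k_in)
    then show ?thesis
      unfolding split int_interval_constraint(1)[OF pos] if_distrib[of "?sum _"]
      using insert.prems pos
      by (intro quasi_algebra_if quasi_algebra_floor_le_floor sum_in closed)
  next
    case neg
    then show ?thesis
      unfolding split int_interval_constraint(2)[OF neg] if_distrib[of "?sum _"]
      using insert.prems k_in
      by (intro quasi_algebra_if quasi_algebra_floor_le_floor sum_in closed) auto
  qed
qed

inductive_set fibre_polynomials :: "('x \<Rightarrow> int) set \<Rightarrow> ('x \<times> int \<Rightarrow> rat) set" for L where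
  monomial: "p \<in> quasi_algebra L \<Longrightarrow> finite S \<Longrightarrow> S \<subseteq> affine_extension L \<Longrightarrow>
    (\<lambda>(x, q). p x * of_int q ^ e * of_bool (\<forall>g\<in>S. 0 \<le> g (x, q))) \<in> fibre_polynomials L"
| add: "f \<in> fibre_polynomials L \<Longrightarrow> g \<in> fibre_polynomials L \<Longrightarrow> (\<lambda>y. f y + g y) \<in> fibre_polynomials L"

lemma fibre_polynomials_mult:
  assumes "f \<in> fibre_polynomials L" "g \<in> fibre_polynomials L"
  shows "(\<lambda>y. f y * g y) \<in> fibre_polynomials L"
  using assms
proof (induction arbitrary: g)
  case monomial_f: (monomial p S e)
  from \<open>g \<in> fibre_polynomials L\<close> show ?case
  proof induction
    case (monomial p' S' e')
    have "(\<lambda>(x, q). (p x * p' x) * of_int q ^ (e + e') * of_bool (\<forall>g\<in>S \<union> S'. 0 \<le> g (x, q)))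
        \<in> fibre_polynomials L"
      using monomial_f monomial by (intro fibre_polynomials.monomial quasi_algebra.mult) auto
    then show ?case
      by (rule back_subst[where P = "\<lambda>f. f \<in> _"]) (auto simp: fun_eq_iff power_add)
  next
    case (add f g)
    then show ?case by (auto simp: distrib_left intro: fibre_polynomials.add)
  qed
next
  case (add f f')
  from add.IH[OF add.prems] show ?case by (auto simp: distrib_right intro: fibre_polynomials.add)
qed

lemma fibre_polynomials_base:
  assumes "p \<in> quasi_algebra L"
  shows "(\<lambda>(x, q). p x) \<in> fibre_polynomials L"
  using fibre_polynomials.monomial[OF assms, of "{}" 0] by simp

lemma fibre_polynomials_floor:
  assumes closed: "affine_closed L" and "g \<in> affine_extension L" and "a > 0" "a dvd M"
  shows "(\<lambda>(x, q). of_int (g (x, M * q + c) div a)) \<in> fibre_polynomials L"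
proof -
  obtain l d where l_in: "l \<in> L" and g_eq: "\<And>x k. g (x, k) = l x + d * k"
    using assms(2) by (meson affine_extensionE)
  obtain m where M_eq: "M = a * m" using \<open>a dvd M\<close> by auto
  have "g (x, M * q + c) div a = (l x + d * c) div a + d * m * q" for x q
  proof -
    have "g (x, M * q + c) div a = (l x + d * c + d * m * q * a) div a"
      by (simp add: g_eq M_eq algebra_simps)
    then show ?thesis using \<open>a > 0\<close> by simp
  qed
  moreover have "(\<lambda>(x, q). of_int ((l x + d * c) div a)) \<in> fibre_polynomials L"
    using assms l_in by (intro fibre_polynomials_base quasi_algebra.floor affine_closed_shift)
  moreover have "(\<lambda>(x, q). of_int (d * m * q)) \<in> fibre_polynomials L"
    using fibre_polynomials.monomial[OF quasi_algebra.const, of "{}" L "of_int (d * m)" 1] by simp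
  ultimately show ?thesis
    using fibre_polynomials.add by (fastforce simp: case_prod_unfold)
qed

lemma fibre_polynomials_indicator:
  assumes closed: "affine_closed L" and "g \<in> affine_extension L"
  shows "(\<lambda>(x, q). of_bool (0 \<le> g (x, M * q + c))) \<in> fibre_polynomials L"
proof -
  obtain l d where l_in: "l \<in> L" and g_eq: "\<And>x k. g (x, k) = l x + d * k"
    using assms(2) by (meson affine_extensionE)
  have "(\<lambda>(x, q). (l x + d * c) + (d * M) * q) \<in> affine_extension L"
    by (intro affine_extensionI affine_closed_shift closed l_in)
  then show ?thesis
    using fibre_polynomials.monomial[OF quasi_algebra.const,
        of "{\<lambda>(x, q). (l x + d * c) + (d * M) * q}" L 1 0]
    by (simp add: g_eq algebra_simps)
qed

lemma ex_common_multiple: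
  fixes P Q :: "int \<Rightarrow> bool"
  assumes "\<exists>a>0. \<forall>m. a dvd m \<longrightarrow> P m" "\<exists>b>0. \<forall>m. b dvd m \<longrightarrow> Q m"
  shows "\<exists>c>0. \<forall>m. c dvd m \<longrightarrow> P m \<and> Q m"
  using assms by (meson dvd_mult_left dvd_mult_right mult_pos_pos)

text \<open>On a residue class of the last variable all floors become affine in that variable.\<close>
lemma quasi_algebra_on_residue_classes:
  assumes closed: "affine_closed L" and "f \<in> quasi_algebra (affine_extension L)"
  shows "\<exists>a>0. \<forall>m. a dvd m \<longrightarrow> (\<forall>c. (\<lambda>y. f (fst y, m * snd y + c)) \<in> fibre_polynomials L)"
  using assms(2)
proof induction
  case (floor g a)
  then show ?case using fibre_polynomials_floor[OF closed] by (auto simp: case_prod_unfold)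
next
  case (indicator g)
  then show ?case
    using fibre_polynomials_indicator[OF closed]
    by (auto simp: case_prod_unfold intro!: exI[of _ 1])
next
  case (const c)
  show ?case using fibre_polynomials_base[OF quasi_algebra.const, of c L]
    by (intro exI[of _ 1]) (simp add: case_prod_unfold)
next
  case (add f g)
  show ?case
    by (rule ex_forward[OF ex_common_multiple[OF add.IH]]) (auto intro: fibre_polynomials.add)
next
  case (mult f g)
  show ?case
    by (rule ex_forward[OF ex_common_multiple[OF mult.IH]]) (auto intro: fibre_polynomials_mult)
qed

lemma quasi_algebra_sum_fibre_polynomial:
  assumes closed: "affine_closed L" and "f \<in> fibre_polynomials L"
    and "l \<in> L" "m \<in> L" "a > 0" "b > 0"
  shows "(\<lambda>x. \<Sum>q=l x div a..m x div b. f (x, q)) \<in> quasi_algebra L"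
  using assms(2)
proof induction
  case (monomial p S e)
  have "(\<Sum>q=u..v. p x * of_int q ^ e * of_bool (\<forall>g\<in>S. 0 \<le> g (x, q))) =
      p x * (\<Sum>q\<in>{u..v} \<inter> {q. \<forall>g\<in>S. 0 \<le> g (x, q)}. of_int q ^ e)" for x u v
    by (auto simp: sum_distrib_left sum.inter_restrict intro!: sum.cong)
  then show ?case
    using assms monomial by (simp add: quasi_algebra.mult quasi_algebra_sum_power_constrained)
qed (simp add: sum.distrib quasi_algebra.add)

lemma sum_int_residue_classes:
  fixes f :: "int \<Rightarrow> 'a::comm_monoid_add"
  assumes "M > 0"
  shows "(\<Sum>k=0..u. f k) = (\<Sum>c=0..<M. \<Sum>q=0..(u - c) div M. f (M * q + c))"
proof -
  have "(\<Sum>c=0..<M. \<Sum>q=0..(u - c) div M. f (M * q + c)) =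
      (\<Sum>(c, q)\<in>(SIGMA c:{0..<M}. {0..(u - c) div M}). f (M * q + c))"
    by (simp add: sum.Sigma)
  also have "\<dots> = (\<Sum>k=0..u. f k)"
    using assms
    by (intro sum.reindex_bij_witness[of _ "\<lambda>k. (k mod M, k div M)" "\<lambda>(c, q). M * q + c"])
      (auto simp: int_le_div_iff pos_imp_zdiv_nonneg_iff minus_mod_eq_div_mult[symmetric]
        algebra_simps)
  finally show ?thesis ..
qed

theorem quasi_algebra_sum_interval:
  assumes closed: "affine_closed L" and f_in: "f \<in> quasi_algebra (affine_extension L)"
    and u_in: "u \<in> L"
  shows "(\<lambda>x. \<Sum>k=0..u x. f (x, k)) \<in> quasi_algebra L"
proof -
  obtain M where modulus: "M > 0" "\<And>c. (\<lambda>y. f (fst y, M * snd y + c)) \<in> fibre_polynomials L"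
    using quasi_algebra_on_residue_classes[OF closed f_in] by auto
  have "(\<lambda>x. \<Sum>q=0 div 1..(u x - c) div M. f (x, M * q + c)) \<in> quasi_algebra L" for c
    using quasi_algebra_sum_fibre_polynomial[OF closed modulus(2) affine_closed_const[OF closed]
        affine_closed_shift(2)[OF closed u_in] zero_less_one modulus(1)] by simp
  then have "(\<lambda>x. \<Sum>c=0..<M. \<Sum>q=0..(u x - c) div M. f (x, M * q + c)) \<in> quasi_algebra L"
    by (intro quasi_algebra_sum) simp
  then show ?thesis
    by (simp only: sum_int_residue_classes[OF modulus(1), where f = "\<lambda>k. f (_, k)", symmetric])
qed

section \<open>Piecewise quasi-polynomials\<close>

definition power_product :: "('r::finite \<Rightarrow> 'a::comm_monoid_mult) \<Rightarrow> ('r \<Rightarrow> nat) \<Rightarrow> 'a" where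
  "power_product x i = (\<Prod>j\<in>UNIV. x j ^ i j)"

lemma power_product_0 [simp]: "power_product x (\<lambda>_. 0) = 1"
  by (simp add: power_product_def)

lemma power_product_add: "power_product x (\<lambda>j. i j + k j) = power_product x i * power_product x k"
  by (simp add: power_product_def power_add prod.distrib)

lemma power_product_unit [simp]: "power_product x (\<lambda>k. of_bool (k = j)) = x j"
  by (simp add: power_product_def of_bool_def if_distrib[of "\<lambda>e. _ ^ e"] cong: if_cong)

lemma finite_sum_le: "finite {i :: 'r::finite \<Rightarrow> nat. sum i UNIV \<le> D}"
proof (rule finite_subset)
  have "i j \<le> D" if "sum i UNIV \<le> D" for i :: "'r \<Rightarrow> nat" and j
    using that member_le_sum[of j UNIV i] by (simp add: order_trans)
  then show "{i :: 'r \<Rightarrow> nat. sum i UNIV \<le> D} \<subseteq> PiE UNIV (\<lambda>_. {..D})" by auto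
qed (intro finite_PiE, auto)

lemma periodic_fun_const: "periodic_fun (\<lambda>n. c)"
  unfolding periodic_fun_def by (intro exI[of _ 1]) auto

lemma periodic_fun_combine:
  assumes "periodic_fun s" "periodic_fun t"
  shows "periodic_fun (\<lambda>n. h (s n) (t n))"
proof -
  have multiple: "s (n(j := n j + k * a)) = s n" if "\<And>n j. s (n(j := n j + a)) = s n"
    for s :: "('a \<Rightarrow> nat) \<Rightarrow> rat" and n j k a
  proof (induction k)
    case (Suc k)
    have "n(j := n j + Suc k * a) = (n(j := n j + k * a))(j := (n(j := n j + k * a)) j + a)"
      by (simp add: algebra_simps)
    with Suc show ?case by (simp only: that)
  qed simp
  obtain a b where "a > 0" "b > 0"
    and "\<And>n j. s (n(j := n j + a)) = s n" "\<And>n j. t (n(j := n j + b)) = t n"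
    using assms unfolding periodic_fun_def by blast
  then show ?thesis
    unfolding periodic_fun_def using multiple[of s a _ _ b] multiple[of t b _ _ a]
    by (intro exI[of _ "a * b"]) (auto simp: mult.commute)
qed

lemma quasi_polyI:
  assumes "finite A" and periodic: "\<And>i. i \<in> A \<Longrightarrow> periodic_fun (\<sigma> i)"
    and f_eq: "\<And>n. f n = (\<Sum>i\<in>A. \<sigma> i n * power_product (\<lambda>j. of_nat (n j)) i)"
  shows "quasi_poly f"
proof -
  define D where "D = (\<Sum>i\<in>A. sum i UNIV)"
  define \<tau> where "\<tau> i = (if i \<in> A then \<sigma> i else (\<lambda>_. 0))" for i
  have "sum i UNIV \<le> D" if "i \<in> A" for i
    unfolding D_def using \<open>finite A\<close> that by (intro member_le_sum) auto
  then have "f n = (\<Sum>i\<in>{i. sum i UNIV \<le> D}. \<tau> i n * power_product (\<lambda>j. of_nat (n j)) i)" for n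
    unfolding f_eq by (intro sum.mono_neutral_cong_left finite_sum_le) (auto simp: \<tau>_def)
  moreover have "periodic_fun (\<tau> i)" for i
    using periodic by (auto simp: \<tau>_def periodic_fun_const)
  ultimately show ?thesis
    unfolding quasi_poly_def power_product_def[symmetric] by blast
qed

lemma quasi_polyE:
  assumes "quasi_poly f"
  obtains A \<sigma> where "finite A" "\<forall>i. periodic_fun (\<sigma> i)"
    "f = (\<lambda>n. \<Sum>i\<in>A. \<sigma> i n * power_product (\<lambda>j. of_nat (n j)) i)"
proof -
  obtain D \<sigma> where "\<forall>i. periodic_fun (\<sigma> i)"
    "\<forall>n. f n = (\<Sum>i\<in>{i. sum i UNIV \<le> D}. \<sigma> i n * power_product (\<lambda>j. of_nat (n j)) i)"
    using assms unfolding quasi_poly_def power_product_def[symmetric] by blast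
  with finite_sum_le[of D] show thesis by (intro that) auto
qed

lemma quasi_poly_periodic:
  assumes "periodic_fun p"
  shows "quasi_poly p"
  using assms by (intro quasi_polyI[of "{\<lambda>_. 0}" "\<lambda>_. p"]) auto

lemma quasi_poly_const: "quasi_poly (\<lambda>n. c)"
  by (intro quasi_poly_periodic periodic_fun_const)

lemma quasi_poly_coordinate: "quasi_poly (\<lambda>n. of_nat (n j))"
  by (intro quasi_polyI[of "{\<lambda>k. of_bool (k = j)}" "\<lambda>_ _. 1"]) (auto intro: periodic_fun_const)

lemma quasi_poly_add:
  assumes "quasi_poly f" "quasi_poly g"
  shows "quasi_poly (\<lambda>n. f n + g n)"
proof -
  let ?x = "\<lambda>n j. of_nat (n j) :: rat"
  obtain A \<sigma> where f_terms: "finite A" "\<forall>i. periodic_fun (\<sigma> i)"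
    and f_eq: "f = (\<lambda>n. \<Sum>i\<in>A. \<sigma> i n * power_product (?x n) i)"
    by (rule quasi_polyE[OF assms(1)])
  obtain B \<tau> where g_terms: "finite B" "\<forall>i. periodic_fun (\<tau> i)"
    and g_eq: "g = (\<lambda>n. \<Sum>i\<in>B. \<tau> i n * power_product (?x n) i)"
    by (rule quasi_polyE[OF assms(2)])
  have extend: "(\<Sum>i\<in>C. h i n * power_product (?x n) i) =
      (\<Sum>i\<in>A \<union> B. (of_bool (i \<in> C) * h i n) * power_product (?x n) i)" if "C \<subseteq> A \<union> B" for C h n
    using that f_terms(1) g_terms(1) by (intro sum.mono_neutral_cong_left) auto
  have "f n + g n =
      (\<Sum>i\<in>A \<union> B.
        (of_bool (i \<in> A) * \<sigma> i n + of_bool (i \<in> B) * \<tau> i n) * power_product (?x n) i)" for n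
    unfolding f_eq g_eq extend[of A \<sigma>, OF Un_upper1] extend[of B \<tau>, OF Un_upper2]
    by (simp add: sum.distrib distrib_right)
  moreover have "periodic_fun (\<lambda>n. of_bool (i \<in> A) * \<sigma> i n + of_bool (i \<in> B) * \<tau> i n)" for i
    using f_terms(2) g_terms(2)
    by (intro periodic_fun_combine[where
          h = "\<lambda>a b. of_bool (i \<in> A) * a + of_bool (i \<in> B) * b"]) auto
  ultimately show ?thesis
    using f_terms(1) g_terms(1) by (intro quasi_polyI[of "A \<union> B"]) auto
qed

lemma quasi_poly_sum:
  assumes "\<And>i. i \<in> A \<Longrightarrow> quasi_poly (f i)"
  shows "quasi_poly (\<lambda>n. \<Sum>i\<in>A. f i n)"
  using assms
  by (induction A rule: infinite_finite_induct) (auto intro: quasi_poly_add quasi_poly_const)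

lemma quasi_poly_mult:
  assumes "quasi_poly f" "quasi_poly g"
  shows "quasi_poly (\<lambda>n. f n * g n)"
proof -
  let ?x = "\<lambda>n j. of_nat (n j) :: rat"
  obtain A \<sigma> where f_terms: "finite A" "\<forall>i. periodic_fun (\<sigma> i)"
    and f_eq: "f = (\<lambda>n. \<Sum>i\<in>A. \<sigma> i n * power_product (?x n) i)"
    by (rule quasi_polyE[OF assms(1)])
  obtain B \<tau> where g_terms: "finite B" "\<forall>i. periodic_fun (\<tau> i)"
    and g_eq: "g = (\<lambda>n. \<Sum>i\<in>B. \<tau> i n * power_product (?x n) i)"
    by (rule quasi_polyE[OF assms(2)])
  have "(\<lambda>n. f n * g n) =
      (\<lambda>n. \<Sum>i\<in>A. \<Sum>k\<in>B. (\<sigma> i n * \<tau> k n) * power_product (?x n) (\<lambda>j. i j + k j))"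
    by (simp add: f_eq g_eq sum_product power_product_add mult_ac)
  moreover have "quasi_poly (\<lambda>n. (\<sigma> i n * \<tau> k n) * power_product (?x n) (\<lambda>j. i j + k j))" for i k
    using f_terms(2) g_terms(2)
    by (intro quasi_polyI[of "{\<lambda>j. i j + k j}" "\<lambda>_ n. \<sigma> i n * \<tau> k n"])
      (auto intro: periodic_fun_combine[where h = "(*)"])
  ultimately show ?thesis by (simp add: quasi_poly_sum)
qed

lemma piecewise_quasi_polyI:
  fixes P :: "'i \<Rightarrow> (real ^ 'r::finite) set"
  assumes "finite A" and "\<And>i. i \<in> A \<Longrightarrow> polyhedron (P i)" "\<And>i. i \<in> A \<Longrightarrow> quasi_poly (f i)"
    and partition: "\<And>n. \<exists>!i. i \<in> A \<and> lattice_pt n \<in> P i"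
    and "\<And>i n. i \<in> A \<Longrightarrow> lattice_pt n \<in> P i \<Longrightarrow> F n = f i n"
  shows "piecewise_quasi_poly F"
proof -
  obtain e where enum: "bij_betw e {..<card A} A"
    using ex_bij_betw_nat_finite[OF \<open>finite A\<close>] by (auto simp: atLeast0LessThan)
  then have e_in: "e k \<in> A" if "k < card A" for k
    using that by (auto dest: bij_betwE)
  have "\<exists>!k. k < card A \<and> lattice_pt n \<in> P (e k)" for n
  proof -
    obtain i where piece: "i \<in> A" "lattice_pt n \<in> P i"
      and unique: "\<And>k. k \<in> A \<Longrightarrow> lattice_pt n \<in> P k \<Longrightarrow> k = i"
      using partition[of n] by blast
    obtain k where "k < card A" "e k = i"
      using piece(1) bij_betw_imp_surj_on[OF enum] by (metis imageE lessThan_iff)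
    then show ?thesis
      using piece(2) unique e_in bij_betw_imp_inj_on[OF enum]
      by (intro ex1I[of _ k]) (auto simp: inj_on_def)
  qed
  then show ?thesis
    unfolding piecewise_quasi_poly_def using assms e_in
    by (intro exI[of _ "card A"] exI[of _ "\<lambda>k. P (e k)"] exI[of _ "\<lambda>k. f (e k)"]) auto
qed

lemma piecewise_quasi_poly_of_quasi_poly:
  assumes "quasi_poly f"
  shows "piecewise_quasi_poly f"
  using assms by (intro piecewise_quasi_polyI[of "{()}" "\<lambda>_. UNIV" "\<lambda>_. f"]) auto

lemma piecewise_quasi_poly_combine:
  fixes F G :: "('r::finite \<Rightarrow> nat) \<Rightarrow> rat"
  assumes closed: "\<And>f g :: ('r \<Rightarrow> nat) \<Rightarrow> rat. quasi_poly f \<Longrightarrow> quasi_poly g \<Longrightarrow>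
      quasi_poly (\<lambda>n. h (f n) (g n))"
    and "piecewise_quasi_poly F" "piecewise_quasi_poly G"
  shows "piecewise_quasi_poly (\<lambda>n. h (F n) (G n))"
proof -
  obtain s :: nat and P f where F_pieces: "\<forall>i<s. polyhedron (P i) \<and> quasi_poly (f i)"
    "\<forall>n. \<exists>!i. i < s \<and> lattice_pt n \<in> P i"
    "\<forall>i<s. \<forall>n. lattice_pt n \<in> P i \<longrightarrow> F n = f i n"
    using assms(2) unfolding piecewise_quasi_poly_def by (elim exE conjE) (rule that)
  obtain t :: nat and Q g where G_pieces: "\<forall>i<t. polyhedron (Q i) \<and> quasi_poly (g i)"
    "\<forall>n. \<exists>!i. i < t \<and> lattice_pt n \<in> Q i"
    "\<forall>i<t. \<forall>n. lattice_pt n \<in> Q i \<longrightarrow> G n = g i n"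
    using assms(3) unfolding piecewise_quasi_poly_def by (elim exE conjE) (rule that)
  show ?thesis
  proof (rule piecewise_quasi_polyI)
    show "\<exists>!ik. ik \<in> {..<s} \<times> {..<t} \<and> lattice_pt n \<in> P (fst ik) \<inter> Q (snd ik)" for n
      using spec[OF F_pieces(2), of n] spec[OF G_pieces(2), of n] by (auto simp: Ex1_def)
    show "quasi_poly (\<lambda>n. h (f (fst ik) n) (g (snd ik) n))" if "ik \<in> {..<s} \<times> {..<t}" for ik
      using F_pieces(1) G_pieces(1) that closed[of "f (fst ik)" "g (snd ik)"] by auto
  qed (use F_pieces G_pieces in \<open>auto intro: polyhedron_Int\<close>)
qed

definition affine_maps :: "(int ^ 'r \<Rightarrow> int) set" where
  "affine_maps = {\<lambda>z. (\<Sum>j\<in>UNIV. c $ j * z $ j) + b | c b. True}"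

lemma affine_mapsI: "(\<lambda>z. (\<Sum>j\<in>UNIV. c $ j * z $ j) + b) \<in> affine_maps"
  unfolding affine_maps_def by blast

lemma affine_mapsE:
  assumes "l \<in> affine_maps"
  obtains c b where "l = (\<lambda>z. (\<Sum>j\<in>UNIV. c $ j * z $ j) + b)"
  using assms unfolding affine_maps_def by blast

lemma affine_closed_affine_maps: "affine_closed (affine_maps :: (int ^ 'r \<Rightarrow> int) set)"
  unfolding affine_closed_def
proof (intro conjI allI ballI)
  show "(\<lambda>z. b) \<in> (affine_maps :: (int ^ 'r \<Rightarrow> int) set)" for b
    using affine_mapsI[of 0 b] by simp
  fix l :: "int ^ 'r \<Rightarrow> int" assume "l \<in> affine_maps"
  then obtain c b where l_eq: "l = (\<lambda>z. (\<Sum>j\<in>UNIV. c $ j * z $ j) + b)" by (rule affine_mapsE)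
  show "(\<lambda>z. k * l z) \<in> affine_maps" for k
    using affine_mapsI[of "k *s c" "k * b"]
    by (simp add: l_eq distrib_left sum_distrib_left mult.assoc)
  fix m :: "int ^ 'r \<Rightarrow> int" assume "m \<in> affine_maps"
  then obtain c' b' where m_eq: "m = (\<lambda>z. (\<Sum>j\<in>UNIV. c' $ j * z $ j) + b')" by (rule affine_mapsE)
  show "(\<lambda>z. l z + m z) \<in> affine_maps"
    using affine_mapsI[of "c + c'" "b + b'"]
    by (simp add: l_eq m_eq distrib_right sum.distrib algebra_simps)
qed

lemma periodic_fun_affine_mod:
  assumes "l \<in> affine_maps" "a > 0"
  shows "periodic_fun (\<lambda>n. of_int (l (\<chi> j. int (n j)) mod a))"
  unfolding periodic_fun_def
proof (intro exI[of _ "nat a"] conjI allI)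
  fix n :: "'a \<Rightarrow> nat" and j
  obtain c b where l_eq: "l = (\<lambda>z. (\<Sum>j\<in>UNIV. c $ j * z $ j) + b)"
    using assms(1) by (rule affine_mapsE)
  have "c $ k * int ((n(j := n j + nat a)) k) =
      c $ k * int (n k) + (if k = j then c $ j * a else 0)" for k
    using \<open>a > 0\<close> by (simp add: distrib_left)
  then have "l (\<chi> k. int ((n(j := n j + nat a)) k)) = l (\<chi> k. int (n k)) + c $ j * a"
    by (simp add: l_eq sum.distrib del: fun_upd_apply)
  then show "of_int (l (\<chi> k. int ((n(j := n j + nat a)) k)) mod a) =
      (of_int (l (\<chi> k. int (n k)) mod a) :: rat)"
    by simp
qed (use \<open>a > 0\<close> in simp)

lemma quasi_poly_affine_floor:
  assumes "l \<in> affine_maps" "a > 0"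
  shows "quasi_poly (\<lambda>n. of_int (l (\<chi> j. int (n j)) div a))"
proof -
  obtain c b where l_eq: "l = (\<lambda>z. (\<Sum>j\<in>UNIV. c $ j * z $ j) + b)"
    using assms(1) by (rule affine_mapsE)
  have "of_int (z div a) = (1 / of_int a) * (of_int z + (- 1) * of_int (z mod a) :: rat)" for z
    using \<open>a > 0\<close> mult_div_mod_eq[of a z] by (simp add: field_simps flip: of_int_mult of_int_add)
  then have "(\<lambda>n. of_int (l (\<chi> j. int (n j)) div a) :: rat) =
      (\<lambda>n. (1 / of_int a) * (((\<Sum>j\<in>UNIV. of_int (c $ j) * of_nat (n j)) + of_int b) +
        (- 1) * of_int (l (\<chi> j. int (n j)) mod a)))"
    by (simp add: l_eq)
  then show ?thesis
    by (simp only:) (intro quasi_poly_mult quasi_poly_add quasi_poly_sum quasi_poly_coordinate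
        quasi_poly_const quasi_poly_periodic periodic_fun_affine_mod assms)
qed

lemma piecewise_quasi_poly_affine_indicator:
  fixes l :: "int ^ 'r \<Rightarrow> int"
  assumes "l \<in> affine_maps"
  shows "piecewise_quasi_poly (\<lambda>n. of_bool (0 \<le> l (\<chi> j. int (n j))))"
proof -
  obtain c b where l_eq: "l = (\<lambda>z. (\<Sum>j\<in>UNIV. c $ j * z $ j) + b)" using assms by (rule affine_mapsE)
  define w :: "real ^ 'r" where "w = (\<chi> j. of_int (c $ j))"
  have w_inner: "w \<bullet> lattice_pt n = of_int (l (\<chi> j. int (n j)) - b)" for n
    by (simp add: w_def inner_vec_def lattice_pt_def l_eq)
  \<comment> \<open>On lattice points \<open>l < 0\<close> is the closed condition \<open>l \<le> -1\<close>.\<close>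
  define P where "P s = (if s then {x. w \<bullet> x \<ge> - of_int b} else {x. w \<bullet> x \<le> - of_int b - 1})" for s
  have "lattice_pt n \<in> P s \<longleftrightarrow> s = (0 \<le> l (\<chi> j. int (n j)))" for n s
    by (simp add: P_def w_inner) linarith
  then show ?thesis
    by (intro piecewise_quasi_polyI[of UNIV P "\<lambda>s _. of_bool s"])
      (auto simp: P_def polyhedron_halfspace_le polyhedron_halfspace_ge quasi_poly_const)
qed

theorem piecewise_quasi_poly_quasi_algebra:
  assumes "f \<in> quasi_algebra affine_maps"
  shows "piecewise_quasi_poly (\<lambda>n. f (\<chi> j. int (n j)))"
  using assms
proof induction
  case (floor l a)
  then show ?case by (intro piecewise_quasi_poly_of_quasi_poly quasi_poly_affine_floor)
next
  case (indicator l)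
  then show ?case by (rule piecewise_quasi_poly_affine_indicator)
next
  case (const c)
  show ?case by (intro piecewise_quasi_poly_of_quasi_poly quasi_poly_const)
next
  case (add f g)
  from piecewise_quasi_poly_combine[OF quasi_poly_add add.IH] show ?case .
next
  case (mult f g)
  from piecewise_quasi_poly_combine[OF quasi_poly_mult mult.IH] show ?case .
qed

section \<open>Finitely generated commutative monoids\<close>

lemma dickson:
  fixes f :: "'w \<Rightarrow> 'i \<Rightarrow> nat"
  assumes "finite I"
  shows "\<exists>B\<subseteq>W. finite B \<and> (\<forall>w\<in>W. \<exists>b\<in>B. \<forall>i\<in>I. f b i \<le> f w i)"
  using assms
proof (induction I arbitrary: W rule: finite_induct)
  case empty
  show ?case
  proof (cases "W = {}")
    case False
    then obtain w where "w \<in> W" by auto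
    then show ?thesis by (intro exI[of _ "{w}"]) auto
  qed auto
next
  case (insert i I)
  obtain B where basis: "B \<subseteq> W" "finite B" "\<forall>w\<in>W. \<exists>b\<in>B. \<forall>i\<in>I. f b i \<le> f w i"
    using insert.IH[of W] by auto
  define m where "m = Max (insert 0 ((\<lambda>b. f b i) ` B))"
  have le_m: "f b i \<le> m" if "b \<in> B" for b
    using that basis(2) unfolding m_def by (intro Max_ge) auto
  have "\<forall>k. \<exists>C\<subseteq>{w\<in>W. f w i = k}. finite C \<and> (\<forall>w\<in>{w\<in>W. f w i = k}. \<exists>b\<in>C. \<forall>i\<in>I. f b i \<le> f w i)"
    using insert.IH by blast
  then obtain C where slices: "\<forall>k. C k \<subseteq> {w\<in>W. f w i = k} \<and> finite (C k) \<and>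
      (\<forall>w\<in>{w\<in>W. f w i = k}. \<exists>b\<in>C k. \<forall>i\<in>I. f b i \<le> f w i)"
    unfolding choice_iff by (elim exE) (rule that)
  show ?case
  proof (intro exI[of _ "B \<union> (\<Union>k<m. C k)"] conjI ballI)
    fix w assume w_in: "w \<in> W"
    show "\<exists>b\<in>B \<union> (\<Union>k<m. C k). \<forall>i\<in>insert i I. f b i \<le> f w i"
    proof (cases "f w i < m")
      case True
      obtain b where "b \<in> C (f w i)" "\<forall>i\<in>I. f b i \<le> f w i" using slices w_in by blast
      moreover have "f b i = f w i" using slices \<open>b \<in> C (f w i)\<close> by blast
      ultimately show ?thesis using True by (intro bexI[of _ b]) auto
    next
      case False
      then show ?thesis using basis(3) w_in le_m by (metis UnI1 insert_iff le_trans not_le)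
    qed
  qed (use basis slices in auto)
qed

lemma dickson_multiset:
  assumes "finite A" and support: "\<And>M. M \<in> W \<Longrightarrow> set_mset M \<subseteq> A"
  shows "\<exists>B\<subseteq>W. finite B \<and> (\<forall>M\<in>W. \<exists>N\<in>B. N \<subseteq># M)"
proof -
  obtain B where "B \<subseteq> W" "finite B" and dominates: "\<forall>M\<in>W. \<exists>N\<in>B. \<forall>i\<in>A. count N i \<le> count M i"
    using dickson[OF \<open>finite A\<close>, of W count] by (elim exE conjE) (rule that)
  have "N \<subseteq># M" if "N \<in> B" "\<forall>i\<in>A. count N i \<le> count M i" for M N
    unfolding subseteq_mset_def using that support[of N] \<open>B \<subseteq> W\<close>
    by (metis count_inI le0 subsetD)
  with dominates \<open>B \<subseteq> W\<close> \<open>finite B\<close> show ?thesis by meson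
qed

definition is_submonoid :: "'a::comm_monoid_add set \<Rightarrow> bool" where
  "is_submonoid N \<longleftrightarrow> 0 \<in> N \<and> (\<forall>x\<in>N. \<forall>y\<in>N. x + y \<in> N)"

lemma is_submonoidI:
  "0 \<in> N \<Longrightarrow> (\<And>x y. x \<in> N \<Longrightarrow> y \<in> N \<Longrightarrow> x + y \<in> N) \<Longrightarrow> is_submonoid N"
  by (auto simp: is_submonoid_def)

lemma is_submonoid_0: "is_submonoid N \<Longrightarrow> 0 \<in> N"
  and is_submonoid_add: "is_submonoid N \<Longrightarrow> x \<in> N \<Longrightarrow> y \<in> N \<Longrightarrow> x + y \<in> N"
  by (auto simp: is_submonoid_def)

lemma is_submonoid_sum:
  "is_submonoid N \<Longrightarrow> (\<And>i. i \<in> A \<Longrightarrow> f i \<in> N) \<Longrightarrow> sum f A \<in> N"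
  by (induction A rule: infinite_finite_induct) (auto simp: is_submonoid_def)

lemma is_submonoid_sum_mset:
  "is_submonoid N \<Longrightarrow> (\<And>i. i \<in># M \<Longrightarrow> f i \<in> N) \<Longrightarrow> (\<Sum>i\<in>#M. f i) \<in> N"
  by (induction M) (auto simp: is_submonoid_def)

lemma is_submonoid_Inter: "(\<And>N. N \<in> F \<Longrightarrow> is_submonoid N) \<Longrightarrow> is_submonoid (\<Inter>F)"
  by (auto simp: is_submonoid_def)

lemma is_submonoid_hull: "is_submonoid (is_submonoid hull S)"
  by (rule hull_in) (auto simp: is_submonoid_Inter)

lemma submonoid_hull_eq_sums: "is_submonoid hull S = sum_mset ` {M. set_mset M \<subseteq> S}"
proof (rule hull_unique)
  show "S \<subseteq> sum_mset ` {M. set_mset M \<subseteq> S}"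
    by (auto intro!: image_eqI[of _ _ "{#_#}"])
  show "is_submonoid (sum_mset ` {M. set_mset M \<subseteq> S})"
  proof (rule is_submonoidI)
    show "0 \<in> sum_mset ` {M. set_mset M \<subseteq> S}" by (intro image_eqI[of _ _ "{#}"]) auto
    fix x y assume "x \<in> sum_mset ` {M. set_mset M \<subseteq> S}" "y \<in> sum_mset ` {M. set_mset M \<subseteq> S}"
    then obtain M N where "x = sum_mset M" "set_mset M \<subseteq> S" "y = sum_mset N" "set_mset N \<subseteq> S"
      by auto
    then show "x + y \<in> sum_mset ` {M. set_mset M \<subseteq> S}" by (intro image_eqI[of _ _ "M + N"]) auto
  qed
  show "sum_mset ` {M. set_mset M \<subseteq> S} \<subseteq> N" if "S \<subseteq> N" "is_submonoid N" for N
    using that is_submonoid_sum_mset[of N _ "\<lambda>x. x"] by auto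
qed

lemma msets_over_image: "{M. set_mset M \<subseteq> h ` S} = image_mset h ` {M. set_mset M \<subseteq> S}"
proof (intro equalityI subsetI)
  fix M assume "M \<in> {M. set_mset M \<subseteq> h ` S}"
  then show "M \<in> image_mset h ` {M. set_mset M \<subseteq> S}"
  proof (induction M)
    case (add y M)
    then obtain x N where "y = h x" "x \<in> S" "M = image_mset h N" "set_mset N \<subseteq> S" by auto
    then show ?case by (intro image_eqI[of _ _ "add_mset x N"]) auto
  qed simp
qed (auto simp: subset_iff)

lemma submonoid_hull_image:
  assumes "h 0 = 0" "\<And>x y. h (x + y) = h x + h y"
  shows "is_submonoid hull (h ` S) = h ` (is_submonoid hull S)"
proof -
  have "sum_mset (image_mset h M) = h (sum_mset M)" for M
    by (induction M) (simp_all add: assms)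
  then show ?thesis by (simp add: submonoid_hull_eq_sums msets_over_image image_image)
qed

lemma submonoid_hull_Un: "is_submonoid hull (S \<union> T) = is_submonoid hull S + is_submonoid hull T"
proof (rule hull_unique)
  have zero: "0 \<in> is_submonoid hull A" for A :: "'a set"
    by (rule is_submonoid_0[OF is_submonoid_hull])
  show "S \<union> T \<subseteq> is_submonoid hull S + is_submonoid hull T"
    using set_zero_plus2[OF zero, of "is_submonoid hull S" T]
      set_zero_plus2[OF zero, of "is_submonoid hull T" S]
      hull_subset[of S is_submonoid] hull_subset[of T is_submonoid] by (auto simp: add.commute)
  show "is_submonoid (is_submonoid hull S + is_submonoid hull T)"
  proof (rule is_submonoidI)
    show "0 \<in> is_submonoid hull S + is_submonoid hull T"
      using set_plus_intro[OF zero zero] by simp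
    fix x y assume "x \<in> is_submonoid hull S + is_submonoid hull T"
      "y \<in> is_submonoid hull S + is_submonoid hull T"
    then obtain a b c d where "x = a + b" "y = c + d"
      and mem: "a \<in> is_submonoid hull S" "c \<in> is_submonoid hull S"
      "b \<in> is_submonoid hull T" "d \<in> is_submonoid hull T" by (auto elim!: set_plus_elim)
    then have "x + y = (a + c) + (b + d)" by (simp add: add_ac)
    also have "\<dots> \<in> is_submonoid hull S + is_submonoid hull T"
      by (intro set_plus_intro is_submonoid_add is_submonoid_hull mem)
    finally show "x + y \<in> is_submonoid hull S + is_submonoid hull T" .
  qed
  show "is_submonoid hull S + is_submonoid hull T \<subseteq> N" if "S \<union> T \<subseteq> N" "is_submonoid N" for N
    using that hull_minimal[of S N is_submonoid] hull_minimal[of T N is_submonoid]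
    by (auto elim!: set_plus_elim intro!: is_submonoid_add)
qed

lemma submonoid_hull_diff_0: "is_submonoid hull (S - {0}) = is_submonoid hull S"
proof -
  have "S \<subseteq> is_submonoid hull (S - {0})"
    using is_submonoid_0[OF is_submonoid_hull] by (auto intro: hull_inc)
  then show ?thesis
    by (intro equalityI hull_mono hull_minimal is_submonoid_hull) auto
qed

definition fg_monoid :: "'a::comm_monoid_add set \<Rightarrow> bool" where
  "fg_monoid N \<longleftrightarrow> (\<exists>S. finite S \<and> N = is_submonoid hull S)"

lemma fg_monoid_hull: "finite S \<Longrightarrow> fg_monoid (is_submonoid hull S)"
  by (auto simp: fg_monoid_def)

lemma fg_monoid_image:
  assumes "fg_monoid N" "h 0 = 0" "\<And>x y. h (x + y) = h x + h y"
  shows "fg_monoid (h ` N)"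
  using assms(1) submonoid_hull_image[of h, OF assms(2,3), symmetric] by (auto simp: fg_monoid_def)

lemma fg_monoid_plus: "fg_monoid M \<Longrightarrow> fg_monoid N \<Longrightarrow> fg_monoid (M + N)"
  unfolding fg_monoid_def using submonoid_hull_Un by (metis finite_Un)

text \<open>Closure under subtraction makes the minimal nonzero elements generate.\<close>
lemma fg_monoid_subtractive_multisets:
  assumes "finite A" and support: "\<And>M. M \<in> N \<Longrightarrow> set_mset M \<subseteq> A" and submonoid: "is_submonoid N"
    and diff: "\<And>M P. M \<in> N \<Longrightarrow> M + P \<in> N \<Longrightarrow> P \<in> N"
  shows "fg_monoid N"
proof -
  have "\<exists>B\<subseteq>N - {{#}}. finite B \<and> (\<forall>M\<in>N - {{#}}. \<exists>b\<in>B. b \<subseteq># M)"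
    using support by (intro dickson_multiset[OF \<open>finite A\<close>]) auto
  then obtain B where basis: "B \<subseteq> N - {{#}}" "finite B"
    and minimal: "\<forall>M\<in>N - {{#}}. \<exists>b\<in>B. b \<subseteq># M" by (elim exE conjE) (rule that)
  have "M \<in> is_submonoid hull B" if "M \<in> N" for M
    using that
  proof (induction "size M" arbitrary: M rule: less_induct)
    case less
    show ?case
    proof (cases "M = {#}")
      case True
      then show ?thesis using is_submonoid_0[OF is_submonoid_hull, of B] by simp
    next
      case False
      then obtain b P where b_in: "b \<in> B" and M_eq: "M = b + P"
        using minimal less.prems by (metis DiffI mset_subset_eq_exists_conv singletonD)
      then have "P \<in> N" "size P < size M"
        using basis(1) less.prems diff[of b P] by (auto simp: nonempty_has_size)
      then have "P \<in> is_submonoid hull B" by (intro less.hyps)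
      then show ?thesis
        unfolding M_eq by (rule is_submonoid_add[OF is_submonoid_hull hull_inc[OF b_in]])
    qed
  qed
  moreover have "is_submonoid hull B \<subseteq> N" using basis(1) submonoid by (intro hull_minimal) auto
  ultimately have "N = is_submonoid hull B" by blast
  with basis(2) show ?thesis by (simp add: fg_monoid_hull)
qed

lemma fg_monoid_Int:
  fixes N N' :: "'a::cancel_comm_monoid_add set"
  assumes "fg_monoid N" "fg_monoid N'"
  shows "fg_monoid (N \<inter> N')"
proof -
  obtain S T where "finite S" "finite T"
    and hulls: "N = is_submonoid hull S" "N' = is_submonoid hull T"
    using assms by (auto simp: fg_monoid_def)
  define left right where "left M = (\<Sum>x\<in>#M. case_sum id (\<lambda>_. 0) x)"
    and "right M = (\<Sum>x\<in>#M. case_sum (\<lambda>_. 0) id x)"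
    for M :: "('a + 'a) multiset"
  define E where "E = {M. set_mset M \<subseteq> S <+> T \<and> left M = right M}"
  have "N \<inter> N' = left ` E"
  proof (intro equalityI subsetI)
    fix x assume "x \<in> N \<inter> N'"
    then obtain P Q where sums: "set_mset P \<subseteq> S" "set_mset Q \<subseteq> T" "x = sum_mset P" "x = sum_mset Q"
      by (auto simp: hulls submonoid_hull_eq_sums)
    have "left (image_mset Inl P + image_mset Inr Q) = sum_mset P"
      "right (image_mset Inl P + image_mset Inr Q) = sum_mset Q"
      by (simp_all add: left_def right_def image_mset.compositionality comp_def)
    with sums show "x \<in> left ` E"
      by (intro image_eqI[of _ _ "image_mset Inl P + image_mset Inr Q"]) (auto simp: E_def)
  next
    fix x assume "x \<in> left ` E"
    then obtain M where M_sums: "set_mset M \<subseteq> S <+> T" "x = left M" "x = right M"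
      by (auto simp: E_def)
    have "case_sum id (\<lambda>_. 0) i \<in> N" "case_sum (\<lambda>_. 0) id i \<in> N'" if "i \<in># M" for i
      using that M_sums(1)
      by (auto simp: hulls intro: hull_inc is_submonoid_0[OF is_submonoid_hull] dest!: subsetD)
    then have "left M \<in> N" "right M \<in> N'"
      unfolding left_def right_def hulls by (auto intro!: is_submonoid_sum_mset is_submonoid_hull)
    with M_sums show "x \<in> N \<inter> N'" by simp
  qed
  moreover have "fg_monoid E"
    using \<open>finite S\<close> \<open>finite T\<close>
    by (intro fg_monoid_subtractive_multisets[of "S <+> T"])
      (auto simp: E_def is_submonoid_def left_def right_def)
  ultimately show ?thesis using fg_monoid_image[of E left] by (simp add: left_def)
qed

section \<open>Counting elements of given degree\<close>

definition coord_sum :: "int ^ 'r \<Rightarrow> int" where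
  "coord_sum z = (\<Sum>j\<in>UNIV. z $ j)"

lemma coord_sum_add [simp]: "coord_sum (x + y) = coord_sum x + coord_sum y"
  by (simp add: coord_sum_def sum.distrib)

lemma coord_sum_0 [simp]: "coord_sum 0 = 0"
  by (simp add: coord_sum_def)

definition weighted_msets :: "('i \<Rightarrow> 'w::comm_monoid_add) \<Rightarrow> 'i set \<Rightarrow> 'w \<Rightarrow> 'i multiset set" where
  "weighted_msets w A z = {M. set_mset M \<subseteq> A \<and> (\<Sum>i\<in>#M. w i) = z}"

lemma size_le_coord_sum:
  assumes pos: "\<And>i. i \<in> A \<Longrightarrow> 0 < coord_sum (w i)" and "M \<in> weighted_msets w A z"
  shows "int (size M) \<le> coord_sum z"
proof -
  have "int (size M) \<le> coord_sum (\<Sum>i\<in>#M. w i)" if "set_mset M \<subseteq> A"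
    using that
  proof (induction M)
    case (add i M)
    then show ?case using pos[of i] by simp
  qed simp
  with assms(2) show ?thesis by (auto simp: weighted_msets_def)
qed

lemma finite_weighted_msets:
  assumes "finite A" and "\<And>i. i \<in> A \<Longrightarrow> 0 < coord_sum (w i)"
  shows "finite (weighted_msets w A z)"
proof (rule finite_subset)
  show "weighted_msets w A z \<subseteq> (\<Union>k\<le>nat (coord_sum z). multisets_of_size A k)"
  proof
    fix M assume M_in: "M \<in> weighted_msets w A z"
    then have "size M \<le> nat (coord_sum z)" using size_le_coord_sum[of A w M z] assms(2) by simp
    with M_in show "M \<in> (\<Union>k\<le>nat (coord_sum z). multisets_of_size A k)"
      by (auto simp: weighted_msets_def multisets_of_size_def)
  qed
qed (use assms(1) in \<open>auto intro: finite_multisets_of_size\<close>)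

lemma card_weighted_msets_insert:
  fixes w :: "'i \<Rightarrow> int ^ 'r"
  assumes "finite A" "a \<notin> A" and pos: "\<And>i. i \<in> insert a A \<Longrightarrow> 0 < coord_sum (w i)"
  shows "card (weighted_msets w (insert a A) z) =
      (\<Sum>k=0..coord_sum z. card (weighted_msets w A (z - of_int k * w a)))"
proof -
  let ?Z = "SIGMA k:{0..coord_sum z}. weighted_msets w A (z - of_int k * w a)"
  let ?remove = "\<lambda>M. (int (count M a), filter_mset (\<lambda>i. i \<noteq> a) M)"
  let ?insert = "\<lambda>(k, M). M + replicate_mset (nat k) a"
  have decomp: "filter_mset (\<lambda>i. i \<noteq> a) M + replicate_mset (count M a) a = M" for M
    by (rule multiset_eqI) auto
  have "bij_betw ?remove (weighted_msets w (insert a A) z) ?Z"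
  proof (rule bij_betw_byWitness[where f' = ?insert])
    show "\<forall>M\<in>weighted_msets w (insert a A) z. ?insert (?remove M) = M"
      using decomp by simp
    show "\<forall>y\<in>?Z. ?remove (?insert y) = y"
    proof
      fix y assume "y \<in> ?Z"
      then obtain k M where "y = (k, M)" "0 \<le> k" and M_in: "set_mset M \<subseteq> A"
        by (auto simp: weighted_msets_def)
      moreover from M_in have "a \<notin># M" using \<open>a \<notin> A\<close> by blast
      ultimately show "?remove (?insert y) = y" by (auto simp: not_in_iff multiset_eq_iff)
    qed
    show "?remove ` weighted_msets w (insert a A) z \<subseteq> ?Z"
    proof (rule image_subsetI)
      fix M assume M_in: "M \<in> weighted_msets w (insert a A) z"
      have "int (count M a) \<le> coord_sum z"
        using size_le_coord_sum[OF pos M_in] count_le_size[of M a] by linarith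
      moreover have "(\<Sum>i\<in>#filter_mset (\<lambda>i. i \<noteq> a) M. w i) + of_nat (count M a) * w a = z"
        using M_in arg_cong[OF decomp[of M], of "\<lambda>M. \<Sum>i\<in>#M. w i"]
        by (simp add: weighted_msets_def)
      ultimately show "?remove M \<in> ?Z"
        using M_in by (auto simp: weighted_msets_def eq_diff_eq)
    qed
    show "?insert ` ?Z \<subseteq> weighted_msets w (insert a A) z"
      by (auto simp: weighted_msets_def split: if_splits)
  qed
  then have "card (weighted_msets w (insert a A) z) = card ?Z" by (rule bij_betw_same_card)
  also have "\<dots> = (\<Sum>k=0..coord_sum z. card (weighted_msets w A (z - of_int k * w a)))"
    using assms by (intro card_SigmaI) (auto intro!: finite_weighted_msets)
  finally show ?thesis .
qed

lemma quasi_algebra_eq_0: "(\<lambda>z :: int ^ 'r. of_bool (z = 0)) \<in> quasi_algebra affine_maps"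
proof -
  have coordinate: "(\<lambda>z :: int ^ 'r. c * z $ j) \<in> affine_maps" for c j
    using affine_mapsI[of "\<chi> k. if k = j then c else 0" 0]
    by (simp add: if_distrib[of "\<lambda>x. x * _"] cong: if_cong)
  have "(\<lambda>z :: int ^ 'r. of_bool (z = 0)) =
      (\<lambda>z. \<Prod>j\<in>UNIV. of_bool (0 \<le> 1 * z $ j) * of_bool (0 \<le> - 1 * z $ j) :: rat)"
    by (auto simp: fun_eq_iff vec_eq_iff)
  also have "\<dots> \<in> quasi_algebra affine_maps"
    by (intro quasi_algebra_prod quasi_algebra.mult quasi_algebra.indicator coordinate)
  finally show ?thesis .
qed

lemma affine_maps_translate:
  fixes v :: "int ^ 'r"
  assumes "l \<in> affine_maps"
  shows "(\<lambda>(z, k). l (z - of_int k * v)) \<in> affine_extension affine_maps"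
    "(\<lambda>z. l (z - v)) \<in> affine_maps"
proof -
  obtain c b where l_eq: "l = (\<lambda>z. (\<Sum>j\<in>UNIV. c $ j * z $ j) + b)" using assms by (rule affine_mapsE)
  have "(of_int k :: int ^ 'r) $ j = k" for k j
    by (cases k rule: int_cases) (simp_all add: of_nat_index)
  then have translate: "l (z - of_int k * v) = l z + (- (\<Sum>j\<in>UNIV. c $ j * v $ j)) * k" for z k
    by (simp add: l_eq right_diff_distrib sum_subtractf sum_distrib_left mult_ac)
  then show "(\<lambda>(z, k). l (z - of_int k * v)) \<in> affine_extension affine_maps"
    using affine_extensionI[OF assms] by (simp only:)
  show "(\<lambda>z. l (z - v)) \<in> affine_maps"
    using affine_closed_shift(2)[OF affine_closed_affine_maps assms] translate[of _ 1] by simp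
qed

lemma quasi_algebra_card_weighted_msets:
  fixes w :: "'i \<Rightarrow> int ^ 'r"
  assumes "finite A" and "\<And>i. i \<in> A \<Longrightarrow> 0 < coord_sum (w i)"
  shows "(\<lambda>z. of_nat (card (weighted_msets w A z))) \<in> quasi_algebra affine_maps"
  using assms
proof (induction A rule: finite_induct)
  case empty
  have "weighted_msets w {} z = (if z = 0 then {{#}} else {})" for z
    by (auto simp: weighted_msets_def)
  then have "of_nat (card (weighted_msets w {} z)) = (of_bool (z = 0) :: rat)" for z
    by (cases "z = 0") simp_all
  then show ?case by (simp add: quasi_algebra_eq_0)
next
  case (insert a A)
  have "(\<lambda>y. of_nat (card (weighted_msets w A (case y of (z, k) \<Rightarrow> z - of_int k * w a))))
      \<in> quasi_algebra (affine_extension affine_maps)"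
    using insert affine_maps_translate(1)
    by (intro quasi_algebra_pullback[where h = "\<lambda>(z, k). z - of_int k * w a"])
      (auto simp: case_prod_unfold)
  moreover have "coord_sum \<in> (affine_maps :: (int ^ 'r \<Rightarrow> int) set)"
    using affine_mapsI[of "\<chi> j. 1" 0] by (simp add: coord_sum_def[abs_def])
  ultimately have "(\<lambda>z. \<Sum>k=0..coord_sum z.
        of_nat (card (weighted_msets w A (case (z, k) of (z, k) \<Rightarrow> z - of_int k * w a))))
      \<in> quasi_algebra affine_maps"
    by (rule quasi_algebra_sum_interval[OF affine_closed_affine_maps])
  then show ?case
    by (simp only: card_weighted_msets_insert[OF insert.hyps insert.prems] of_nat_sum prod.case)
qed

lemma quasi_algebra_card_weighted_msets_above:
  fixes w :: "'i \<Rightarrow> int ^ 'r"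
  assumes "finite A" and "\<And>i. i \<in> A \<Longrightarrow> 0 < coord_sum (w i)"
  shows "(\<lambda>z. of_nat (card {M\<in>weighted_msets w A z. u \<subseteq># M})) \<in> quasi_algebra affine_maps"
proof (cases "set_mset u \<subseteq> A")
  case True
  have "{M\<in>weighted_msets w A z. u \<subseteq># M} =
      (\<lambda>M. u + M) ` weighted_msets w A (z - (\<Sum>i\<in>#u. w i))" for z
    using True by (auto simp: weighted_msets_def mset_subset_eq_exists_conv image_iff)
  then have "card {M\<in>weighted_msets w A z. u \<subseteq># M} =
      card (weighted_msets w A (z - (\<Sum>i\<in>#u. w i)))" for z
    by (simp add: card_image)
  then show ?thesis
    using quasi_algebra_pullback[where h = "\<lambda>z. z - (\<Sum>i\<in>#u. w i)",
        OF quasi_algebra_card_weighted_msets[OF assms] affine_maps_translate(2)]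
    by simp
next
  case False
  then have "{M\<in>weighted_msets w A z. u \<subseteq># M} = {}" for z
    by (auto simp: weighted_msets_def dest: set_mset_mono)
  then show ?thesis by (simp only: card.empty of_nat_0 quasi_algebra.const)
qed

lemma quasi_algebra_card_weighted_msets_avoiding:
  fixes w :: "'i \<Rightarrow> int ^ 'r"
  assumes "finite A" and pos: "\<And>i. i \<in> A \<Longrightarrow> 0 < coord_sum (w i)" and "finite B"
  shows "(\<lambda>z. of_nat (card {M\<in>weighted_msets w A z. u \<subseteq># M \<and> (\<forall>g\<in>B. \<not> g \<subseteq># M)}))
    \<in> quasi_algebra affine_maps"
  using assms(3)
proof (induction B arbitrary: u rule: finite_induct)
  case empty
  show ?case using quasi_algebra_card_weighted_msets_above[OF assms(1,2), where u = u] by simp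
next
  case (insert g B)
  let ?S = "\<lambda>u z. {M\<in>weighted_msets w A z. u \<subseteq># M \<and> (\<forall>g\<in>B. \<not> g \<subseteq># M)}"
  have "of_nat (card {M\<in>weighted_msets w A z. u \<subseteq># M \<and> (\<forall>g\<in>insert g B. \<not> g \<subseteq># M)}) =
     of_nat (card (?S u z)) - (of_nat (card (?S (u \<union># g) z)) :: rat)" for z
  proof -
    have "{M\<in>weighted_msets w A z. u \<subseteq># M \<and> (\<forall>g\<in>insert g B. \<not> g \<subseteq># M)} = ?S u z - ?S (u \<union># g) z"
      by auto
    moreover have "?S (u \<union># g) z \<subseteq> ?S u z" by auto
    moreover have "finite (?S u z)" using finite_weighted_msets[OF assms(1,2)] by simp
    ultimately show ?thesis
      by (simp add: card_Diff_subset finite_subset card_mono of_nat_diff)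
  qed
  then show ?case
    using quasi_algebra_diff[OF insert.IH[of u] insert.IH[of "u \<union># g"]] by (simp only:)
qed

definition least_representatives :: "('i::wellorder multiset \<Rightarrow> 'a) \<Rightarrow> 'i set \<Rightarrow> 'i multiset set" where
  "least_representatives val A =
    {M. set_mset M \<subseteq> A \<and> (\<forall>N. set_mset N \<subseteq> A \<longrightarrow> val N = val M \<longrightarrow> M \<le> N)}"

lemma bij_betw_least_representatives:
  "bij_betw val (least_representatives val A) (val ` {M. set_mset M \<subseteq> A})"
  unfolding bij_betw_def
proof (intro conjI equalityI subsetI)
  show "inj_on val (least_representatives val A)"
    by (rule inj_onI) (auto simp: least_representatives_def intro: antisym)
  fix x assume "x \<in> val ` {M. set_mset M \<subseteq> A}"
  then obtain N where N_rep: "set_mset N \<subseteq> A" "x = val N" by auto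
  define M where "M = (LEAST M. set_mset M \<subseteq> A \<and> val M = x)"
  have "set_mset M \<subseteq> A \<and> val M = x"
    unfolding M_def by (rule LeastI[of _ N]) (use N_rep in simp)
  moreover have "M \<le> N" if "set_mset N \<subseteq> A" "val N = x" for N
    unfolding M_def using that by (intro Least_le) simp
  ultimately show "x \<in> val ` least_representatives val A"
    by (intro image_eqI[of _ _ M]) (auto simp: least_representatives_def)
qed (auto simp: least_representatives_def)

text \<open>The multiset order is additive, so the representatives that are not least form an up-set.\<close>
lemma least_representatives_avoid_finite:
  fixes val :: "'i::wellorder multiset \<Rightarrow> 'a::plus"
  assumes "finite A" and val: "\<And>M N. val (M + N) = val M + val N"
  shows "\<exists>B. finite B \<and> least_representatives val A = {M. set_mset M \<subseteq> A \<and> (\<forall>g\<in>B. \<not> g \<subseteq># M)}"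
proof -
  define W where "W = {M. set_mset M \<subseteq> A} - least_representatives val A"
  have W_iff: "M \<in> W \<longleftrightarrow> set_mset M \<subseteq> A \<and> (\<exists>N. set_mset N \<subseteq> A \<and> val N = val M \<and> N < M)" for M
    by (auto simp: W_def least_representatives_def not_le)
  have upward: "M + P \<in> W" if M_in: "M \<in> W" and P_support: "set_mset P \<subseteq> A" for M P
  proof -
    obtain N where "set_mset N \<subseteq> A" "val N = val M" "N < M"
      using M_in by (auto simp: W_iff)
    with M_in P_support show ?thesis
      unfolding W_iff by (intro conjI exI[of _ "N + P"]) (auto simp: val)
  qed
  have "\<exists>B\<subseteq>W. finite B \<and> (\<forall>M\<in>W. \<exists>g\<in>B. g \<subseteq># M)"
    by (rule dickson_multiset[OF \<open>finite A\<close>]) (simp add: W_def)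
  then obtain B where "B \<subseteq> W" "finite B" and basis: "\<forall>M\<in>W. \<exists>g\<in>B. g \<subseteq># M"
    by (elim exE conjE) (rule that)
  have "M \<in> W \<longleftrightarrow> (\<exists>g\<in>B. g \<subseteq># M)" if "set_mset M \<subseteq> A" for M
    using that basis \<open>B \<subseteq> W\<close> upward by (fastforce simp: mset_subset_eq_exists_conv)
  then show ?thesis
    using \<open>finite B\<close> by (intro exI[of _ B]) (auto simp: W_def least_representatives_def)
qed

theorem quasi_algebra_card_fg_monoid:
  fixes N :: "'a::comm_monoid_add set" and deg :: "'a \<Rightarrow> int ^ 'r"
  assumes fg: "fg_monoid N" and deg: "deg 0 = 0" "\<And>x y. deg (x + y) = deg x + deg y"
    and pos: "\<And>x. x \<in> N \<Longrightarrow> x \<noteq> 0 \<Longrightarrow> 0 < coord_sum (deg x)"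
  shows "(\<lambda>z. of_nat (card {x\<in>N. deg x = z})) \<in> quasi_algebra affine_maps"
proof -
  obtain C where generators: "finite C" "0 \<notin> C" "N = is_submonoid hull C"
    using fg submonoid_hull_diff_0 unfolding fg_monoid_def by (metis Diff_iff finite_Diff insertI1)
  obtain h where enum: "bij_betw h {..<card C} C"
    using ex_bij_betw_nat_finite[OF generators(1)] by (auto simp: atLeast0LessThan)
  define val w where "val M = (\<Sum>i\<in>#M. h i)" and "w i = deg (h i)" for M :: "nat multiset" and i
  have deg_val: "deg (val M) = (\<Sum>i\<in>#M. w i)" for M
    by (induction M) (auto simp: val_def w_def deg)
  have N_val: "N = val ` {M. set_mset M \<subseteq> {..<card C}}"
  proof -
    have "N = is_submonoid hull (h ` {..<card C})"
      using generators(3) bij_betw_imp_surj_on[OF enum] by simp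
    then show ?thesis by (simp add: submonoid_hull_eq_sums msets_over_image val_def image_image)
  qed
  have w_pos: "0 < coord_sum (w i)" if "i \<in> {..<card C}" for i
  proof -
    have "h i \<in> C" using that bij_betwE[OF enum] by blast
    then show ?thesis unfolding w_def using generators(2,3) by (intro pos) (auto intro: hull_inc)
  qed
  obtain B where "finite B"
    and avoid: "least_representatives val {..<card C} =
        {M. set_mset M \<subseteq> {..<card C} \<and> (\<forall>g\<in>B. \<not> g \<subseteq># M)}"
    using least_representatives_avoid_finite[of "{..<card C}" val] by (auto simp: val_def)
  have "card {x\<in>N. deg x = z} =
      card {M\<in>weighted_msets w {..<card C} z. {#} \<subseteq># M \<and> (\<forall>g\<in>B. \<not> g \<subseteq># M)}" for z
  proof -
    have "bij_betw val {M\<in>least_representatives val {..<card C}. deg (val M) = z} {x\<in>N. deg x = z}"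
      using bij_betw_least_representatives[of val "{..<card C}"]
      unfolding N_val[symmetric] bij_betw_def inj_on_def by auto
    then show ?thesis
      by (simp add: bij_betw_same_card[symmetric] avoid deg_val weighted_msets_def conj_ac)
  qed
  then show ?thesis
    using quasi_algebra_card_weighted_msets_avoiding[of "{..<card C}" w, OF _ w_pos \<open>finite B\<close>,
        of "{#}"] by simp
qed

section \<open>Noetherian subrings\<close>

lemma is_subringD:
  assumes "is_subring A"
  shows is_subring_1: "1 \<in> A" and is_subring_0: "0 \<in> A"
    and is_subring_add: "x \<in> A \<Longrightarrow> y \<in> A \<Longrightarrow> x + y \<in> A"
    and is_subring_diff: "x \<in> A \<Longrightarrow> y \<in> A \<Longrightarrow> x - y \<in> A"
    and is_subring_mult: "x \<in> A \<Longrightarrow> y \<in> A \<Longrightarrow> x * y \<in> A"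
    and is_subring_power: "x \<in> A \<Longrightarrow> x ^ k \<in> A"
proof -
  show one: "1 \<in> A" and diff: "\<And>x y. x \<in> A \<Longrightarrow> y \<in> A \<Longrightarrow> x - y \<in> A"
    and mult: "\<And>x y. x \<in> A \<Longrightarrow> y \<in> A \<Longrightarrow> x * y \<in> A"
    and "x \<in> A \<Longrightarrow> y \<in> A \<Longrightarrow> x + y \<in> A"
    using assms by (auto simp: is_subring_def)
  show "0 \<in> A" using diff[OF one one] by simp
  show "x \<in> A \<Longrightarrow> x ^ k \<in> A" by (induction k) (use one mult in auto)
qed

lemma is_subring_sum: "is_subring A \<Longrightarrow> (\<And>i. i \<in> S \<Longrightarrow> f i \<in> A) \<Longrightarrow> sum f S \<in> A"
  by (induction S rule: infinite_finite_induct) (auto intro: is_subringD)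

lemma is_subring_hull: "is_subring (is_subring hull S)"
  by (rule hull_in) (auto simp: is_subring_def)

definition polys_over :: "'a::comm_ring_1 set \<Rightarrow> 'a poly set" where
  "polys_over B = {p. \<forall>i. coeff p i \<in> B}"

lemma is_subring_polys_over:
  assumes "is_subring B"
  shows "is_subring (polys_over B)"
  using assms unfolding is_subring_def[of "polys_over B"]
  by (auto simp: polys_over_def coeff_mult intro!: is_subring_sum)
    (auto simp: one_pCons coeff_pCons split: nat.split intro: is_subringD)

lemma pCons_in_polys_over: "b \<in> B \<Longrightarrow> p \<in> polys_over B \<Longrightarrow> pCons b p \<in> polys_over B"
  by (auto simp: polys_over_def coeff_pCons split: nat.split)

lemma const_poly_in_polys_over: "is_subring B \<Longrightarrow> b \<in> B \<Longrightarrow> [:b:] \<in> polys_over B"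
  by (intro pCons_in_polys_over is_subring_0 is_subring_polys_over)

definition adjoin :: "'a::comm_ring_1 set \<Rightarrow> 'a \<Rightarrow> 'a set" where
  "adjoin B x = (\<lambda>p. poly p x) ` polys_over B"

lemma is_subring_adjoin:
  assumes "is_subring B"
  shows "is_subring (adjoin B x)"
proof -
  note closed = is_subringD[OF is_subring_polys_over[OF assms]]
  show ?thesis
    unfolding is_subring_def adjoin_def
    using closed(1,3-5) by (auto simp flip: poly_add poly_diff poly_mult intro: image_eqI[of _ _ 1])
qed

lemma adjoin_eq_hull:
  assumes subring: "is_subring B"
  shows "adjoin B x = is_subring hull (insert x B)"
proof (rule hull_unique[symmetric])
  have "[:0, 1:] \<in> polys_over B"
    by (intro pCons_in_polys_over const_poly_in_polys_over is_subringD subring)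
  then have "x \<in> adjoin B x" by (force simp: adjoin_def)
  moreover have "b \<in> adjoin B x" if "b \<in> B" for b
    using const_poly_in_polys_over[OF subring that] by (force simp: adjoin_def)
  ultimately show "insert x B \<subseteq> adjoin B x" by auto
  show "is_subring (adjoin B x)" by (rule is_subring_adjoin[OF subring])
  show "adjoin B x \<subseteq> A" if "insert x B \<subseteq> A" "is_subring A" for A
    using that unfolding adjoin_def polys_over_def
    by (auto simp: poly_altdef intro!: is_subring_sum is_subring_mult is_subring_power)
qed

lemma ideal_ofD:
  assumes "ideal_of A I"
  shows ideal_of_0: "0 \<in> I" and ideal_of_add: "x \<in> I \<Longrightarrow> y \<in> I \<Longrightarrow> x + y \<in> I"
    and ideal_of_mult: "a \<in> A \<Longrightarrow> x \<in> I \<Longrightarrow> a * x \<in> I" and ideal_of_subset: "I \<subseteq> A"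
  using assms by (auto simp: ideal_of_def)

lemma ideal_of_diff:
  assumes "is_subring A" "ideal_of A I" "x \<in> I" "y \<in> I"
  shows "x - y \<in> I"
proof -
  have "- 1 \<in> A" using is_subring_diff[OF assms(1) is_subring_0 is_subring_1] assms(1) by simp
  then show ?thesis
    using ideal_of_add[OF assms(2,3) ideal_of_mult[OF assms(2), of "- 1" y]] assms(4) by simp
qed

text \<open>The powers of \<open>x\<close> may be linearly dependent over \<open>B\<close>, so an element does not determine its
  leading coefficient: all representing polynomials count.\<close>
definition lead_ideal :: "'a::comm_ring_1 set \<Rightarrow> 'a \<Rightarrow> 'a set \<Rightarrow> nat \<Rightarrow> 'a set" where
  "lead_ideal B x I k = {coeff p k | p. p \<in> polys_over B \<and> degree p \<le> k \<and> poly p x \<in> I}"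

lemma lead_idealI:
  "p \<in> polys_over B \<Longrightarrow> degree p \<le> k \<Longrightarrow> poly p x \<in> I \<Longrightarrow> coeff p k \<in> lead_ideal B x I k"
  by (auto simp: lead_ideal_def)

lemma lead_idealE:
  assumes "b \<in> lead_ideal B x I k"
  obtains p where "p \<in> polys_over B" "degree p \<le> k" "poly p x \<in> I" "b = coeff p k"
  using assms by (auto simp: lead_ideal_def)

lemma ideal_of_lead_ideal:
  assumes subring: "is_subring B" and ideal: "ideal_of (adjoin B x) I"
  shows "ideal_of B (lead_ideal B x I k)"
  unfolding ideal_of_def
proof (intro conjI ballI)
  note closed = is_subringD[OF is_subring_polys_over[OF subring]]
  show "lead_ideal B x I k \<subseteq> B" by (auto simp: lead_ideal_def polys_over_def)
  show "0 \<in> lead_ideal B x I k"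
    using lead_idealI[of 0 B k x I] ideal_of_0[OF ideal] closed(2) by simp
  fix b assume "b \<in> lead_ideal B x I k"
  then obtain p where p_rep: "p \<in> polys_over B" "degree p \<le> k" "poly p x \<in> I" "b = coeff p k"
    by (rule lead_idealE)
  show "b + c \<in> lead_ideal B x I k" if "c \<in> lead_ideal B x I k" for c
  proof -
    from that obtain q where q_rep: "q \<in> polys_over B" "degree q \<le> k" "poly q x \<in> I" "c = coeff q k"
      by (rule lead_idealE)
    show ?thesis
      using lead_idealI[of "p + q" B k x I] p_rep q_rep closed(3) ideal_of_add[OF ideal]
      by (simp add: degree_add_le)
  qed
  show "a * b \<in> lead_ideal B x I k" if "a \<in> B" for a
  proof -
    have "smult a p \<in> polys_over B"
      using closed(5)[OF const_poly_in_polys_over[OF subring that] p_rep(1)] by simp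
    moreover have "a * poly p x \<in> I"
      using that p_rep(3)
      by (intro ideal_of_mult[OF ideal]) (auto simp: adjoin_eq_hull[OF subring] intro: hull_inc)
    ultimately show ?thesis
      using lead_idealI[of "smult a p" B k x I] p_rep degree_smult_le[of a p] by simp
  qed
qed

lemma lead_ideal_Suc:
  assumes subring: "is_subring B" and ideal: "ideal_of (adjoin B x) I"
  shows "lead_ideal B x I k \<subseteq> lead_ideal B x I (Suc k)"
proof
  fix b assume "b \<in> lead_ideal B x I k"
  then obtain p where p_rep: "p \<in> polys_over B" "degree p \<le> k" "poly p x \<in> I" "b = coeff p k"
    by (rule lead_idealE)
  have "x \<in> adjoin B x" by (simp add: adjoin_eq_hull[OF subring] hull_inc)
  then have "poly (pCons 0 p) x \<in> I" using p_rep(3) ideal_of_mult[OF ideal] by simp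
  then show "b \<in> lead_ideal B x I (Suc k)"
    using lead_idealI[of "pCons 0 p" B "Suc k" x I]
      p_rep pCons_in_polys_over[OF is_subring_0[OF subring]]
      degree_pCons_le[of 0 p] by simp
qed

lemma lead_ideal_mono: "I \<subseteq> I' \<Longrightarrow> lead_ideal B x I k \<subseteq> lead_ideal B x I' k"
  unfolding lead_ideal_def by blast

lemma ideal_subset_if_lead_ideals_subset:
  assumes subring: "is_subring B"
    and ideals: "ideal_of (adjoin B x) I" "ideal_of (adjoin B x) I'" "I \<subseteq> I'"
    and lead: "\<And>k. lead_ideal B x I' k \<subseteq> lead_ideal B x I k"
  shows "I' \<subseteq> I"
proof
  have reduce: "poly p x \<in> I" if "p \<in> polys_over B" "poly p x \<in> I'" "\<forall>i\<ge>n. coeff p i = 0" for n p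
    using that
  proof (induction n arbitrary: p)
    case 0
    then have "p = 0" by (simp add: poly_eq_iff)
    then show ?case using ideal_of_0[OF ideals(1)] by simp
  next
    case (Suc n)
    then have "degree p \<le> n" by (intro degree_le) auto
    then have "coeff p n \<in> lead_ideal B x I n"
      using lead Suc.prems(1,2) lead_idealI by blast
    then obtain q where q_rep: "q \<in> polys_over B" "degree q \<le> n" "poly q x \<in> I"
      "coeff p n = coeff q n"
      by (rule lead_idealE)
    have "coeff (p - q) i = 0" if "i \<ge> n" for i
      using that Suc.prems(3) q_rep(2,4) by (cases "i = n") (simp_all add: coeff_eq_0)
    moreover have "p - q \<in> polys_over B"
      by (intro is_subring_diff is_subring_polys_over subring Suc.prems q_rep)
    moreover have "poly (p - q) x \<in> I'"
      using ideal_of_diff[OF is_subring_adjoin[OF subring] ideals(2)]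
        Suc.prems(2) q_rep(3) ideals(3) by auto
    ultimately have "poly (p - q) x \<in> I" by (intro Suc.IH) auto
    then show ?case using ideal_of_add[OF ideals(1) _ q_rep(3)] by fastforce
  qed
  fix f assume f_in: "f \<in> I'"
  then obtain p where "p \<in> polys_over B" "f = poly p x"
    using ideal_of_subset[OF ideals(2)] by (auto simp: adjoin_def)
  with f_in show "f \<in> I" using reduce[of p "Suc (degree p)"] by (simp add: coeff_eq_0)
qed

lemma noetherian_subring_is_subring: "noetherian_subring A \<Longrightarrow> is_subring A"
  by (simp add: noetherian_subring_def)

lemma noetherian_double_chain_stationary:
  fixes L :: "nat \<Rightarrow> nat \<Rightarrow> 'a::comm_ring_1 set"
  assumes "noetherian_subring B" and ideal: "\<And>k m. ideal_of B (L k m)"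
    and mono: "\<And>k k' m m'. k \<le> k' \<Longrightarrow> m \<le> m' \<Longrightarrow> L k m \<subseteq> L k' m'"
  shows "\<exists>T. \<forall>m\<ge>T. \<forall>k. L k m = L k T"
proof -
  have stationary: "\<exists>N. \<forall>m\<ge>N. C m = C N" if "\<And>i. ideal_of B (C i)" "\<And>i. C i \<subseteq> C (Suc i)" for C
    using assms(1) that unfolding noetherian_subring_def by blast
  have "\<exists>N. \<forall>m\<ge>N. L m m = L N N"
    by (rule stationary) (simp_all add: ideal mono)
  then obtain N where diagonal: "\<And>m. m \<ge> N \<Longrightarrow> L m m = L N N" by auto
  have "\<forall>k. \<exists>M. \<forall>m\<ge>M. L k m = L k M"
    by (intro allI stationary) (simp_all add: ideal mono)
  then obtain M where rows: "\<And>k m. m \<ge> M k \<Longrightarrow> L k m = L k (M k)" by metis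
  define T where "T = N + (\<Sum>k<N. M k)"
  have "L k m = L k T" if "m \<ge> T" for k m
  proof (cases "k < N")
    case True
    then have "M k \<le> (\<Sum>k<N. M k)" by (intro member_le_sum) auto
    then have "M k \<le> T" by (simp add: T_def)
    then show ?thesis using rows[of k m] rows[of k T] that by simp
  next
    case False
    have "L k j = L N N" if "j \<ge> N" for j
    proof
      show "L N N \<subseteq> L k j" using False that by (intro mono) auto
      have "L k j \<subseteq> L (max k j) (max k j)" by (intro mono) auto
      then show "L k j \<subseteq> L N N" using diagonal[of "max k j"] that by simp
    qed
    then show ?thesis using that by (simp add: T_def)
  qed
  then show ?thesis by blast
qed

theorem hilbert_basis:
  assumes "noetherian_subring B"
  shows "noetherian_subring (adjoin B x)"
  unfolding noetherian_subring_def
proof (intro conjI allI impI)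
  note subring = noetherian_subring_is_subring[OF assms]
  show "is_subring (adjoin B x)" by (rule is_subring_adjoin[OF subring])
  fix I :: "nat \<Rightarrow> 'a set"
  assume "(\<forall>i. ideal_of (adjoin B x) (I i)) \<and> (\<forall>i. I i \<subseteq> I (Suc i))"
  then have ideals: "\<And>i. ideal_of (adjoin B x) (I i)" and mono: "\<And>i j. i \<le> j \<Longrightarrow> I i \<subseteq> I j"
    using lift_Suc_mono_le[of I] by auto
  have lead_mono: "lead_ideal B x (I m) k \<subseteq> lead_ideal B x (I m') k'"
    if "k \<le> k'" "m \<le> m'" for k k' m m'
    using lift_Suc_mono_le[of "lead_ideal B x (I m)", OF lead_ideal_Suc[OF subring ideals] that(1)]
      lead_ideal_mono[OF mono[OF that(2)]] by blast
  obtain T where stable: "\<And>m k. m \<ge> T \<Longrightarrow> lead_ideal B x (I m) k = lead_ideal B x (I T) k"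
    using noetherian_double_chain_stationary[OF assms, of "\<lambda>k m. lead_ideal B x (I m) k"]
      ideal_of_lead_ideal[OF subring ideals] lead_mono by blast
  have "I m \<subseteq> I T" if "m \<ge> T" for m
    using stable[OF that]
    by (intro ideal_subset_if_lead_ideals_subset[OF subring ideals ideals mono[OF that]]) simp
  with mono show "\<exists>N. \<forall>m\<ge>N. I m = I N" by blast
qed

lemma noetherian_subring_hull:
  assumes "noetherian_subring B" "finite X"
  shows "noetherian_subring (is_subring hull (B \<union> X))"
  using assms(2)
proof (induction X rule: finite_induct)
  case empty
  then show ?case using assms(1) by (simp add: hull_same noetherian_subring_is_subring)
next
  case (insert x X)
  have "is_subring hull (B \<union> insert x X) = adjoin (is_subring hull (B \<union> X)) x"
    using hull_insert[of is_subring x "B \<union> X"] by (simp add: adjoin_eq_hull is_subring_hull)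
  then show ?case using hilbert_basis[OF insert.IH] by simp
qed

lemma noetherian_subring_field:
  assumes subring: "is_subring B" and inverse: "\<And>b. b \<in> B \<Longrightarrow> b \<noteq> 0 \<Longrightarrow> \<exists>c\<in>B. c * b = 1"
  shows "noetherian_subring B"
  unfolding noetherian_subring_def
proof (intro conjI allI impI subring)
  fix L :: "nat \<Rightarrow> 'a set"
  assume chain: "(\<forall>i. ideal_of B (L i)) \<and> (\<forall>i. L i \<subseteq> L (Suc i))"
  have trivial: "L i = {0} \<or> L i = B" for i
  proof -
    note ideal = ideal_ofD[OF conjunct1[OF chain, rule_format, of i]]
    have "L i = B" if b_in: "b \<in> L i" "b \<noteq> 0" for b
    proof -
      obtain c where "c \<in> B" "c * b = 1" using inverse[of b] b_in ideal(4) by blast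
      then have "1 \<in> L i" using ideal(3)[of c b] b_in by simp
      then have "a \<in> L i" if "a \<in> B" for a using ideal(3)[OF that, of 1] by simp
      with ideal(4) show ?thesis by blast
    qed
    with ideal(1) show ?thesis by blast
  qed
  have mono: "L i \<subseteq> L j" if "i \<le> j" for i j using lift_Suc_mono_le[of L, OF _ that] chain by simp
  show "\<exists>N. \<forall>m\<ge>N. L m = L N"
  proof (cases "\<exists>N. L N = B")
    case True
    then obtain N where reached: "L N = B" by auto
    have "L m = L N" if "m \<ge> N" for m
      using mono[OF that] reached chain unfolding ideal_of_def by blast
    then show ?thesis by blast
  next
    case False
    then have "L m = {0}" for m using trivial by blast
    then show ?thesis by blast
  qed
qed

section \<open>Monomial ideals\<close>

type_synonym 'v exponent = "'v \<Rightarrow>\<^sub>0 nat"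

abbreviation "lookup \<equiv> Poly_Mapping.lookup"
abbreviation "keys \<equiv> Poly_Mapping.keys"
abbreviation "single \<equiv> Poly_Mapping.single"

abbreviation exp_le_on :: "'v set \<Rightarrow> 'v exponent \<Rightarrow> 'v exponent \<Rightarrow> bool" where
  "exp_le_on A a b \<equiv> \<forall>i\<in>A. lookup a i \<le> lookup b i"

lemma exp_le_imp_add_diff:
  assumes "exp_le_on UNIV a b"
  shows "b = a + (b - a)"
  using assms by (intro poly_mapping_eqI) (simp add: lookup_add lookup_minus)

lemma sum_single_keys:
  fixes f :: "'a \<Rightarrow>\<^sub>0 'b::comm_monoid_add"
  shows "(\<Sum>a\<in>keys f. single a (lookup f a)) = f"
proof (rule poly_mapping_eqI)
  fix k
  have "lookup (\<Sum>a\<in>keys f. single a (lookup f a)) k = (\<Sum>a\<in>keys f. if a = k then lookup f a else 0)"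
    by (simp add: lookup_sum lookup_single when_def)
  then show "lookup (\<Sum>a\<in>keys f. single a (lookup f a)) k = lookup f k"
    by (simp add: in_keys_iff)
qed

lemma mult_eq_sum_single:
  fixes f g :: "'a::comm_monoid_add \<Rightarrow>\<^sub>0 'b::comm_semiring_0"
  shows "f * g = (\<Sum>k\<in>keys f. \<Sum>l\<in>keys g. single (k + l) (lookup f k * lookup g l))"
proof -
  have "f * g = (\<Sum>k\<in>keys f. single k (lookup f k)) * (\<Sum>l\<in>keys g. single l (lookup g l))"
    by (simp only: sum_single_keys)
  then show ?thesis by (simp only: sum_product mult_single)
qed

lemma keys_mult_subset_plus: "keys (f * g) \<subseteq> keys f + keys g"
  using keys_mult[of f g] unfolding set_plus_def by blast

lemma keys_prod_subset_sum:
  fixes f :: "'i \<Rightarrow> ('a::comm_monoid_add \<Rightarrow>\<^sub>0 'b::comm_semiring_1)"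
  shows "keys (\<Prod>j\<in>A. f j) \<subseteq> (\<Sum>j\<in>A. keys (f j))"
proof (induction A rule: infinite_finite_induct)
  case (insert j A)
  then show ?case
    using order_trans[OF keys_mult_subset_plus set_plus_mono2[OF subset_refl insert.IH]] by simp
qed simp_all

definition upset :: "'a::plus set \<Rightarrow> bool" where
  "upset U \<longleftrightarrow> (\<forall>a\<in>U. \<forall>c. a + c \<in> U)"

lemma upset_UNIV: "upset UNIV"
  by (simp add: upset_def)

lemma upset_plus: "upset V \<Longrightarrow> upset (U + V)" for U V :: "'a::semigroup_add set"
  by (fastforce simp: upset_def set_plus_def add.assoc)

lemma UNIV_plus_upset:
  fixes U :: "'a::comm_monoid_add set"
  assumes "upset U"
  shows "UNIV + U = U"
proof
  have "c + a \<in> U" if "a \<in> U" for a c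
    using assms that by (simp add: upset_def add.commute[of c])
  then show "UNIV + U \<subseteq> U" by (auto elim!: set_plus_elim)
qed (simp add: set_zero_plus2)

lemma upset_exp_le: "upset U \<Longrightarrow> a \<in> U \<Longrightarrow> exp_le_on UNIV a b \<Longrightarrow> b \<in> U"
  using exp_le_imp_add_diff unfolding upset_def by metis

definition mon_span :: "'v exponent set \<Rightarrow> ('v, 'k::field) mpoly set" where
  "mon_span U = {f. keys f \<subseteq> U}"

lemma mon_span_mono: "U \<subseteq> V \<Longrightarrow> mon_span U \<subseteq> mon_span V"
  by (auto simp: mon_span_def)

lemma mon_span_0: "0 \<in> mon_span U"
  and mon_span_add: "f \<in> mon_span U \<Longrightarrow> g \<in> mon_span U \<Longrightarrow> f + g \<in> mon_span U"
  and mon_span_diff: "f \<in> mon_span U \<Longrightarrow> g \<in> mon_span U \<Longrightarrow> f - g \<in> mon_span U"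
  using keys_add[of f g] keys_diff[of f g] by (auto simp: mon_span_def)

lemma mon_span_sum: "(\<And>i. i \<in> A \<Longrightarrow> f i \<in> mon_span U) \<Longrightarrow> sum f A \<in> mon_span U"
  by (induction A rule: infinite_finite_induct) (auto intro: mon_span_0 mon_span_add)

lemma mon_span_mult: "f \<in> mon_span U \<Longrightarrow> g \<in> mon_span V \<Longrightarrow> f * g \<in> mon_span (U + V)"
  using keys_mult_subset_plus[of f g] set_plus_mono2[of "keys f" U "keys g" V]
  by (auto simp: mon_span_def)

lemma is_ideal_mon_span:
  fixes U :: "'v exponent set"
  assumes "upset U"
  shows "is_ideal (mon_span U)"
proof -
  have "a * f \<in> mon_span U" if "f \<in> mon_span U" for a f :: "('v, 'k::field) mpoly"
    using mon_span_mult[of a UNIV f U] that by (simp add: UNIV_plus_upset[OF assms] mon_span_def)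
  then show ?thesis by (auto simp: is_ideal_def intro: mon_span_0 mon_span_add)
qed

lemma monom_in_mon_span_iff: "monom a \<in> mon_span U \<longleftrightarrow> a \<in> U"
  by (simp add: monom_def mon_span_def)

lemma monom_add: "monom (a + b) = monom a * monom b"
  by (simp add: monom_def mult_single)

lemma monom_sum: "monom (\<Sum>j\<in>A. f j) = (\<Prod>j\<in>A. monom (f j))"
  by (induction A rule: infinite_finite_induct) (simp_all add: monom_add, simp_all add: monom_def)

lemma ideal_gen_eq_hull: "ideal_gen S = is_ideal hull S"
  by (simp add: ideal_gen_def hull_def)

lemma is_ideal_ideal_gen: "is_ideal (ideal_gen S)"
  unfolding ideal_gen_eq_hull by (rule hull_in) (auto simp: is_ideal_def)

lemma ideal_gen_inc: "x \<in> S \<Longrightarrow> x \<in> ideal_gen S"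
  by (simp add: ideal_gen_eq_hull hull_inc)

lemma ideal_gen_minimal: "S \<subseteq> I \<Longrightarrow> is_ideal I \<Longrightarrow> ideal_gen S \<subseteq> I"
  by (simp add: ideal_gen_eq_hull hull_minimal)

lemma is_ideal_sum: "is_ideal I \<Longrightarrow> (\<And>i. i \<in> A \<Longrightarrow> f i \<in> I) \<Longrightarrow> sum f A \<in> I"
  by (induction A rule: infinite_finite_induct) (auto simp: is_ideal_def)

lemma is_ideal_diff:
  assumes "is_ideal I" "x \<in> I" "y \<in> I"
  shows "x - y \<in> I"
proof -
  have "x + (- 1) * y \<in> I" using assms unfolding is_ideal_def by blast
  then show ?thesis by simp
qed

lemma mon_span_subset_ideal:
  assumes ideal: "is_ideal I" and monom: "\<And>a. a \<in> U \<Longrightarrow> monom a \<in> I"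
  shows "mon_span U \<subseteq> I"
proof
  fix f :: "('a, 'b) mpoly" assume f_in: "f \<in> mon_span U"
  have "single a c \<in> I" if "a \<in> U" for a c
  proof -
    have "single a c = single 0 c * monom a" by (simp add: monom_def mult_single)
    then show ?thesis using ideal monom[OF that] by (auto simp: is_ideal_def)
  qed
  then have "(\<Sum>a\<in>keys f. single a (lookup f a)) \<in> I"
    using f_in by (intro is_ideal_sum[OF ideal]) (auto simp: mon_span_def)
  then show "f \<in> I" by (simp only: sum_single_keys)
qed

lemma ideal_gen_eq_mon_span:
  assumes "upset U" "S \<subseteq> mon_span U" "\<And>a. a \<in> U \<Longrightarrow> monom a \<in> ideal_gen S"
  shows "ideal_gen S = mon_span U"
  by (intro equalityI ideal_gen_minimal is_ideal_mon_span mon_span_subset_ideal is_ideal_ideal_gen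
      assms)

lemma ideal_gen_monoms: "ideal_gen (monom ` B) = mon_span (B + UNIV)"
proof (rule ideal_gen_eq_mon_span)
  show "upset (B + UNIV)" by (intro upset_plus upset_UNIV)
  have "B \<subseteq> B + UNIV" using set_zero_plus2[of UNIV B] by (simp add: add.commute)
  then show "monom ` B \<subseteq> mon_span (B + UNIV)" by (auto simp: monom_in_mon_span_iff)
  fix a assume "a \<in> B + UNIV"
  then obtain b c where "b \<in> B" "a = c + b" by (auto simp: add.commute elim: set_plus_elim)
  then show "monom a \<in> ideal_gen (monom ` B)"
    using is_ideal_ideal_gen[of "monom ` B"] ideal_gen_inc[of "monom b" "monom ` B"]
    by (auto simp: monom_add is_ideal_def)
qed

lemma monomial_ideal_finitely_generated:
  fixes I :: "('v::finite, 'k::field) mpoly set"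
  assumes "monomial_ideal I"
  shows "\<exists>B. finite B \<and> I = mon_span (B + UNIV)"
proof -
  obtain W where I_eq: "I = mon_span (W + UNIV)"
    using assms ideal_gen_monoms unfolding monomial_ideal_def by (metis subset_imageE)
  obtain B where basis: "B \<subseteq> W" "finite B" and minimal: "\<forall>w\<in>W. \<exists>b\<in>B. exp_le_on UNIV b w"
    using dickson[OF finite_class.finite_UNIV, of W lookup] by (elim exE conjE) (rule that)
  have "W \<subseteq> B + UNIV"
  proof
    fix w assume "w \<in> W"
    then obtain b where "b \<in> B" "exp_le_on UNIV b w" using minimal by blast
    then show "w \<in> B + UNIV"
      using exp_le_imp_add_diff[of b w] set_plus_intro[of b B "w - b" UNIV] by simp
  qed
  then have "W + UNIV \<subseteq> B + UNIV + UNIV" by (intro set_plus_mono2) auto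
  moreover have "B + UNIV \<subseteq> W + UNIV" using basis(1) by (intro set_plus_mono2) auto
  ultimately have "W + UNIV = B + UNIV"
    by (simp add: add.assoc UNIV_plus_upset upset_UNIV subset_antisym)
  with I_eq basis(2) show ?thesis by auto
qed

lemma ideal_mult_mon_span:
  fixes U V :: "'v exponent set"
  assumes "upset V"
  shows "ideal_mult (mon_span U) (mon_span V) = (mon_span (U + V) :: ('v, 'k::field) mpoly set)"
  unfolding ideal_mult_def
proof (rule ideal_gen_eq_mon_span[OF upset_plus[OF assms]])
  show "{f * g |f g. f \<in> mon_span U \<and> g \<in> mon_span V} \<subseteq> (mon_span (U + V) :: ('v, 'k) mpoly set)"
    by (auto intro: mon_span_mult)
  fix a assume "a \<in> U + V"
  then obtain b c where "a = b + c" "b \<in> U" "c \<in> V" by (rule set_plus_elim)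
  then show "monom a \<in> ideal_gen {f * g |f g. f \<in> (mon_span U :: ('v, 'k) mpoly set) \<and>
      g \<in> mon_span V}"
    by (intro ideal_gen_inc CollectI exI[of _ "monom b"] exI[of _ "monom c"])
      (simp add: monom_add monom_in_mon_span_iff)
qed

primrec exp_pow :: "'v exponent set \<Rightarrow> nat \<Rightarrow> 'v exponent set" where
  "exp_pow U 0 = UNIV"
| "exp_pow U (Suc k) = U + exp_pow U k"

lemma upset_exp_pow: "upset (exp_pow U k)"
  by (induction k) (auto intro: upset_plus upset_UNIV)

lemma exp_pow_add: "exp_pow U (k + l) = exp_pow U k + exp_pow U l"
  by (induction k) (simp_all add: UNIV_plus_upset upset_exp_pow add.assoc)

lemma ideal_pow_mon_span: "ideal_pow (mon_span U) k = mon_span (exp_pow U k)"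
  by (induction k) (auto simp: ideal_mult_mon_span upset_exp_pow mon_span_def[of UNIV])

definition exp_multipow :: "('r \<Rightarrow> 'v exponent set) \<Rightarrow> ('r \<Rightarrow> nat) \<Rightarrow> 'v exponent set" where
  "exp_multipow U n = (\<Sum>j\<in>UNIV. exp_pow (U j) (n j))"

lemma exp_multipow_add: "exp_multipow U (\<lambda>j. m j + n j) = exp_multipow U m + exp_multipow U n"
  by (simp add: exp_multipow_def exp_pow_add sum.distrib)

lemma upset_exp_multipow: "upset (exp_multipow (U :: 'r::finite \<Rightarrow> _) n)"
proof -
  have "exp_multipow U n = (\<Sum>j\<in>UNIV - {undefined}. exp_pow (U j) (n j)) +
      exp_pow (U undefined) (n undefined)"
    by (simp add: exp_multipow_def sum.remove[of UNIV undefined] add.commute)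
  then show ?thesis by (simp add: upset_plus upset_exp_pow)
qed

lemma ideal_multipow_mon_span:
  fixes U :: "'r::finite \<Rightarrow> 'v exponent set"
  shows "ideal_multipow (\<lambda>j. mon_span (U j)) n =
      (mon_span (exp_multipow U n) :: ('v, 'k::field) mpoly set)"
  unfolding ideal_multipow_def ideal_pow_mon_span
proof (rule ideal_gen_eq_mon_span[OF upset_exp_multipow])
  let ?products = "{\<Prod>j\<in>UNIV. f j |f.
      \<forall>j. f j \<in> (mon_span (exp_pow (U j) (n j)) :: ('v, 'k) mpoly set)}"
  have "(\<Prod>j\<in>UNIV. f j) \<in> mon_span (exp_multipow U n)"
    if "\<forall>j. f j \<in> mon_span (exp_pow (U j) (n j))" for f :: "'r \<Rightarrow> ('v, 'k) mpoly"
  proof -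
    have "(\<Sum>j\<in>UNIV. keys (f j)) \<subseteq> exp_multipow U n"
      using that by (auto simp: exp_multipow_def set_sum_alt mon_span_def)
    then show ?thesis using keys_prod_subset_sum[of f UNIV] by (auto simp: mon_span_def)
  qed
  then show "?products \<subseteq> mon_span (exp_multipow U n)" by auto
  fix a assume "a \<in> exp_multipow U n"
  then obtain f where "a = (\<Sum>j\<in>UNIV. f j)" "\<forall>j. f j \<in> exp_pow (U j) (n j)"
    by (auto simp: exp_multipow_def set_sum_alt)
  then have "monom a \<in> ?products"
    by (intro CollectI exI[of _ "\<lambda>j. monom (f j)"]) (simp add: monom_sum monom_in_mon_span_iff)
  then show "monom a \<in> ideal_gen ?products" by (rule ideal_gen_inc)
qed

section \<open>Saturation of monomial ideals\<close>

text \<open>The exponents in the contraction of the localisation at the prime \<open>(X\<^sub>i : i \<in> A)\<close>.\<close>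
definition local_exps :: "'v exponent set \<Rightarrow> 'v set \<Rightarrow> 'v exponent set" where
  "local_exps U A = {a. \<exists>b\<in>U. exp_le_on A b a}"

text \<open>The sets \<open>A\<close> of variables such that the prime \<open>(X\<^sub>i : i \<in> A)\<close> does not contain \<open>J\<close>.\<close>
definition avoiding :: "('v, 'k::field) mpoly set \<Rightarrow> 'v set set" where
  "avoiding J = {A. \<exists>g\<in>J. \<exists>a\<in>keys g. keys a \<inter> A = {}}"

lemma avoiding_antimono: "B \<in> avoiding J \<Longrightarrow> A \<subseteq> B \<Longrightarrow> A \<in> avoiding J"
  by (fastforce simp: avoiding_def)

lemma subset_local_exps: "U \<subseteq> local_exps U A"
  by (auto simp: local_exps_def)

lemma local_exps_exp_le_on: "a \<in> local_exps U A \<Longrightarrow> exp_le_on A a b \<Longrightarrow> b \<in> local_exps U A"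
  unfolding local_exps_def using le_trans by blast

lemma additive_order_refining_degree:
  fixes A :: "'v::finite set"
  obtains e :: "'v exponent \<Rightarrow> (nat \<Rightarrow>\<^sub>0 nat)" where
    "inj e" "\<And>a b. e (a + b) = e a + e b"
    "\<And>a b. (\<Sum>i\<in>A. lookup a i) < (\<Sum>i\<in>A. lookup b i) \<Longrightarrow> e a < e b"
proof -
  obtain idx :: "'v \<Rightarrow> nat" where idx: "inj idx"
    using finite_imp_inj_to_nat_seg[of "UNIV :: 'v set"] by auto
  define e where "e a = single 0 (\<Sum>i\<in>A. lookup a i) + (\<Sum>i\<in>UNIV. single (Suc (idx i)) (lookup a i))"
    for a :: "'v exponent"
  have lookup_0: "lookup (e a) 0 = (\<Sum>i\<in>A. lookup a i)" for a
    by (simp add: e_def lookup_add lookup_sum lookup_single)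
  have lookup_Suc: "lookup (e a) (Suc (idx i)) = lookup a i" for a i
  proof -
    have "lookup (e a) (Suc (idx i)) = (\<Sum>k\<in>UNIV. if k = i then lookup a k else 0)"
      using idx
      by (auto simp: e_def lookup_add lookup_sum lookup_single when_def inj_eq intro!: sum.cong)
    then show ?thesis by simp
  qed
  show thesis
  proof (rule that[of e])
    show "inj e" by (rule injI, rule poly_mapping_eqI) (metis lookup_Suc)
    show "e (a + b) = e a + e b" for a b
      by (simp add: e_def lookup_add single_add sum.distrib algebra_simps)
    show "e a < e b" if "(\<Sum>i\<in>A. lookup a i) < (\<Sum>i\<in>A. lookup b i)" for a b
      unfolding less_poly_mapping.rep_eq less_fun_def using that
      by (intro exI[of _ 0]) (simp add: lookup_0)
  qed
qed

lemma lookup_mult_unique: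
  fixes f g :: "'a::comm_monoid_add \<Rightarrow>\<^sub>0 'b::comm_semiring_0"
  assumes "a \<in> keys f" "b \<in> keys g"
    and unique: "\<And>a' b'. a' \<in> keys f \<Longrightarrow> b' \<in> keys g \<Longrightarrow> a' + b' = a + b \<Longrightarrow> a' = a \<and> b' = b"
  shows "lookup (f * g) (a + b) = lookup f a * lookup g b"
proof -
  let ?K = "keys f \<times> keys g"
  have "f * g = (\<Sum>(k, l)\<in>?K. single (k + l) (lookup f k * lookup g l))"
    unfolding mult_eq_sum_single[of f g] sum.cartesian_product ..
  then have "lookup (f * g) (a + b) = (\<Sum>(k, l)\<in>?K. (lookup f k * lookup g l when k + l = a + b))"
    by (simp add: lookup_sum lookup_single case_prod_unfold)
  also have "\<dots> = (\<Sum>(k, l)\<in>{(a, b)}. (lookup f k * lookup g l when k + l = a + b))"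
    using assms(1,2)
    by (intro sum.mono_neutral_right) (auto simp: when_def split: if_splits dest: unique)
  finally show ?thesis by simp
qed

text \<open>The least exponents of \<open>g\<close> and of \<open>f\<close> outside the up-set cannot cancel in \<open>g * f\<close>.\<close>
lemma mon_span_local_exps_cancel:
  fixes f g :: "('v::finite, 'k::field) mpoly"
  assumes b_key: "b \<in> keys g" "keys b \<inter> A = {}"
    and product_in: "g * f \<in> mon_span (local_exps U A)"
  shows "f \<in> mon_span (local_exps U A)"
proof (rule ccontr)
  obtain e :: "'v exponent \<Rightarrow> (nat \<Rightarrow>\<^sub>0 nat)" where order: "inj e" "\<And>a b. e (a + b) = e a + e b"
    "\<And>a b. (\<Sum>i\<in>A. lookup a i) < (\<Sum>i\<in>A. lookup b i) \<Longrightarrow> e a < e b"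
    using additive_order_refining_degree[of A] by metis
  assume "f \<notin> mon_span (local_exps U A)"
  then have nonempty: "keys f - local_exps U A \<noteq> {}" by (auto simp: mon_span_def)
  define a where "a = arg_min_on e (keys f - local_exps U A)"
  have a_outside: "a \<in> keys f" "a \<notin> local_exps U A"
    using arg_min_if_finite(1)[OF _ nonempty, of e] by (auto simp: a_def)
  have a_least: "e a \<le> e a'" if "a' \<in> keys f" "a' \<notin> local_exps U A" for a'
    unfolding a_def using that by (intro arg_min_least) auto
  define c where "c = arg_min_on e (keys g)"
  have c_key: "c \<in> keys g"
    unfolding c_def using b_key(1) by (intro arg_min_if_finite finite_keys) auto
  have c_least: "e c \<le> e c'" if "c' \<in> keys g" for c'
    unfolding c_def using that by (intro arg_min_least) auto
  have "(\<Sum>i\<in>A. lookup b i) = 0" using b_key(2) by (intro sum.neutral) (auto simp: in_keys_iff)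
  then have "(\<Sum>i\<in>A. lookup c i) = 0" using order(3)[of b c] c_least[OF b_key(1)] by (metis gr0I leD)
  then have c_vanishes: "lookup c i = 0" if "i \<in> A" for i using that by simp
  have "lookup (g * f) (c + a) = lookup g c * lookup f a"
  proof (rule lookup_mult_unique)
    fix c' a' assume c': "c' \<in> keys g" and a': "a' \<in> keys f" and same_sum: "c' + a' = c + a"
    have "lookup a' i \<le> lookup a i" if "i \<in> A" for i
      using c_vanishes[OF that] arg_cong[OF same_sum, of "\<lambda>m. lookup m i"] by (simp add: lookup_add)
    then have "a' \<notin> local_exps U A" using local_exps_exp_le_on[of a' U A a] a_outside(2) by blast
    then have "e a \<le> e a'" "e c \<le> e c'" using a_least[OF a'] c_least[OF c'] by auto
    moreover have "e c' + e a' = e c + e a"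
      using arg_cong[OF same_sum, of e] by (simp add: order(2))
    ultimately have "e a = e a'" "e c = e c'"
      by (metis add_less_le_mono add_le_less_mono antisym_conv2 order_less_irrefl)+
    then show "c' = c \<and> a' = a" using order(1) by (auto dest: injD)
  qed (use a_outside c_key in auto)
  then have "c + a \<in> keys (g * f)" using a_outside(1) c_key by (auto simp: in_keys_iff)
  then have "c + a \<in> local_exps U A" using product_in by (auto simp: mon_span_def)
  then have "a \<in> local_exps U A"
    by (rule local_exps_exp_le_on) (simp add: lookup_add c_vanishes)
  with a_outside(2) show False by simp
qed

lemma power_in_ideal_pow: "g \<in> J \<Longrightarrow> g ^ k \<in> ideal_pow J k"
  by (induction k) (auto simp: ideal_mult_def intro!: ideal_gen_inc)

lemma saturation_subset_local_exps:
  fixes J :: "('v::finite, 'k::field) mpoly set"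
  assumes "A \<in> avoiding J"
  shows "saturation (mon_span U) J \<subseteq> mon_span (local_exps U A)"
proof
  fix f assume "f \<in> saturation (mon_span U) J"
  then obtain k where k_mult: "\<forall>y\<in>ideal_pow J k. y * f \<in> mon_span U" by (auto simp: saturation_def)
  obtain g b where g_in: "g \<in> J" and b_key: "b \<in> keys g" "keys b \<inter> A = {}"
    using assms by (auto simp: avoiding_def)
  have "g ^ k * f \<in> mon_span (local_exps U A)"
    using k_mult power_in_ideal_pow[OF g_in] mon_span_mono[OF subset_local_exps] by blast
  then show "f \<in> mon_span (local_exps U A)"
  proof (induction k)
    case (Suc k)
    then show ?case
      using mon_span_local_exps_cancel[OF b_key, of "g ^ k * f" U] by (simp add: mult.assoc)
  qed simp
qed

lemma ideal_pow_degree_ge: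
  fixes J :: "('v::finite, 'k::field) mpoly set"
  assumes "A \<notin> avoiding J"
  shows "ideal_pow J k \<subseteq> mon_span {c. k \<le> (\<Sum>i\<in>A. lookup c i)}"
proof (induction k)
  case (Suc k)
  have J_degree: "J \<subseteq> mon_span {c. 1 \<le> (\<Sum>i\<in>A. lookup c i)}"
  proof (clarsimp simp: mon_span_def)
    fix g a assume "g \<in> J" "a \<in> keys g"
    then obtain i where "i \<in> A" "i \<in> keys a" using assms unfolding avoiding_def by blast
    then show "Suc 0 \<le> (\<Sum>i\<in>A. lookup a i)"
      using member_le_sum[of i A "lookup a"] by (simp add: in_keys_iff)
  qed
  have "{c. 1 \<le> (\<Sum>i\<in>A. lookup c i)} + {c. k \<le> (\<Sum>i\<in>A. lookup c i)} \<subseteq> {c. Suc k \<le> (\<Sum>i\<in>A. lookup c i)}"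
    by (auto simp: lookup_add sum.distrib elim!: set_plus_elim)
  then have "f * g \<in> mon_span {c. Suc k \<le> (\<Sum>i\<in>A. lookup c i)}"
    if "f \<in> J" "g \<in> ideal_pow J k" for f g
    using mon_span_mult[of f _ g] that J_degree Suc.IH mon_span_mono by blast
  moreover have "is_ideal (mon_span {c. Suc k \<le> (\<Sum>i\<in>A. lookup c i)} :: ('v, 'k) mpoly set)"
    by (intro is_ideal_mon_span) (auto simp: upset_def lookup_add sum.distrib)
  ultimately show ?case
    unfolding ideal_pow.simps ideal_mult_def by (intro ideal_gen_minimal) auto
qed (simp add: mon_span_def)

lemma local_exps_add_in_upset:
  fixes \<A> :: "'v::finite set set"
  assumes upset: "upset U" and a_local: "\<And>A. A \<in> \<A> \<Longrightarrow> a \<in> local_exps U A"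
  shows "\<exists>N. \<forall>c. {i. lookup c i < N} \<in> \<A> \<longrightarrow> c + a \<in> U"
proof -
  have "\<forall>A\<in>\<A>. \<exists>u. u \<in> U \<and> exp_le_on A u a" using a_local by (auto simp: local_exps_def)
  then obtain u where witness: "\<And>A. A \<in> \<A> \<Longrightarrow> u A \<in> U" "\<And>A. A \<in> \<A> \<Longrightarrow> exp_le_on A (u A) a"
    by (auto simp: bchoice_iff)
  define N where "N = (\<Sum>(A, i)\<in>UNIV. lookup (u A) i)"
  have le_N: "lookup (u A) i \<le> N" for A i
    unfolding N_def using member_le_sum[of "(A, i)" UNIV "\<lambda>(A, i). lookup (u A) i"] by simp
  have "c + a \<in> U" if small: "{i. lookup c i < N} \<in> \<A>" for c
  proof (rule upset_exp_le[OF upset witness(1)[OF small]], intro ballI)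
    fix i
    show "lookup (u {i. lookup c i < N}) i \<le> lookup (c + a) i"
      using witness(2)[OF small] le_N[of "{i. lookup c i < N}" i]
      by (cases "lookup c i < N") (auto simp: lookup_add trans_le_add1 trans_le_add2)
  qed
  then show ?thesis by blast
qed

theorem saturation_mon_span:
  fixes J :: "('v::finite, 'k::field) mpoly set"
  assumes upset: "upset U"
  shows "saturation (mon_span U) J = mon_span (\<Inter>A\<in>avoiding J. local_exps U A)"
proof (intro equalityI subsetI)
  fix f assume "f \<in> saturation (mon_span U) J"
  then show "f \<in> mon_span (\<Inter>A\<in>avoiding J. local_exps U A)"
    using saturation_subset_local_exps[of _ J U] by (fastforce simp: mon_span_def)
next
  fix f :: "('v, 'k) mpoly" assume "f \<in> mon_span (\<Inter>A\<in>avoiding J. local_exps U A)"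
  then have "\<forall>a\<in>keys f. \<exists>N. \<forall>c. {i. lookup c i < N} \<in> avoiding J \<longrightarrow> c + a \<in> U"
    by (intro ballI local_exps_add_in_upset[OF upset]) (auto simp: mon_span_def)
  then obtain N where shift: "\<And>a c. a \<in> keys f \<Longrightarrow> {i. lookup c i < N a} \<in> avoiding J \<Longrightarrow> c + a \<in> U"
    by (auto simp: bchoice_iff)
  define M where "M = (\<Sum>a\<in>keys f. N a)"
  have add_in_U: "c + a \<in> U" if "a \<in> keys f" "{i. lookup c i < M} \<in> avoiding J" for a c
  proof -
    have "N a \<le> M" unfolding M_def using that(1) by (intro member_le_sum) auto
    then show ?thesis using that by (intro shift avoiding_antimono[OF that(2)]) auto
  qed
  have "g * f \<in> mon_span U" if g_in: "g \<in> ideal_pow J (Suc (CARD('v) * M))" for g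
  proof -
    have "c + a \<in> U" if "c \<in> keys g" "a \<in> keys f" for c a
    proof (rule add_in_U[OF that(2)], rule ccontr)
      let ?A = "{i. lookup c i < M}"
      assume "?A \<notin> avoiding J"
      then have "Suc (CARD('v) * M) \<le> (\<Sum>i\<in>?A. lookup c i)"
        using ideal_pow_degree_ge[of ?A J "Suc (CARD('v) * M)"] g_in that(1)
        by (auto simp: mon_span_def)
      also have "\<dots> \<le> (\<Sum>i\<in>?A. M)" by (intro sum_mono) auto
      also have "\<dots> \<le> CARD('v) * M" by (simp add: card_mono)
      finally show False by simp
    qed
    then show ?thesis using keys_mult[of g f] by (fastforce simp: mon_span_def)
  qed
  then show "f \<in> saturation (mon_span U) J" unfolding saturation_def by blast
qed

lemma avoiding_max_ideal: "avoiding (max_ideal :: ('v, 'k::field) mpoly set) = {A. A \<noteq> UNIV}"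
proof (intro equalityI subsetI)
  fix A :: "'v set" assume "A \<in> {A. A \<noteq> UNIV}"
  then obtain i where "i \<notin> A" by auto
  moreover have "Var i \<in> (max_ideal :: ('v, 'k) mpoly set)"
    unfolding max_ideal_def by (intro ideal_gen_inc) auto
  ultimately show "A \<in> avoiding (max_ideal :: ('v, 'k) mpoly set)"
    unfolding avoiding_def by (force simp: Var_def monom_def)
next
  fix A assume "A \<in> avoiding (max_ideal :: ('v, 'k) mpoly set)"
  then obtain g :: "('v, 'k) mpoly" and a
    where g_key: "g \<in> max_ideal" "a \<in> keys g" "keys a \<inter> A = {}"
    by (auto simp: avoiding_def)
  have "upset {a :: 'v exponent. a \<noteq> 0}"
    by (auto simp: upset_def poly_mapping_eq_iff lookup_add fun_eq_iff)
  moreover have "single i (1::nat) \<noteq> 0" for i :: 'v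
    by (metis lookup_single_eq lookup_zero one_neq_zero)
  ultimately have "max_ideal \<subseteq> (mon_span {a. a \<noteq> 0} :: ('v, 'k) mpoly set)"
    unfolding max_ideal_def
    by (intro ideal_gen_minimal is_ideal_mon_span) (auto simp: Var_def monom_in_mon_span_iff)
  then have "keys a \<noteq> {}" using g_key by (auto simp: mon_span_def)
  then show "A \<in> {A. A \<noteq> UNIV}" using g_key(3) by auto
qed

section \<open>Length of quotients of monomial ideals\<close>

definition initial_exps :: "('v exponent \<Rightarrow> 'o::linorder) \<Rightarrow> 'v exponent set \<Rightarrow>
    ('v, 'k::field) mpoly set \<Rightarrow> 'v exponent set" where
  "initial_exps e U L = {a. \<exists>f\<in>L. is_arg_min e (\<lambda>b. b \<in> keys f - U) a}"

lemma initial_exps_mono: "L \<subseteq> L' \<Longrightarrow> initial_exps e U L \<subseteq> initial_exps e U L'"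
  unfolding initial_exps_def by blast

lemma initial_exps_subset: "L \<subseteq> mon_span V \<Longrightarrow> initial_exps e U L \<subseteq> V - U"
  by (auto simp: initial_exps_def is_arg_min_def mon_span_def)

lemma ex_initial_exp:
  fixes f :: "('v, 'k::field) mpoly" and e :: "'v exponent \<Rightarrow> 'o::linorder"
  assumes "f \<notin> mon_span U"
  obtains a where "is_arg_min e (\<lambda>b. b \<in> keys f - U) a"
  using assms ex_is_arg_min_if_finite[of "keys f - U" e] by (auto simp: mon_span_def)

lemma cancel_initial_exp:
  fixes f g :: "('v, 'k::field) mpoly" and e :: "'v exponent \<Rightarrow> 'o::linorder"
  assumes "inj e" and f_init: "is_arg_min e (\<lambda>b. b \<in> keys f - U) a"
    and g_init: "is_arg_min e (\<lambda>b. b \<in> keys g - U) a"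
  shows "\<exists>c. \<forall>b \<in> keys (f - single 0 c * g) - U. e a < e b"
proof (intro exI ballI)
  define c where "c = lookup f a / lookup g a"
  have lookup_diff: "lookup (f - single 0 c * g) b = lookup f b - c * lookup g b" for b
    unfolding mult_map_scale_conv_mult[symmetric] by (simp add: lookup_minus map.rep_eq when_def)
  fix b assume b_key: "b \<in> keys (f - single 0 c * g) - U"
  then have "b \<in> keys f - U \<or> b \<in> keys g - U" by (auto simp: in_keys_iff lookup_diff)
  then have "e a \<le> e b" using f_init g_init by (auto simp: is_arg_min_linorder)
  moreover have "lookup g a \<noteq> 0" using g_init by (auto simp: is_arg_min_def in_keys_iff)
  then have "lookup (f - single 0 c * g) a = 0" unfolding lookup_diff by (simp add: c_def)
  then have "b \<noteq> a" using b_key by (auto simp: in_keys_iff)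
  then have "e a \<noteq> e b" using \<open>inj e\<close> by (auto dest: injD)
  ultimately show "e a < e b" by simp
qed

text \<open>An element of \<open>L' - L\<close> whose initial exponent is as large as possible can be reduced further.\<close>
lemma ideal_subset_if_initial_exps_subset:
  fixes L L' :: "('v, 'k::field) mpoly set" and e :: "'v exponent \<Rightarrow> 'o::linorder"
  assumes "inj e" and "finite (V - U)" and ideals: "is_ideal L" "is_ideal L'" "L \<subseteq> L'"
    and sandwich: "mon_span U \<subseteq> L" "L' \<subseteq> mon_span V"
    and init: "initial_exps e U L' \<subseteq> initial_exps e U L"
  shows "L' \<subseteq> L"
proof (rule ccontr)
  assume "\<not> L' \<subseteq> L"
  let ?X = "initial_exps e U (L' - L)"
  have fin: "finite (e ` ?X)"
    using initial_exps_subset[of "L' - L" V e U] sandwich(2) \<open>finite (V - U)\<close>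
    by (meson Diff_subset finite_imageI finite_subset subset_trans)
  obtain f0 where "f0 \<in> L' - L" using \<open>\<not> L' \<subseteq> L\<close> by blast
  then obtain a0 where "is_arg_min e (\<lambda>b. b \<in> keys f0 - U) a0"
    using sandwich(1) ex_initial_exp[of f0 U e] by blast
  with \<open>f0 \<in> L' - L\<close> have "?X \<noteq> {}" by (auto simp: initial_exps_def)
  then obtain a where a_init: "a \<in> ?X" and "Max (e ` ?X) = e a" using Max_in[OF fin] by auto
  then have a_max: "e b \<le> e a" if "b \<in> ?X" for b using Max_ge[OF fin, of "e b"] that by simp
  from a_init obtain f where f_init: "f \<in> L'" "f \<notin> L" "is_arg_min e (\<lambda>b. b \<in> keys f - U) a"
    by (auto simp: initial_exps_def)
  then have "a \<in> initial_exps e U L" using init by (auto simp: initial_exps_def)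
  then obtain g where g_init: "g \<in> L" "is_arg_min e (\<lambda>b. b \<in> keys g - U) a"
    by (auto simp: initial_exps_def)
  obtain c where reduced: "\<And>b. b \<in> keys (f - single 0 c * g) - U \<Longrightarrow> e a < e b"
    using cancel_initial_exp[OF \<open>inj e\<close> f_init(3) g_init(2)] by blast
  have multiple_in: "single 0 c * g \<in> L" using g_init(1) ideals(1) by (auto simp: is_ideal_def)
  have "f - single 0 c * g \<in> L'"
    using is_ideal_diff[OF ideals(2) f_init(1)] multiple_in ideals(3) by blast
  moreover have "f - single 0 c * g \<notin> L"
  proof
    assume "f - single 0 c * g \<in> L"
    then have "(f - single 0 c * g) + single 0 c * g \<in> L"
      using multiple_in ideals(1) unfolding is_ideal_def by blast
    with f_init(2) show False by simp
  qed
  moreover obtain b where b_init: "is_arg_min e (\<lambda>b. b \<in> keys (f - single 0 c * g) - U) b"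
    using ex_initial_exp[of "f - single 0 c * g" U e] calculation(2) sandwich(1) by blast
  ultimately have "e b \<le> e a" by (intro a_max) (auto simp: initial_exps_def)
  with reduced[of b] b_init show False by (auto simp: is_arg_min_def)
qed

definition ideal_chain :: "(nat \<Rightarrow> 'a::comm_ring_1 set) \<Rightarrow> nat \<Rightarrow> bool" where
  "ideal_chain L n \<longleftrightarrow> (\<forall>i\<le>n. is_ideal (L i)) \<and> (\<forall>i<n. L i \<subset> L (Suc i))"

lemma quot_length_leI:
  assumes "\<And>L n. L 0 = A \<Longrightarrow> L n = B \<Longrightarrow> ideal_chain L n \<Longrightarrow> enat n \<le> k"
  shows "quot_length A B \<le> k"
  unfolding quot_length_def ideal_chain_def[symmetric] using assms by (auto intro: Sup_least)

lemma length_le_quot_length: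
  assumes "L 0 = A" "L n = B" "ideal_chain L n"
  shows "enat n \<le> quot_length A B"
  unfolding quot_length_def ideal_chain_def[symmetric] using assms by (auto intro!: Sup_upper)

lemma ideal_chain_mono:
  assumes "ideal_chain L n" "i \<le> j" "j \<le> n"
  shows "L i \<subseteq> L j"
  using assms(2,3)
proof (induction j rule: dec_induct)
  case (step j)
  then have "L i \<subseteq> L j" "L j \<subset> L (Suc j)" using assms(1) by (auto simp: ideal_chain_def)
  then show ?case by auto
qed simp

lemma ideal_chain_Suc:
  assumes "is_ideal I" "I \<subset> L 0" "ideal_chain L n"
  shows "ideal_chain (case_nat I L) (Suc n)"
  using assms by (auto simp: ideal_chain_def split: nat.split simp: less_Suc_eq_0_disj)

lemma ideal_chain_length_le:
  fixes L :: "nat \<Rightarrow> ('v::finite, 'k::field) mpoly set"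
  assumes "finite (V - U)" "L 0 = mon_span U" "L n = mon_span V" "ideal_chain L n"
  shows "n \<le> card (V - U)"
proof -
  obtain e :: "'v exponent \<Rightarrow> (nat \<Rightarrow>\<^sub>0 nat)" where order: "inj e"
    using additive_order_refining_degree[of "{} :: 'v set"] by metis
  note mono = ideal_chain_mono[OF assms(4)]
  have subset: "initial_exps e U (L i) \<subseteq> V - U" if "i \<le> n" for i
    using mono[OF that] assms(3) by (intro initial_exps_subset) simp
  have "i \<le> n \<Longrightarrow> i \<le> card (initial_exps e U (L i))" for i
  proof (induction i)
    case (Suc i)
    then have step: "is_ideal (L i)" "is_ideal (L (Suc i))" "L i \<subset> L (Suc i)"
      using assms(4) by (auto simp: ideal_chain_def)
    have "\<not> initial_exps e U (L (Suc i)) \<subseteq> initial_exps e U (L i)"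
      using ideal_subset_if_initial_exps_subset[OF order assms(1) step(1,2)] step(3)
        mono[of 0 i] mono[of "Suc i" n] assms(2,3) Suc.prems by auto
    then have "initial_exps e U (L i) \<subset> initial_exps e U (L (Suc i))"
      using initial_exps_mono[of "L i" "L (Suc i)" e U] step(3) by blast
    then have "card (initial_exps e U (L i)) < card (initial_exps e U (L (Suc i)))"
      using finite_subset[OF subset assms(1)] Suc.prems by (intro psubset_card_mono) auto
    then show ?case using Suc by simp
  qed simp
  from this[of n] show ?thesis using card_mono[OF assms(1) subset[of n]] by simp
qed

definition total_degree :: "'v::finite exponent \<Rightarrow> nat" where
  "total_degree a = (\<Sum>i\<in>UNIV. lookup a i)"

lemma total_degree_add: "total_degree (a + b) = total_degree a + total_degree b"
  by (simp add: total_degree_def lookup_add sum.distrib)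

lemma total_degree_single [simp]: "total_degree (single i k) = k"
  by (simp add: total_degree_def lookup_single when_def)

lemma total_degree_eq_0_iff [simp]: "total_degree a = 0 \<longleftrightarrow> a = 0"
  by (auto simp: total_degree_def poly_mapping_eq_iff fun_eq_iff)

lemma ex_upset_insert:
  fixes U V :: "'v::finite exponent set"
  assumes "finite (V - U)" "upset U" "upset V" "V - U \<noteq> {}"
  obtains a where "a \<in> V - U" "upset (insert a U)"
proof -
  define a where "a = arg_min_on (\<lambda>a. - int (total_degree a)) (V - U)"
  have a_in: "a \<in> V - U" unfolding a_def using assms by (intro arg_min_if_finite)
  have a_max: "total_degree b \<le> total_degree a" if "b \<in> V - U" for b
    using arg_min_least[OF assms(1,4) that, of "\<lambda>a. - int (total_degree a)"] by (simp add: a_def)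
  have "a + c \<in> insert a U" for c
  proof (cases "c = 0")
    case False
    then have "a + c \<notin> V - U" using a_max[of "a + c"] by (auto simp: total_degree_add)
    moreover have "a + c \<in> V" using a_in assms(3) by (auto simp: upset_def)
    ultimately show ?thesis by simp
  qed simp
  with assms(2) have "upset (insert a U)" by (auto simp: upset_def)
  with a_in show thesis by (rule that)
qed

lemma ex_ideal_chain_mon_span:
  assumes "finite (V - U)" "upset U" "upset V" "U \<subseteq> V"
  shows "\<exists>L :: nat \<Rightarrow> ('v::finite, 'k::field) mpoly set.
    L 0 = mon_span U \<and> L (card (V - U)) = mon_span V \<and> ideal_chain L (card (V - U))"
  using assms
proof (induction "card (V - U)" arbitrary: U)
  case 0
  then have "V = U" by auto
  then show ?case
    using is_ideal_mon_span[OF \<open>upset U\<close>]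
    by (intro exI[of _ "\<lambda>_. mon_span U"]) (auto simp: ideal_chain_def)
next
  case (Suc m)
  have "V - U \<noteq> {}" using Suc.hyps(2) by (metis card.empty nat.distinct(1))
  with Suc.prems obtain a where a_new: "a \<in> V - U" "upset (insert a U)" by (elim ex_upset_insert)
  have card_insert: "m = card (V - insert a U)"
    unfolding Diff_insert[of V a U] using Suc.hyps(2) a_new(1) Suc.prems(1) by simp
  have "\<exists>L :: nat \<Rightarrow> ('v, 'k) mpoly set.
      L 0 = mon_span (insert a U) \<and> L m = mon_span V \<and> ideal_chain L m"
    using Suc.hyps(1)[OF card_insert, folded card_insert] Suc.prems a_new by simp
  then obtain L :: "nat \<Rightarrow> ('v, 'k) mpoly set"
    where chain: "L 0 = mon_span (insert a U)" "L m = mon_span V" "ideal_chain L m"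
    by (elim exE conjE) (rule that)
  have "monom a \<in> (mon_span (insert a U) :: ('v, 'k) mpoly set)"
    "monom a \<notin> (mon_span U :: ('v, 'k) mpoly set)"
    using a_new(1) by (simp_all add: monom_in_mon_span_iff)
  then have "mon_span U \<subset> L 0" unfolding chain(1) using mon_span_mono[of U "insert a U"] by blast
  then have "ideal_chain (case_nat (mon_span U) L) (Suc m)"
    by (intro ideal_chain_Suc is_ideal_mon_span \<open>upset U\<close> chain(3))
  then show ?case
    unfolding Suc.hyps(2)[symmetric] using chain(2)
    by (intro exI[of _ "case_nat (mon_span U) L"]) simp
qed

theorem quot_length_mon_span:
  assumes "finite (V - U)" "upset U" "upset V" "U \<subseteq> V"
  shows "quot_length (mon_span U) (mon_span V :: ('v::finite, 'k::field) mpoly set) =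
      enat (card (V - U))"
proof (rule antisym)
  show "quot_length (mon_span U) (mon_span V :: ('v, 'k) mpoly set) \<le> enat (card (V - U))"
    by (rule quot_length_leI) (simp add: ideal_chain_length_le[OF assms(1)])
  obtain L :: "nat \<Rightarrow> ('v, 'k) mpoly set"
    where "L 0 = mon_span U" "L (card (V - U)) = mon_span V" "ideal_chain L (card (V - U))"
    using ex_ideal_chain_mon_span[OF assms, where 'k = 'k] by (elim exE conjE) (rule that)
  then show "enat (card (V - U)) \<le> quot_length (mon_span U) (mon_span V :: ('v, 'k) mpoly set)"
    by (rule length_le_quot_length)
qed

section \<open>Monoids of exponents\<close>

definition power_monoid :: "('r \<Rightarrow> 'v exponent set) \<Rightarrow> ('v exponent \<times> 'r exponent) set" where
  "power_monoid B = is_submonoid hull (\<Union>j. (\<lambda>g. (g, single j 1)) ` B j)"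

definition local_monoid :: "('v exponent \<times> 'r exponent) set \<Rightarrow> 'v set \<Rightarrow>
    ('v exponent \<times> 'r exponent) set" where
  "local_monoid N A = {(a, n). \<exists>b. (b, n) \<in> N \<and> exp_le_on A b a}"

definition sat_monoid :: "('v exponent \<times> 'r exponent) set \<Rightarrow> 'v set set \<Rightarrow>
    ('v exponent \<times> 'r exponent) set" where
  "sat_monoid N \<A> = (\<Inter>A\<in>\<A>. local_monoid N A)"

lemma zero_in_local_monoid: "is_submonoid N \<Longrightarrow> (a, 0) \<in> local_monoid N A"
  using is_submonoid_0[of N] by (auto simp: local_monoid_def zero_prod_def intro!: exI[of _ 0])

lemma is_submonoid_local_monoid:
  assumes "is_submonoid N"
  shows "is_submonoid (local_monoid N A)"
proof (rule is_submonoidI)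
  show "0 \<in> local_monoid N A"
    using zero_in_local_monoid[OF assms, of 0] by (simp add: zero_prod_def)
  fix x y assume "x \<in> local_monoid N A" "y \<in> local_monoid N A"
  then obtain a n b a' n' b' where "x = (a, n)" "(b, n) \<in> N" "exp_le_on A b a"
    "y = (a', n')" "(b', n') \<in> N" "exp_le_on A b' a'" by (auto simp: local_monoid_def)
  moreover from this have "(b + b', n + n') \<in> N"
    using is_submonoid_add[OF assms, of "(b, n)" "(b', n')"] by simp
  ultimately show "x + y \<in> local_monoid N A"
    by (auto simp: local_monoid_def lookup_add intro!: exI[of _ "b + b'"] add_mono)
qed

lemma is_submonoid_sat_monoid: "is_submonoid N \<Longrightarrow> is_submonoid (sat_monoid N \<A>)"
  unfolding sat_monoid_def by (intro is_submonoid_Inter) (auto intro: is_submonoid_local_monoid)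

lemma upset_sat_monoid_fibre:
  assumes "is_submonoid N"
  shows "upset {a. (a, n) \<in> sat_monoid N \<A>}"
proof -
  have "(a + c, n) \<in> sat_monoid N \<A>" if "(a, n) \<in> sat_monoid N \<A>" for a c
    using is_submonoid_add[OF is_submonoid_sat_monoid[OF assms] that, of "(c, 0)"]
      zero_in_local_monoid[OF assms, of c] by (simp add: sat_monoid_def)
  then show ?thesis by (simp add: upset_def)
qed

lemma is_submonoid_power_monoid: "is_submonoid (power_monoid B)"
  unfolding power_monoid_def by (rule is_submonoid_hull)

lemma power_monoid_gen: "g \<in> B j \<Longrightarrow> (g, single j 1) \<in> power_monoid B"
  unfolding power_monoid_def by (intro hull_inc) auto

lemma sum_single_UNIV:
  fixes a :: "'v::finite exponent"
  shows "(\<Sum>i\<in>UNIV. single i (lookup a i)) = a"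
  by (rule poly_mapping_eqI) (simp add: lookup_sum lookup_single when_def)

lemma power_monoid_subset_exp_multipow:
  fixes B :: "'r::finite \<Rightarrow> 'v exponent set"
  assumes "(b, n) \<in> power_monoid B"
  shows "b \<in> exp_multipow (\<lambda>j. B j + UNIV) (lookup n)"
proof -
  let ?U = "\<lambda>j. B j + UNIV"
  let ?E = "{(b, n). b \<in> exp_multipow ?U (lookup n)}"
  have mem: "(\<Sum>k\<in>UNIV. f k) \<in> exp_multipow ?U m" if "\<And>k. f k \<in> exp_pow (?U k) (m k)" for f m
    using that by (auto simp: exp_multipow_def set_sum_alt)
  have "power_monoid B \<subseteq> ?E"
    unfolding power_monoid_def
  proof (rule hull_minimal)
    have "g \<in> exp_multipow ?U (lookup (single j 1))" if "g \<in> B j" for g j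
    proof -
      have "g + 0 + 0 \<in> B j + UNIV + UNIV" by (intro set_plus_intro that UNIV_I)
      then have "(if k = j then g else 0) \<in> exp_pow (?U k) (lookup (single j 1) k)" for k
        by (auto simp: lookup_single when_def)
      from mem[OF this] show ?thesis by simp
    qed
    then show "(\<Union>j. (\<lambda>g. (g, single j 1)) ` B j) \<subseteq> ?E" by auto
    show "is_submonoid ?E"
    proof (rule is_submonoidI)
      show "0 \<in> ?E" using mem[of "\<lambda>_. 0" "lookup 0"] by (simp add: zero_prod_def)
      fix x y assume "x \<in> ?E" "y \<in> ?E"
      then show "x + y \<in> ?E"
        by (auto simp: plus_poly_mapping.rep_eq exp_multipow_add)
    qed
  qed
  with assms show ?thesis by auto
qed

lemma exp_multipow_iff_local_monoid:
  fixes B :: "'r::finite \<Rightarrow> 'v exponent set"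
  shows "a \<in> exp_multipow (\<lambda>j. B j + UNIV) (lookup n) \<longleftrightarrow> (a, n) \<in> local_monoid (power_monoid B) UNIV"
proof
  let ?M = "local_monoid (power_monoid B) UNIV"
  have submonoid: "is_submonoid ?M" by (intro is_submonoid_local_monoid is_submonoid_power_monoid)
  have pow: "(c, single j k) \<in> ?M" if "c \<in> exp_pow (B j + UNIV) k" for c j k
    using that
  proof (induction k arbitrary: c)
    case 0
    then show ?case by (simp add: zero_in_local_monoid is_submonoid_power_monoid)
  next
    case (Suc k)
    then obtain g d e where "c = g + d + e" "g \<in> B j" "e \<in> exp_pow (B j + UNIV) k"
      by (auto elim!: set_plus_elim)
    moreover from this have "(g + d, single j 1) \<in> ?M"
      using power_monoid_gen[of g B j]
      by (auto simp: local_monoid_def lookup_add intro!: exI[of _ g])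
    ultimately show ?case
      using is_submonoid_add[OF submonoid _ Suc.IH, of "(g + d, single j 1)" e]
      by (simp add: single_add[symmetric])
  qed
  assume "a \<in> exp_multipow (\<lambda>j. B j + UNIV) (lookup n)"
  then obtain f where "a = (\<Sum>j\<in>UNIV. f j)" "\<And>j. f j \<in> exp_pow (B j + UNIV) (lookup n j)"
    by (auto simp: exp_multipow_def set_sum_alt)
  then show "(a, n) \<in> ?M"
    using is_submonoid_sum[OF submonoid, of UNIV "\<lambda>j. (f j, single j (lookup n j))"] pow
    by (simp add: sum_prod sum_single_UNIV)
next
  assume "(a, n) \<in> local_monoid (power_monoid B) UNIV"
  then obtain b where "(b, n) \<in> power_monoid B" "exp_le_on UNIV b a"
    by (auto simp: local_monoid_def)
  then show "a \<in> exp_multipow (\<lambda>j. B j + UNIV) (lookup n)"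
    using upset_exp_le[OF upset_exp_multipow power_monoid_subset_exp_multipow] by blast
qed

lemma local_exps_exp_multipow:
  fixes B :: "'r::finite \<Rightarrow> 'v exponent set"
  shows "local_exps (exp_multipow (\<lambda>j. B j + UNIV) (lookup n)) A =
      {a. (a, n) \<in> local_monoid (power_monoid B) A}"
  unfolding local_exps_def exp_multipow_iff_local_monoid Bex_def
  by (auto simp: local_monoid_def) (meson le_trans)

lemma fg_monoid_UNIV: "fg_monoid (UNIV :: 'v::finite exponent set)"
proof -
  let ?H = "is_submonoid hull range (\<lambda>i :: 'v. single i (1::nat))"
  have submonoid: "is_submonoid ?H" by (rule is_submonoid_hull)
  have single: "single i k \<in> ?H" for i k
  proof (induction k)
    case (Suc k)
    have "single i 1 \<in> ?H" by (intro hull_inc) auto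
    from is_submonoid_add[OF submonoid this Suc] show ?case by (simp add: single_add[symmetric])
  qed (use is_submonoid_0[OF submonoid] in simp)
  have "a \<in> ?H" for a
    using is_submonoid_sum[OF submonoid, of UNIV "\<lambda>i. single i (lookup a i)"] single
    by (simp add: sum_single_UNIV)
  then have "UNIV = ?H" by auto
  then show ?thesis using fg_monoid_hull[of "range (\<lambda>i :: 'v. single i (1::nat))"] by simp
qed

lemma fg_monoid_UNIV_Times_0:
  "fg_monoid (UNIV \<times> {0} :: ('v::finite exponent \<times> 'm::comm_monoid_add) set)"
proof -
  have "UNIV \<times> {0} = range (\<lambda>a :: 'v exponent. (a, 0 :: 'm))" by auto
  then show ?thesis by (simp only:) (intro fg_monoid_image fg_monoid_UNIV, auto simp: zero_prod_def)
qed

lemma fg_monoid_UNIV_prod: "fg_monoid (UNIV :: ('v::finite exponent \<times> 'r::finite exponent) set)"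
proof -
  have "fg_monoid (prod.swap ` (UNIV \<times> {0}) :: ('v exponent \<times> 'r exponent) set)"
    by (intro fg_monoid_image fg_monoid_UNIV_Times_0) (auto simp: zero_prod_def)
  then have "fg_monoid (UNIV \<times> {0} + prod.swap ` (UNIV \<times> {0}) :: ('v exponent \<times> 'r exponent) set)"
    by (intro fg_monoid_plus fg_monoid_UNIV_Times_0)
  moreover have "(a, n) \<in> UNIV \<times> {0} + prod.swap ` (UNIV \<times> {0})"
    for a :: "'v exponent" and n :: "'r exponent"
    using set_plus_intro[of "(a, 0)" "UNIV \<times> {0}" "(0, n)" "prod.swap ` (UNIV \<times> {0})"] by force
  ultimately show ?thesis by (metis UNIV_eq_I surj_pair)
qed

lemma fg_monoid_power_monoid:
  fixes B :: "'r::finite \<Rightarrow> 'v exponent set"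
  shows "(\<And>j. finite (B j)) \<Longrightarrow> fg_monoid (power_monoid B)"
  unfolding power_monoid_def by (intro fg_monoid_hull) auto

lemma fg_monoid_local_monoid:
  fixes N :: "('v::finite exponent \<times> 'r exponent) set"
  assumes "fg_monoid N"
  shows "fg_monoid (local_monoid N A)"
proof -
  define restrict where "restrict b = (\<Sum>i\<in>A. single i (lookup b i))" for b :: "'v exponent"
  have lookup_restrict: "lookup (restrict b) i = (if i \<in> A then lookup b i else 0)" for b i
    by (simp add: restrict_def lookup_sum lookup_single when_def)
  have restrict: "restrict 0 = 0" "restrict (a + b) = restrict a + restrict b" for a b
    by (rule poly_mapping_eqI, simp add: lookup_restrict lookup_add)+
  have "local_monoid N A = map_prod restrict id ` N + UNIV \<times> {0}"
  proof (intro equalityI subsetI)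
    fix x assume "x \<in> local_monoid N A"
    then obtain a n b where x_eq: "x = (a, n)" "(b, n) \<in> N" "exp_le_on A b a"
      by (auto simp: local_monoid_def)
    have "exp_le_on UNIV (restrict b) a" using x_eq(3) by (simp add: lookup_restrict)
    then have "x = (restrict b, n) + (a - restrict b, 0)"
      using exp_le_imp_add_diff[of "restrict b" a] by (simp add: x_eq(1))
    also have "\<dots> \<in> map_prod restrict id ` N + UNIV \<times> {0}"
      using x_eq(2) by (intro set_plus_intro) (force simp: map_prod_def)+
    finally show "x \<in> map_prod restrict id ` N + UNIV \<times> {0}" .
  next
    fix x assume "x \<in> map_prod restrict id ` N + UNIV \<times> {0}"
    then obtain b n c where "x = (restrict b + c, n)" "(b, n) \<in> N" by (auto elim!: set_plus_elim)
    then show "x \<in> local_monoid N A"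
      by (auto simp: local_monoid_def lookup_add lookup_restrict intro!: exI[of _ b])
  qed
  moreover have "fg_monoid (map_prod restrict id ` N)"
    by (intro fg_monoid_image assms) (auto simp: restrict zero_prod_def)
  ultimately show ?thesis by (simp add: fg_monoid_plus fg_monoid_UNIV_Times_0)
qed

lemma fg_monoid_sat_monoid:
  fixes N :: "('v::finite exponent \<times> 'r::finite exponent) set"
  assumes "fg_monoid N"
  shows "fg_monoid (sat_monoid N \<A>)"
  unfolding sat_monoid_def using finite[of \<A>]
  by (induction \<A> rule: finite_induct)
    (simp_all add: fg_monoid_UNIV_prod fg_monoid_Int fg_monoid_local_monoid assms)

definition bounded_monoid :: "nat \<Rightarrow> ('v exponent \<times> 'r::finite exponent) set" where
  "bounded_monoid c = {(a, n). \<forall>i. lookup a i \<le> c * total_degree n}"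

lemma is_submonoid_bounded_monoid: "is_submonoid (bounded_monoid c)"
  by (rule is_submonoidI)
    (auto simp: bounded_monoid_def total_degree_add lookup_add distrib_left zero_prod_def
        intro!: add_mono)

lemma power_monoid_bounded:
  fixes B :: "'r::finite \<Rightarrow> 'v::finite exponent set"
  assumes "\<And>j. finite (B j)"
  shows "\<exists>c. power_monoid B \<subseteq> bounded_monoid c"
proof -
  define c where "c = (\<Sum>g\<in>(\<Union>j. B j). total_degree g)"
  have "lookup g i \<le> c" if "g \<in> B j" for g i j
  proof -
    have "lookup g i \<le> total_degree g" unfolding total_degree_def by (intro member_le_sum) auto
    also have "\<dots> \<le> c" unfolding c_def using that assms by (intro member_le_sum) auto
    finally show ?thesis .
  qed
  then have "power_monoid B \<subseteq> bounded_monoid c"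
    unfolding power_monoid_def
    by (intro hull_minimal is_submonoid_bounded_monoid) (auto simp: bounded_monoid_def)
  then show ?thesis ..
qed

lemma lookup_image_box_subset:
  "lookup ` {a :: 'v::finite exponent. \<forall>i. lookup a i < m} \<subseteq> PiE UNIV (\<lambda>_. {..<m})"
  by auto

lemma finite_box: "finite {a :: 'v::finite exponent. \<forall>i. lookup a i < m}"
  by (rule inj_on_finite[OF _ lookup_image_box_subset])
    (auto intro: inj_onI finite_PiE simp: lookup_inject)

lemma card_box_le: "card {a :: 'v::finite exponent. \<forall>i. lookup a i < m} \<le> m ^ CARD('v)"
proof -
  have "card {a :: 'v exponent. \<forall>i. lookup a i < m} \<le> card (PiE (UNIV :: 'v set) (\<lambda>_. {..<m}))"
    by (rule card_inj_on_le[OF _ lookup_image_box_subset])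
      (auto intro: inj_onI finite_PiE simp: lookup_inject)
  then show ?thesis by (simp add: card_PiE)
qed

text \<open>Splitting off one unit of degree, the part \<open>min a c\<close> of the exponent goes with it.\<close>
lemma bounded_monoid_split:
  fixes a :: "'v::finite exponent" and n :: "'r::finite exponent"
  assumes "(a, n) \<in> bounded_monoid c" "n \<noteq> 0"
  obtains b j a' n' where "(a, n) = (b, single j 1) + (a', n')" "\<forall>i. lookup b i < Suc c"
    "(a', n') \<in> bounded_monoid c" "total_degree n' < total_degree n"
proof -
  obtain j where "lookup n j \<noteq> 0" using assms(2) by (auto simp: poly_mapping_eq_iff fun_eq_iff)
  then have n_eq: "n = single j 1 + (n - single j 1)"
    by (intro exp_le_imp_add_diff) (auto simp: lookup_single when_def)
  define b where "b = (\<Sum>i\<in>UNIV. single i (min (lookup a i) c))"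
  have lookup_b: "lookup b i = min (lookup a i) c" for i
    by (simp add: b_def lookup_sum lookup_single when_def)
  have a_eq: "a = b + (a - b)" by (rule exp_le_imp_add_diff) (simp add: lookup_b)
  have degree: "total_degree n = Suc (total_degree (n - single j 1))"
    using arg_cong[OF n_eq, of total_degree] by (simp add: total_degree_add)
  then have "lookup a i \<le> c + c * total_degree (n - single j 1)" for i
    using assms(1) by (simp add: bounded_monoid_def)
  then have "(a - b, n - single j 1) \<in> bounded_monoid c"
    by (simp add: bounded_monoid_def lookup_minus lookup_b min_def le_diff_conv add.commute)
  then show thesis
    using a_eq n_eq lookup_b degree by (intro that[of b j "a - b" "n - single j 1"]) auto
qed

lemma fg_monoid_bounded_monoid:
  "fg_monoid (bounded_monoid c :: ('v::finite exponent \<times> 'r::finite exponent) set)"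
proof -
  let ?S = "{b :: 'v exponent. \<forall>i. lookup b i < Suc c} \<times> range (\<lambda>j :: 'r. single j (1::nat))"
  have "(a, n) \<in> is_submonoid hull ?S" if "(a, n) \<in> bounded_monoid c" for a n
    using that
  proof (induction "total_degree n" arbitrary: a n rule: less_induct)
    case less
    show ?case
    proof (cases "n = 0")
      case True
      then have "(a, n) = 0"
        using less.prems
        by (auto simp: bounded_monoid_def zero_prod_def poly_mapping_eq_iff fun_eq_iff
            total_degree_def)
      then show ?thesis by (simp only: is_submonoid_0[OF is_submonoid_hull])
    next
      case False
      obtain b j a' n' where split: "(a, n) = (b, single j 1) + (a', n')" "\<forall>i. lookup b i < Suc c"
        "(a', n') \<in> bounded_monoid c" "total_degree n' < total_degree n"
        by (rule bounded_monoid_split[OF less.prems False])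
      have "(b, single j 1) \<in> is_submonoid hull ?S" using split(2) by (intro hull_inc) auto
      moreover have "(a', n') \<in> is_submonoid hull ?S" by (rule less.hyps[OF split(4,3)])
      ultimately show ?thesis unfolding split(1) by (rule is_submonoid_add[OF is_submonoid_hull])
    qed
  qed
  moreover have "is_submonoid hull ?S \<subseteq> bounded_monoid c"
    by (intro hull_minimal is_submonoid_bounded_monoid)
      (auto simp: bounded_monoid_def less_Suc_eq_le)
  ultimately have "bounded_monoid c = is_submonoid hull ?S" by auto
  then show ?thesis
    using finite_box by (simp only:) (intro fg_monoid_hull finite_cartesian_product, auto)
qed

lemma finite_bounded_fibre: "finite {a :: 'v::finite exponent. (a, n) \<in> bounded_monoid c}"
  using finite_box[of "Suc (c * total_degree n)"] by (simp add: bounded_monoid_def less_Suc_eq_le)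

lemma quasi_algebra_card_fibre:
  fixes N :: "('v::finite exponent \<times> 'r::finite exponent) set"
  assumes "fg_monoid N" "N \<subseteq> bounded_monoid c"
  obtains f where "f \<in> quasi_algebra affine_maps"
    "\<And>n. f (\<chi> j. int (lookup n j)) = of_nat (card {a. (a, n) \<in> N})"
proof
  define deg :: "'v exponent \<times> 'r exponent \<Rightarrow> int ^ 'r" where
    "deg x = (\<chi> j. int (lookup (snd x) j))" for x
  show "(\<lambda>z. of_nat (card {x\<in>N. deg x = z})) \<in> quasi_algebra affine_maps"
  proof (rule quasi_algebra_card_fg_monoid[OF assms(1)])
    fix x assume "x \<in> N" "x \<noteq> 0"
    then have "snd x \<noteq> 0"
      using assms(2)
      by (cases x) (force simp: bounded_monoid_def zero_prod_def poly_mapping_eq_iff fun_eq_iff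
          total_degree_def)
    then have "0 < total_degree (snd x)" by (simp flip: neq0_conv)
    then show "0 < coord_sum (deg x)"
      by (simp add: coord_sum_def deg_def total_degree_def flip: of_nat_sum)
  qed (simp_all add: deg_def vec_eq_iff lookup_add)
  fix n :: "'r exponent"
  have "deg x = (\<chi> j. int (lookup n j)) \<longleftrightarrow> snd x = n" for x
    by (simp add: deg_def vec_eq_iff poly_mapping_eq_iff fun_eq_iff)
  then have "{x\<in>N. deg x = (\<chi> j. int (lookup n j))} = (\<lambda>a. (a, n)) ` {a. (a, n) \<in> N}" by auto
  then show "of_nat (card {x\<in>N. deg x = (\<chi> j. int (lookup n j))}) = of_nat (card {a. (a, n) \<in> N})"
    by (simp add: card_image inj_on_def)
qed

theorem piecewise_quasi_poly_card_fibre_Diff: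
  fixes M N :: "('v::finite exponent \<times> 'r::finite exponent) set"
  assumes "fg_monoid M" "fg_monoid N" "N \<subseteq> M" and bounded: "M - N \<subseteq> bounded_monoid c"
  shows "piecewise_quasi_poly (\<lambda>n. of_nat (card {a. (a, Abs_poly_mapping n) \<in> M - N}))"
proof -
  let ?fibre = "\<lambda>N n. {a. (a, n) \<in> N \<inter> bounded_monoid c}"
  obtain f where f_count: "f \<in> quasi_algebra affine_maps"
    "\<And>n. f (\<chi> j. int (lookup n j)) = of_nat (card (?fibre M n))"
    using quasi_algebra_card_fibre[of "M \<inter> bounded_monoid c" c] assms(1)
    by (metis fg_monoid_Int fg_monoid_bounded_monoid inf_le2)
  obtain g where g_count: "g \<in> quasi_algebra affine_maps"
    "\<And>n. g (\<chi> j. int (lookup n j)) = of_nat (card (?fibre N n))"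
    using quasi_algebra_card_fibre[of "N \<inter> bounded_monoid c" c] assms(2)
    by (metis fg_monoid_Int fg_monoid_bounded_monoid inf_le2)
  have "of_nat (card {a. (a, n) \<in> M - N}) =
      f (\<chi> j. int (lookup n j)) - g (\<chi> j. int (lookup n j))" for n
  proof -
    have "{a. (a, n) \<in> M - N} = ?fibre M n - ?fibre N n" using bounded by auto
    moreover have "?fibre N n \<subseteq> ?fibre M n" using \<open>N \<subseteq> M\<close> by auto
    moreover have "finite (?fibre M n)"
      by (rule finite_subset[OF _ finite_bounded_fibre[of n c]]) auto
    ultimately show ?thesis
      by (simp add: f_count g_count card_Diff_subset finite_subset card_mono of_nat_diff)
  qed
  then have "(\<lambda>n. of_nat (card {a. (a, Abs_poly_mapping n) \<in> M - N})) =
      (\<lambda>n. f (\<chi> j. int (n j)) - g (\<chi> j. int (n j)))" by simp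
  then show ?thesis
    using piecewise_quasi_poly_quasi_algebra[OF quasi_algebra_diff[OF f_count(1) g_count(1)]]
    by simp
qed

section \<open>The symbolic multi-Rees algebra\<close>

definition monoid_algebra :: "('v exponent \<times> 'r exponent) set \<Rightarrow>
    ('r exponent \<Rightarrow>\<^sub>0 ('v, 'k::field) mpoly) set" where
  "monoid_algebra N = {P. \<forall>n. lookup P n \<in> mon_span {a. (a, n) \<in> N}}"

lemma single_in_monoid_algebra_iff:
  "single n f \<in> monoid_algebra N \<longleftrightarrow> f \<in> mon_span {a. (a, n) \<in> N}"
  by (auto simp: monoid_algebra_def lookup_single when_def mon_span_0)

lemma is_subring_monoid_algebra:
  fixes N :: "('v exponent \<times> 'r exponent) set"
  assumes submonoid: "is_submonoid N"
  shows "is_subring (monoid_algebra N :: ('r exponent \<Rightarrow>\<^sub>0 ('v, 'k::field) mpoly) set)"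
  unfolding is_subring_def
proof (intro conjI ballI)
  have "single 0 1 \<in> (monoid_algebra N :: ('r exponent \<Rightarrow>\<^sub>0 ('v, 'k) mpoly) set)"
    unfolding single_in_monoid_algebra_iff using is_submonoid_0[OF submonoid]
    by (simp add: mon_span_def zero_prod_def)
  then show "1 \<in> (monoid_algebra N :: ('r exponent \<Rightarrow>\<^sub>0 ('v, 'k) mpoly) set)" by simp
  fix P Q :: "'r exponent \<Rightarrow>\<^sub>0 ('v, 'k) mpoly"
  assume P_in: "P \<in> monoid_algebra N" and Q_in: "Q \<in> monoid_algebra N"
  then show "P + Q \<in> monoid_algebra N" "P - Q \<in> monoid_algebra N"
    by (auto simp: monoid_algebra_def lookup_add lookup_minus intro: mon_span_add mon_span_diff)
  have add: "{a. (a, k) \<in> N} + {a. (a, l) \<in> N} \<subseteq> {a. (a, k + l) \<in> N}" for k l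
    using is_submonoid_add[OF submonoid, of "(_, k)" "(_, l)"] by (auto elim!: set_plus_elim)
  have summand: "single (k + l) (lookup P k * lookup Q l) \<in> monoid_algebra N" for k l
    unfolding single_in_monoid_algebra_iff
    using P_in Q_in
    by (intro subsetD[OF mon_span_mono[OF add] mon_span_mult]) (auto simp: monoid_algebra_def)
  have "lookup (P * Q) n \<in> mon_span {a. (a, n) \<in> N}" for n
    unfolding mult_eq_sum_single[of P Q] lookup_sum
    using summand by (intro mon_span_sum) (auto simp: monoid_algebra_def)
  then show "P * Q \<in> monoid_algebra N" by (simp add: monoid_algebra_def)
qed

definition scalars :: "('r exponent \<Rightarrow>\<^sub>0 ('v, 'k::field) mpoly) set" where
  "scalars = range (\<lambda>c. single 0 (single 0 c))"

lemma noetherian_subring_scalars: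
  "noetherian_subring (scalars :: ('r exponent \<Rightarrow>\<^sub>0 ('v, 'k::field) mpoly) set)"
proof (rule noetherian_subring_field)
  let ?\<kappa> = "\<lambda>c. single 0 (single 0 c) :: 'r exponent \<Rightarrow>\<^sub>0 ('v, 'k) mpoly"
  have hom: "?\<kappa> 1 = 1" "?\<kappa> (c + d) = ?\<kappa> c + ?\<kappa> d" "?\<kappa> (c - d) = ?\<kappa> c - ?\<kappa> d"
    "?\<kappa> (c * d) = ?\<kappa> c * ?\<kappa> d" for c d
    by (simp_all add: single_add single_diff mult_single)
  show "is_subring (scalars :: ('r exponent \<Rightarrow>\<^sub>0 ('v, 'k) mpoly) set)"
    unfolding is_subring_def scalars_def
    using rangeI[of ?\<kappa> 1] by (auto simp only: hom(1) hom(2-)[symmetric])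
  fix b :: "'r exponent \<Rightarrow>\<^sub>0 ('v, 'k) mpoly" assume "b \<in> scalars" "b \<noteq> 0"
  then obtain c where b_eq: "b = ?\<kappa> c" by (auto simp: scalars_def)
  with \<open>b \<noteq> 0\<close> have "c \<noteq> 0" by auto
  with b_eq have "?\<kappa> (inverse c) * b = 1" by (simp add: hom(4)[symmetric])
  then show "\<exists>c\<in>scalars. c * b = 1" unfolding scalars_def by blast
qed

lemma single_sum: "single n (sum g A) = (\<Sum>a\<in>A. single n (g a))"
  by (induction A rule: infinite_finite_induct) (auto simp: single_add)

definition monomial_terms :: "('v exponent \<times> 'r exponent) set \<Rightarrow>
    ('r exponent \<Rightarrow>\<^sub>0 ('v, 'k::field) mpoly) set" where
  "monomial_terms C = (\<lambda>(a, n). single n (monom a)) ` C"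

lemma single_single_in_subring_hull:
  fixes C :: "('v exponent \<times> 'r exponent) set" and k :: "'k::field"
  assumes "(a, n) \<in> is_submonoid hull C"
  shows "single n (single a k) \<in> is_subring hull (scalars \<union> monomial_terms C)"
proof -
  let ?H = "is_subring hull (scalars \<union> monomial_terms C) :: ('r exponent \<Rightarrow>\<^sub>0 ('v, 'k) mpoly) set"
  let ?M = "{(a, n). single n (monom a) \<in> ?H}"
  have subring: "is_subring ?H" by (rule is_subring_hull)
  have "C \<subseteq> ?M" by (auto simp: monomial_terms_def intro!: hull_inc)
  moreover have "is_submonoid ?M"
  proof (rule is_submonoidI)
    show "0 \<in> ?M" using is_subring_1[OF subring] by (simp add: zero_prod_def monom_def)
    show "x + y \<in> ?M" if "x \<in> ?M" "y \<in> ?M" for x y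
      using that is_subring_mult[OF subring] by (auto simp: monom_add simp flip: mult_single)
  qed
  ultimately have "single n (monom a) \<in> ?H"
    using hull_minimal[of C ?M is_submonoid] assms by blast
  moreover have "single 0 (single 0 k) \<in> ?H" by (intro hull_inc) (auto simp: scalars_def)
  ultimately have "single 0 (single 0 k) * single n (monom a) \<in> ?H"
    by (intro is_subring_mult[OF subring])
  then show ?thesis by (simp add: mult_single monom_def)
qed

lemma monoid_algebra_hull:
  "(monoid_algebra (is_submonoid hull C) :: ('r exponent \<Rightarrow>\<^sub>0 ('v, 'k::field) mpoly) set) =
    is_subring hull (scalars \<union> monomial_terms C)" (is "?A = ?H")
proof
  show "?H \<subseteq> ?A"
  proof (rule hull_minimal)
    show "scalars \<union> monomial_terms C \<subseteq> ?A"
      using is_submonoid_0[OF is_submonoid_hull, of C]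
      by (auto simp: scalars_def monomial_terms_def single_in_monoid_algebra_iff zero_prod_def
          mon_span_def
          monom_def intro: hull_inc)
  qed (intro is_subring_monoid_algebra is_submonoid_hull)
  show "?A \<subseteq> ?H"
  proof
    fix P assume P_in: "P \<in> ?A"
    have "P = (\<Sum>n\<in>keys P. single n (\<Sum>a\<in>keys (lookup P n). single a (lookup (lookup P n) a)))"
      by (simp only: sum_single_keys)
    also have "\<dots> = (\<Sum>n\<in>keys P. \<Sum>a\<in>keys (lookup P n). single n (single a (lookup (lookup P n) a)))"
      by (simp only: single_sum)
    also have "\<dots> \<in> ?H"
      using P_in by (intro is_subring_sum[OF is_subring_hull] single_single_in_subring_hull)
        (auto simp: monoid_algebra_def mon_span_def)
    finally show "P \<in> ?H" .
  qed
qed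

theorem noetherian_monoid_algebra:
  assumes "fg_monoid N"
  shows "noetherian_subring (monoid_algebra N :: ('r exponent \<Rightarrow>\<^sub>0 ('v, 'k::field) mpoly) set)"
  using assms unfolding fg_monoid_def
  by (auto simp: monoid_algebra_hull monomial_terms_def
      intro!: noetherian_subring_hull noetherian_subring_scalars)

lemma ideal_multipow_0: "ideal_multipow I (\<lambda>_. 0) = UNIV"
proof -
  have "1 \<in> ideal_multipow I (\<lambda>_. 0)"
    unfolding ideal_multipow_def by (intro ideal_gen_inc) (auto intro!: exI[of _ "\<lambda>_. 1"])
  then have "x * 1 \<in> ideal_multipow I (\<lambda>_. 0)" for x
    using is_ideal_ideal_gen unfolding ideal_multipow_def is_ideal_def by blast
  then show ?thesis by auto
qed

lemma single_in_symb_multi_rees_iff: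
  "single n f \<in> symb_multi_rees J I \<longleftrightarrow> f \<in> saturation (ideal_multipow I (lookup n)) J"
proof -
  have "0 \<in> saturation (ideal_multipow I (lookup m)) J" for m
    using is_ideal_ideal_gen by (auto simp: saturation_def ideal_multipow_def is_ideal_def)
  then show ?thesis by (auto simp: symb_multi_rees_def lookup_single when_def)
qed

lemma single_0_in_symb_multi_rees: "single 0 f \<in> symb_multi_rees J I"
  by (simp add: single_in_symb_multi_rees_iff saturation_def zero_poly_mapping.rep_eq
      ideal_multipow_0)

lemma ideal_multipow_eq_mon_span:
  fixes B :: "'r::finite \<Rightarrow> 'v exponent set"
  shows "ideal_multipow (\<lambda>j. mon_span (B j + UNIV)) (lookup n) =
    (mon_span {a. (a, n) \<in> local_monoid (power_monoid B) UNIV} :: ('v, 'k::field) mpoly set)"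
  by (simp add: ideal_multipow_mon_span flip: exp_multipow_iff_local_monoid)

lemma saturation_multipow_eq_mon_span:
  fixes B :: "'r::finite \<Rightarrow> 'v::finite exponent set" and J :: "('v, 'k::field) mpoly set"
  shows "saturation (ideal_multipow (\<lambda>j. mon_span (B j + UNIV)) (lookup n)) J =
    mon_span {a. (a, n) \<in> sat_monoid (power_monoid B) (avoiding J)}"
proof -
  have "(\<Inter>A\<in>avoiding J. local_exps (exp_multipow (\<lambda>j. B j + UNIV) (lookup n)) A) =
      {a. (a, n) \<in> sat_monoid (power_monoid B) (avoiding J)}"
    by (auto simp: local_exps_exp_multipow sat_monoid_def)
  then show ?thesis
    by (simp add: ideal_multipow_mon_span saturation_mon_span[OF upset_exp_multipow])
qed

lemma symb_multi_rees_eq_monoid_algebra: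
  fixes B :: "'r::finite \<Rightarrow> 'v::finite exponent set" and J :: "('v, 'k::field) mpoly set"
  shows "symb_multi_rees J (\<lambda>j. mon_span (B j + UNIV)) =
      monoid_algebra (sat_monoid (power_monoid B) (avoiding J))"
  by (simp add: symb_multi_rees_def monoid_algebra_def saturation_multipow_eq_mon_span)

lemma monomial_ideals_eq_mon_span:
  fixes I :: "'r \<Rightarrow> ('v::finite, 'k::field) mpoly set"
  assumes "\<And>j. monomial_ideal (I j)"
  obtains B where "\<And>j. finite (B j)" "I = (\<lambda>j. mon_span (B j + UNIV))"
proof -
  have "\<forall>j. \<exists>B. finite B \<and> I j = mon_span (B + UNIV)"
    by (intro allI monomial_ideal_finitely_generated assms)
  then show thesis using that by (auto simp: choice_iff)
qed

theorem noetherian_symb_multi_rees: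
  fixes I :: "'r::finite \<Rightarrow> ('v::finite, 'k::field) mpoly set"
  assumes "\<And>j. monomial_ideal (I j)"
  shows "noetherian_subring (symb_multi_rees J I)"
proof -
  obtain B where "\<And>j. finite (B j)" "I = (\<lambda>j. mon_span (B j + UNIV))"
    using monomial_ideals_eq_mon_span[of I, OF assms] by blast
  then show ?thesis
    by (simp add: symb_multi_rees_eq_monoid_algebra noetherian_monoid_algebra fg_monoid_sat_monoid
        fg_monoid_power_monoid)
qed

section \<open>The local cohomology length\<close>

definition torsion_exps :: "('v exponent \<times> 'r exponent) set \<Rightarrow> ('v exponent \<times> 'r exponent) set" where
  "torsion_exps N = sat_monoid N {A. A \<noteq> UNIV} - local_monoid N UNIV"

lemma local_monoid_UNIV_subset_sat_monoid: "local_monoid N UNIV \<subseteq> sat_monoid N \<A>"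
  by (auto simp: local_monoid_def sat_monoid_def)

text \<open>Dropping only the variable \<open>X\<^sub>i\<close> yields \<open>b\<close> that fails only by \<open>lookup a i < lookup b i\<close>.\<close>
lemma torsion_exps_bound:
  assumes bounded: "N \<subseteq> bounded_monoid c" and a_in: "(a, n) \<in> torsion_exps N"
  shows "lookup a i < c * total_degree n"
proof -
  have "UNIV - {i} \<noteq> UNIV" by blast
  then have "(a, n) \<in> local_monoid N (UNIV - {i})"
    using a_in by (auto simp: torsion_exps_def sat_monoid_def)
  then obtain b where b_in: "(b, n) \<in> N" "exp_le_on (UNIV - {i}) b a"
    by (auto simp: local_monoid_def)
  have "\<not> lookup b i \<le> lookup a i"
  proof
    assume "lookup b i \<le> lookup a i"
    then have "exp_le_on UNIV b a" using b_in(2) by (metis DiffI UNIV_I singletonD)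
    then show False using a_in b_in(1) by (auto simp: torsion_exps_def local_monoid_def)
  qed
  moreover have "lookup b i \<le> c * total_degree n"
    using bounded b_in(1) by (auto simp: bounded_monoid_def)
  ultimately show ?thesis by simp
qed

lemma torsion_fibre_subset_box:
  "N \<subseteq> bounded_monoid c \<Longrightarrow> {a. (a, n) \<in> torsion_exps N} \<subseteq> {a. \<forall>i. lookup a i < c * total_degree n}"
  by (auto intro: torsion_exps_bound)

lemma card_torsion_fibre_le:
  fixes N :: "('v::finite exponent \<times> 'r::finite exponent) set"
  assumes "N \<subseteq> bounded_monoid c"
  shows "card {a. (a, n) \<in> torsion_exps N} \<le> (c * total_degree n) ^ CARD('v)"
  using card_mono[OF finite_box torsion_fibre_subset_box[OF assms]] card_box_le
  by (rule order_trans)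

lemma piecewise_quasi_poly_card_torsion_fibre:
  fixes N :: "('v::finite exponent \<times> 'r::finite exponent) set"
  assumes "fg_monoid N" "N \<subseteq> bounded_monoid c"
  shows "piecewise_quasi_poly (\<lambda>n. of_nat (card {a. (a, Abs_poly_mapping n) \<in> torsion_exps N}))"
  unfolding torsion_exps_def
proof (rule piecewise_quasi_poly_card_fibre_Diff)
  show "sat_monoid N {A. A \<noteq> UNIV} - local_monoid N UNIV \<subseteq> bounded_monoid c"
    unfolding torsion_exps_def[symmetric] using torsion_exps_bound[OF assms(2)]
    by (auto simp: bounded_monoid_def intro: less_imp_le)
qed (intro fg_monoid_sat_monoid fg_monoid_local_monoid assms local_monoid_UNIV_subset_sat_monoid)+

theorem H0_length_eq_card_torsion_fibre:
  fixes B :: "'r::finite \<Rightarrow> 'v::finite exponent set"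
  assumes "power_monoid B \<subseteq> bounded_monoid c"
  shows "H0_length
      (ideal_multipow (\<lambda>j. mon_span (B j + UNIV) :: ('v, 'k::field) mpoly set) (lookup n)) =
    enat (card {a. (a, n) \<in> torsion_exps (power_monoid B)})"
proof -
  let ?U = "{a. (a, n) \<in> local_monoid (power_monoid B) UNIV}"
  let ?V = "{a. (a, n) \<in> sat_monoid (power_monoid B) {A. A \<noteq> UNIV}}"
  have fibre: "?V - ?U = {a. (a, n) \<in> torsion_exps (power_monoid B)}"
    by (auto simp: torsion_exps_def)
  have "upset ?V" by (intro upset_sat_monoid_fibre is_submonoid_power_monoid)
  moreover have "upset ?U"
    using upset_sat_monoid_fibre[OF is_submonoid_power_monoid, of n B "{UNIV}"]
    by (simp add: sat_monoid_def)
  moreover have "finite (?V - ?U)"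
    unfolding fibre by (rule finite_subset[OF torsion_fibre_subset_box[OF assms] finite_box])
  moreover have "?U \<subseteq> ?V" using local_monoid_UNIV_subset_sat_monoid by auto
  ultimately have "quot_length (mon_span ?U) (mon_span ?V :: ('v, 'k) mpoly set) =
      enat (card (?V - ?U))"
    by (intro quot_length_mon_span)
  then show ?thesis
    unfolding H0_length_def saturation_multipow_eq_mon_span
    by (simp add: ideal_multipow_eq_mon_span avoiding_max_ideal fibre)
qed

section \<open>Numerical polynomial bounds\<close>

lemma poly_eval_eq: "poly_eval D c x = (\<Sum>i\<in>{i. sum i UNIV \<le>
    D}. c i * power_product (\<lambda>j. of_int (x j)) i)"
  by (simp add: poly_eval_def power_product_def)

lemma poly_eval_sum: "poly_eval D (\<lambda>i. \<Sum>j\<in>A. c j i) x = (\<Sum>j\<in>A. poly_eval D (c j) x)"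
  unfolding poly_eval_def sum_distrib_right by (rule sum.swap)

lemma poly_eval_scale: "poly_eval D (\<lambda>i. b * c i) x = b * poly_eval D c x"
  unfolding poly_eval_def sum_distrib_left by (simp add: mult.assoc)

lemma poly_eval_mult_coordinate:
  fixes c :: "('r::finite \<Rightarrow> nat) \<Rightarrow> rat"
  shows "\<exists>c'. \<forall>x. poly_eval (Suc D) c' x = of_int (x j) * poly_eval D c x"
proof (intro exI allI)
  fix x :: "'r \<Rightarrow> int"
  let ?y = "\<lambda>j. of_int (x j) :: rat"
  let ?raise = "\<lambda>i. i(j := Suc (i j)) :: 'r \<Rightarrow> nat"
  let ?c = "\<lambda>i. if i j = 0 then 0 else c (i(j := i j - 1))"
  have raise_eq: "?raise i = (\<lambda>k. of_bool (k = j) + i k)" for i by auto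
  have sum_raise: "sum (?raise i) UNIV = Suc (sum i UNIV)" for i
    unfolding raise_eq by (simp add: sum.distrib)
  have "i \<in> ?raise ` {i. sum i UNIV \<le> D}" if "sum i UNIV \<le> Suc D" "i j \<noteq> 0" for i
  proof (rule image_eqI)
    show lowered: "i = ?raise (i(j := i j - 1))" using that(2) by auto
    show "i(j := i j - 1) \<in> {i. sum i UNIV \<le> D}"
      using that(1) arg_cong[OF lowered, of "\<lambda>i. sum i UNIV"] unfolding sum_raise by simp
  qed
  then have "poly_eval (Suc D) ?c x = (\<Sum>i\<in>?raise ` {i. sum i UNIV \<le> D}. ?c i * power_product ?y i)"
    unfolding poly_eval_eq
    by (intro sum.mono_neutral_right finite_sum_le) (auto simp: sum_raise simp del: fun_upd_apply)
  also have "\<dots> = (\<Sum>i\<in>{i. sum i UNIV \<le> D}. c i * power_product ?y (?raise i))"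
    by (subst sum.reindex) (auto simp: inj_on_def fun_eq_iff)
  also have "\<dots> = of_int (x j) * poly_eval D c x"
    by (simp add: raise_eq power_product_add poly_eval_eq sum_distrib_left mult_ac del:
        fun_upd_apply)
  finally show "poly_eval (Suc D) ?c x = of_int (x j) * poly_eval D c x" .
qed

lemma ex_poly_eval_linear_power:
  "\<exists>c. \<forall>x :: 'r::finite \<Rightarrow> int. poly_eval D c x = (b * (\<Sum>j\<in>UNIV. of_int (x j))) ^ D"
proof (induction D)
  case 0
  have "{i :: 'r \<Rightarrow> nat. sum i UNIV \<le> 0} = {\<lambda>_. 0}" by auto
  then show ?case by (intro exI[of _ "\<lambda>_. 1"]) (simp add: poly_eval_def)
next
  case (Suc D)
  then obtain c where coeffs: "\<And>x :: 'r \<Rightarrow> int. poly_eval D c x = (b * (\<Sum>j\<in>UNIV. of_int (x j))) ^ D"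
    by auto
  obtain c' where c': "\<And>j x. poly_eval (Suc D) (c' j) x = of_int (x j) * poly_eval D c x"
    using poly_eval_mult_coordinate[of D _ c] by metis
  have "poly_eval (Suc D) (\<lambda>i. b * (\<Sum>j\<in>UNIV. c' j i)) x =
      (b * (\<Sum>j\<in>UNIV. of_int (x j))) ^ Suc D" for x
    by (simp add: poly_eval_scale poly_eval_sum c' coeffs sum_distrib_right mult.assoc)
  then show ?case by blast
qed

lemma ex_numerical_poly_linear_power:
  "\<exists>p. numerical_poly D p \<and> (\<forall>n :: 'r::finite \<Rightarrow> nat.
    poly_eval D p (\<lambda>j. int (n j)) = of_nat ((c * (\<Sum>j\<in>UNIV. n j)) ^ D))"
proof -
  obtain p where p_eq: "\<And>x :: 'r \<Rightarrow> int. poly_eval D p x = (of_nat c * (\<Sum>j\<in>UNIV. of_int (x j))) ^ D"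
    using ex_poly_eval_linear_power[of D "of_nat c"] by blast
  have "numerical_poly D p"
    unfolding numerical_poly_def p_eq by (auto intro!: Ints_power Ints_mult Ints_sum)
  with p_eq show ?thesis by auto
qed

lemma card_torsion_fibre_le_numerical_poly:
  fixes N :: "('v::finite exponent \<times> 'r::finite exponent) set"
  assumes "N \<subseteq> bounded_monoid c"
  obtains p where "numerical_poly CARD('v) p"
    "\<And>n. of_nat (card {a. (a, Abs_poly_mapping n) \<in> torsion_exps N}) \<le>
      poly_eval CARD('v) p (\<lambda>j. int (n j))"
proof -
  obtain p where "numerical_poly CARD('v) p" and eval: "\<And>n :: 'r \<Rightarrow> nat.
      poly_eval CARD('v) p (\<lambda>j. int (n j)) = of_nat ((c * (\<Sum>j\<in>UNIV. n j)) ^ CARD('v))"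
    using ex_numerical_poly_linear_power by blast
  have "of_nat (card {a. (a, Abs_poly_mapping n) \<in> torsion_exps N}) \<le>
      poly_eval CARD('v) p (\<lambda>j. int (n j))" for n
    unfolding eval of_nat_le_iff
    using card_torsion_fibre_le[OF assms, of "Abs_poly_mapping n"] by (simp add: total_degree_def)
  with \<open>numerical_poly CARD('v) p\<close> show thesis by (rule that)
qed

theorem theorem1p2:
  fixes I :: "'r::finite \<Rightarrow> ('v::finite, 'k::field) mpoly set"
    and J :: "('v, 'k) mpoly set"
  assumes mon: "\<And>j. monomial_ideal (I j)"
    and J: "is_ideal J"
  shows "noetherian_subring (symb_multi_rees J I)
       \<and> (\<forall>f. Poly_Mapping.single 0 f \<in> symb_multi_rees J I)
       \<and> (\<forall>P\<in>symb_multi_rees J I. \<forall>n.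
            Poly_Mapping.single n (Poly_Mapping.lookup P n) \<in> symb_multi_rees J I)
       \<and> (\<exists>F :: ('r \<Rightarrow> nat) \<Rightarrow> nat.
           piecewise_quasi_poly (\<lambda>n. of_nat (F n)) \<and>
           (\<exists>N. \<forall>n. (\<forall>j. n j \<ge> N) \<longrightarrow> H0_length (ideal_multipow I n) = enat (F n)))
       \<and> (\<exists>c N. numerical_poly CARD('v) c \<and>
           (\<forall>n. (\<forall>j. n j \<ge> N) \<longrightarrow>
              (\<exists>k. H0_length (ideal_multipow I n) = enat k \<and>
                   of_nat k \<le> poly_eval CARD('v) c (\<lambda>j. int (n j)))))"
proof -
  obtain B where finite_gens: "\<And>j. finite (B j)" and I_eq: "I = (\<lambda>j. mon_span (B j + UNIV))"
    using monomial_ideals_eq_mon_span[of I, OF mon] by blast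
  obtain c where bounded: "power_monoid B \<subseteq> bounded_monoid c"
    using power_monoid_bounded finite_gens by blast
  define F where "F n = card {a. (a, Abs_poly_mapping n) \<in> torsion_exps (power_monoid B)}" for n
  have length: "H0_length (ideal_multipow I n) = enat (F n)" for n
    using H0_length_eq_card_torsion_fibre[OF bounded, of "Abs_poly_mapping n"]
    by (simp add: I_eq F_def)
  have quasi_poly: "piecewise_quasi_poly (\<lambda>n. of_nat (F n))"
    unfolding F_def
    by (intro piecewise_quasi_poly_card_torsion_fibre[OF _ bounded] fg_monoid_power_monoid
        finite_gens)
  obtain p where "numerical_poly CARD('v) p"
    and "\<And>n. of_nat (F n) \<le> poly_eval CARD('v) p (\<lambda>j. int (n j))"
    unfolding F_def by (rule card_torsion_fibre_le_numerical_poly[OF bounded]) blast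
  moreover have "single n (lookup P n) \<in> symb_multi_rees J I" if "P \<in> symb_multi_rees J I" for P n
    using that unfolding single_in_symb_multi_rees_iff by (simp add: symb_multi_rees_def)
  ultimately show ?thesis
    using noetherian_symb_multi_rees[OF mon] single_0_in_symb_multi_rees length quasi_poly by auto
qed

end
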